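(* Let $F$ be a finite field of characteristic $p$, let $V_1,V_2$ be finite-dimensional vector spaces over $F$, and let $a \colon V_1 \to V_1$, $b \colon V_2 \to V_1$, $c\colon V_1 \to V_2$, $d \colon V_2 \to V_2$ be linear maps such that $a$, $d$ and $\begin{pmatrix} a & b \\ c & d \end{pmatrix}$ are invertible. Let $\mathcal A=(V_1,V_2,a,b,c,d)$ and let $\Gamma_{\mathcal A}$ be the associated BMW group. If $$\det\begin{pmatrix} 1-ax & bx \\ cy & 1-dy \end{pmatrix} \neq \det(1-ax) \det(1-dy)$$ in the polynomial ring $F[x, y]$, then $\Gamma_{\mathcal A}$ is irreducible, and it contains a fractal anti-torus spanned by a pair $(v_1, v_2) \in V_1 \oplus V_2$. More precisely, the natural coloring of the anti-torus spanned by that pair $(v_1, v_2)$ (viewed as a pair of generators of $\Gamma_{\mathcal A}$) forms a tiling $\mathcal T \colon \mathbf Z^2 \to V_1 \oplus V_2$ that is generated by a substitution of length $p$. Moreover there exist $s\geq 0$ and $t \geq 1$ such that the tiling $\mathcal T^{p^s}$ by blocks of size $p^s$ determined by $\mathcal T$ is invariant under a substitution of length $p^t$.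
   Context: The group. $\begin{pmatrix} a & b\\ c& d\end{pmatrix}$ denotes the linear operator on $V_1\oplus V_2$ mapping $(v_1,v_2)$ to $(av_1+bv_2,\,cv_1+dv_2)$. Define $$\Gamma_{\mathcal A} = \langle V_1 \sqcup V_2 \mid v_1\cdot (cv_1 + d v_2) = v_2 \cdot (av_1 + bv_2) \ \ \forall (v_1, v_2) \in V_1\oplus V_2\rangle,$$ where $\cdot$ is the group multiplication; the same symbol is used for a vector of $V_1$ or $V_2$ and for the corresponding generator (the zero vectors of $V_1$ and of $V_2$ give two different generators, which are not trivial in the group). The action. Under the invertibility assumptions, $\Gamma_{\mathcal A}$ is a BMW group of degree $(2|V_1|,2|V_2|)$: it acts regularly (sharply transitively) on the vertices of a product $T_1\times T_2$ of regular trees of valencies $2|V_1|$, $2|V_2|$. This square complex has the Cayley graph of $\Gamma_{\mathcal A}$ with respect to $V_1\sqcup V_2$ as $1$-skeleton; edges in the $T_i$-direction are those labelled by $V_i$, and squares are labelled by the defining relators, i.e. by elements of $V_1\oplus V_2$. Anti-torus. For a group $\Gamma$ acting properly and cocompactly on a CAT(0) space $X$, an anti-torus is a $2$-dimensional flat $P$ in $X$ which is the convex hull of two non-parallel geodesic lines that are translation axes of hyperbolic isometries $\gamma_1,\gamma_2\in\Gamma$, and such that the stabilizer of $P$ in $\Gamma$ does not act cocompactly on $P$; it is then said to be spanned by $\gamma_1,\gamma_2$. Irreducible (usual meaning): $\Gamma_{\mathcal A}$ has no finite index subgroup of the form $\Lambda_1\times\Lambda_2$ with $\Lambda_i\le\mathrm{Aut}(T_i)$.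 Natural coloring. For $(v_1,v_2)\in V_1\oplus V_2$, let $\ell_i$ be the translation axis of the generator $v_i$ through the identity vertex $e$ (with vertex set $\langle v_i\rangle$), a line in the $T_i$-direction, and let $P_{v_1,v_2}$ be the flat spanned by $\ell_1\cup\ell_2$, with vertex set identified with $\langle v_1\rangle\times\langle v_2\rangle$. Let $g_{m,n}\in\Gamma_{\mathcal A}$ be the vertex of $P_{v_1,v_2}$ with coordinates $(v_1^m,v_2^n)$. The natural coloring is the map $\mathbf Z^2\to V_1\oplus V_2$ sending $(m,n)$ to the relator labelling the square with vertices $g_{m,n},g_{m+1,n},g_{m,n+1},g_{m+1,n+1}$, i.e. to the pair $(u_1,u_2)$ with $u_1=g_{m,n}^{-1}g_{m+1,n}\in V_1$ and $u_2=g_{m,n}^{-1}g_{m,n+1}\in V_2$. Tilings. Let $V$ be a finite set; a map $\mathcal T\colon\mathbf Z^2\to V$ is called a tiling with color set $V$. For $\ell\ge1$ put $\mathcal I=\{0,1,\dots,\ell-1\}$. The tiling by blocks of size $\ell$ determined by $\mathcal T$ is $\mathcal T^\ell\colon\mathbf Z^2\to V^{\mathcal I^2}$ with $\mathcal T^\ell(\alpha)(\beta)=\mathcal T(\ell\alpha+\beta)$ for $\alpha\in\mathbf Z^2$, $\beta\in\mathcal I^2$. The tiling $\mathcal T$ is invariant under a substitution of length $\ell\ge2$ if there is a map $\mathcal S\colon V\to V^{\mathcal I^2}$, $v\mapsto\mathcal S_v$, such that $\mathcal T(\ell\alpha+\beta)=\mathcal S_{\mathcal T(\alpha)}(\beta)$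 for all $\alpha\in\mathbf Z^2$, $\beta\in\mathcal I^2$. It is generated by a substitution of length $\ell$ if there are a finite set $W$, a tiling $\overline{\mathcal T}\colon\mathbf Z^2\to W$ invariant under a substitution of length $\ell$, and a map $\tau\colon W\to V$ with $\mathcal T=\tau\circ\overline{\mathcal T}$. The term "fractal" in the statement is made precise by its second paragraph. *)

theory Defs
  imports
    "HOL-Analysis.Abstract_Metric_Spaces"
    "HOL-Algebra.Bij"
    "HOL-Algebra.Coset"
    "HOL-Algebra.Generated_Groups"
    "Jordan_Normal_Form.Determinant"
begin

section \<open>Group presentations\<close>

text \<open>The letter \<open>(x, True)\<close> stands for the generator \<open>x\<close>, the letter \<open>(x, False)\<close> for its
  inverse. A set \<open>R\<close> of pairs of words is read as the set of relations \<open>u = v\<close>, \<open>(u, v) \<in> R\<close>.\<close>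

type_synonym 'g word = "('g \<times> bool) list"

inductive pres_eq :: "('g word \<times> 'g word) set \<Rightarrow> 'g word \<Rightarrow> 'g word \<Rightarrow> bool"
  for R where
  pres_refl: "pres_eq R u u"
| pres_sym: "pres_eq R u v \<Longrightarrow> pres_eq R v u"
| pres_trans: "pres_eq R u v \<Longrightarrow> pres_eq R v w \<Longrightarrow> pres_eq R u w"
| pres_append: "pres_eq R u v \<Longrightarrow> pres_eq R u' v' \<Longrightarrow> pres_eq R (u @ u') (v @ v')"
| pres_cancel: "pres_eq R [(x, e), (x, \<not> e)] []"
| pres_rel: "(u, v) \<in> R \<Longrightarrow> pres_eq R u v"

definition pres_class :: "('g word \<times> 'g word) set \<Rightarrow> 'g word \<Rightarrow> 'g word set" where
  "pres_class R u = {v. pres_eq R u v}"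

definition presented_group :: "('g word \<times> 'g word) set \<Rightarrow> 'g word set monoid" where
  "presented_group R =
     \<lparr>carrier = range (pres_class R),
      monoid.mult = (\<lambda>A B. {w. \<exists>u\<in>A. \<exists>v\<in>B. pres_eq R (u @ v) w}),
      monoid.one = pres_class R []\<rparr>"

definition pres_gen :: "('g word \<times> 'g word) set \<Rightarrow> 'g \<Rightarrow> 'g word set" where
  "pres_gen R x = pres_class R [(x, True)]"

lemma pres_class_eq_iff: "pres_class R u = pres_class R v \<longleftrightarrow> pres_eq R u v"
  unfolding pres_class_def by (blast intro: pres_refl pres_sym pres_trans)

lemma presented_group_mult:
  "pres_class R u \<otimes>\<^bsub>presented_group R\<^esub> pres_class R v = pres_class R (u @ v)"
  unfolding presented_group_def pres_class_def
  by (auto intro: pres_refl pres_sym pres_trans pres_append)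

lemma pres_eq_inverse: "pres_eq R (rev (map (\<lambda>(x, e). (x, \<not> e)) u) @ u) []"
proof (induction u)
  case Nil
  show ?case by (simp add: pres_refl)
next
  case (Cons l u)
  obtain x e where l: "l = (x, e)" by fastforce
  let ?r = "rev (map (\<lambda>(x, e). (x, \<not> e)) u)"
  have "pres_eq R [(x, \<not> e), (x, e)] []"
    using pres_cancel[of R x "\<not> e"] by simp
  then have "pres_eq R (?r @ [(x, \<not> e), (x, e)] @ u) (?r @ [] @ u)"
    by (intro pres_append pres_refl)
  with Cons.IH show ?case
    using l by (auto intro: pres_trans)
qed

lemma carrier_presented_group: "carrier (presented_group R) = range (pres_class R)"
  by (simp add: presented_group_def)

lemma one_presented_group: "\<one>\<^bsub>presented_group R\<^esub> = pres_class R []"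
  by (simp add: presented_group_def)

lemma group_presented_group: "group (presented_group R)"
proof (rule groupI)
  fix A assume "A \<in> carrier (presented_group R)"
  then obtain u where A: "A = pres_class R u"
    by (auto simp: carrier_presented_group)
  let ?B = "pres_class R (rev (map (\<lambda>(x, e). (x, \<not> e)) u))"
  have "?B \<otimes>\<^bsub>presented_group R\<^esub> A = \<one>\<^bsub>presented_group R\<^esub>"
    by (simp add: A presented_group_mult one_presented_group pres_class_eq_iff pres_eq_inverse)
  then show "\<exists>B\<in>carrier (presented_group R). B \<otimes>\<^bsub>presented_group R\<^esub> A = \<one>\<^bsub>presented_group R\<^esub>"
    by (auto simp: carrier_presented_group)
qed (auto simp: carrier_presented_group one_presented_group presented_group_mult)


section \<open>Graphs and their geometric realization\<close>

record 'a ugraph =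
  verts :: "'a set"
  edges :: "'a set set"

definition graph_aut :: "'a ugraph \<Rightarrow> ('a \<Rightarrow> 'a) monoid" where
  "graph_aut T = (BijGroup (verts T))
     \<lparr>carrier := {f \<in> Bij (verts T).
        \<forall>x\<in>verts T. \<forall>y\<in>verts T. {f x, f y} \<in> edges T \<longleftrightarrow> {x, y} \<in> edges T}\<rparr>"

text \<open>Points of the realization are given by their barycentric coordinates, and every edge is
  isometric to the unit interval. On a common closed edge the distance is half the \<open>l\<^sub>1\<close>-distance
  of the coordinates; in general it is the induced length metric, i.e. the infimum of the
  lengths of piecewise linear paths.\<close>

definition closed_cell :: "'a set \<Rightarrow> ('a \<Rightarrow> real) set" where
  "closed_cell s = {\<xi>. (\<forall>x. 0 \<le> \<xi> x) \<and> (\<forall>x. x \<notin> s \<longrightarrow> \<xi> x = 0) \<and> sum \<xi> s = 1}"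

definition graph_cells :: "'a ugraph \<Rightarrow> 'a set set" where
  "graph_cells T = (\<lambda>x. {x}) ` verts T \<union> edges T"

definition realization :: "'a ugraph \<Rightarrow> ('a \<Rightarrow> real) set" where
  "realization T = (\<Union>s\<in>graph_cells T. closed_cell s)"

definition vertex_point :: "'a \<Rightarrow> 'a \<Rightarrow> real" where
  "vertex_point x = (\<lambda>y. if y = x then 1 else 0)"

definition cell_dist :: "('a \<Rightarrow> real) \<Rightarrow> ('a \<Rightarrow> real) \<Rightarrow> real" where
  "cell_dist \<xi> \<eta> = (\<Sum>x | \<xi> x \<noteq> 0 \<or> \<eta> x \<noteq> 0. \<bar>\<xi> x - \<eta> x\<bar>) / 2"

definition pl_path :: "'a ugraph \<Rightarrow> ('a \<Rightarrow> real) \<Rightarrow> ('a \<Rightarrow> real) \<Rightarrow> ('a \<Rightarrow> real) list \<Rightarrow> bool" where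
  "pl_path T \<xi> \<eta> zs \<longleftrightarrow> zs \<noteq> [] \<and> hd zs = \<xi> \<and> last zs = \<eta> \<and> set zs \<subseteq> realization T \<and>
     (\<forall>i. Suc i < length zs \<longrightarrow> (\<exists>s\<in>graph_cells T. zs ! i \<in> closed_cell s \<and> zs ! Suc i \<in> closed_cell s))"

definition pl_length :: "('a \<Rightarrow> real) list \<Rightarrow> real" where
  "pl_length zs = (\<Sum>i<length zs - 1. cell_dist (zs ! i) (zs ! Suc i))"

definition realization_dist :: "'a ugraph \<Rightarrow> ('a \<Rightarrow> real) \<Rightarrow> ('a \<Rightarrow> real) \<Rightarrow> real" where
  "realization_dist T \<xi> \<eta> =
     (if \<xi> \<in> realization T \<and> \<eta> \<in> realization T then Inf (pl_length ` {zs. pl_path T \<xi> \<eta> zs}) else 0)"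

text \<open>The affine extension to the realization of a map of vertices.\<close>

definition realization_map :: "('a \<Rightarrow> 'b) \<Rightarrow> ('a \<Rightarrow> real) \<Rightarrow> 'b \<Rightarrow> real" where
  "realization_map f \<xi> = (\<lambda>y. \<Sum>x | \<xi> x \<noteq> 0 \<and> f x = y. \<xi> x)"


section \<open>Anti-tori\<close>

text \<open>A metric space is given by its set \<open>X\<close> of points and its distance function \<open>d\<close>.\<close>

definition isometry_of :: "'x set \<Rightarrow> ('x \<Rightarrow> 'x \<Rightarrow> real) \<Rightarrow> ('x \<Rightarrow> 'x) \<Rightarrow> bool" where
  "isometry_of X d \<gamma> \<longleftrightarrow> bij_betw \<gamma> X X \<and> (\<forall>x\<in>X. \<forall>y\<in>X. d (\<gamma> x) (\<gamma> y) = d x y)"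

definition hyperbolic_isometry :: "'x set \<Rightarrow> ('x \<Rightarrow> 'x \<Rightarrow> real) \<Rightarrow> ('x \<Rightarrow> 'x) \<Rightarrow> bool" where
  "hyperbolic_isometry X d \<gamma> \<longleftrightarrow> isometry_of X d \<gamma> \<and>
     (\<exists>x\<in>X. 0 < d x (\<gamma> x) \<and> (\<forall>y\<in>X. d x (\<gamma> x) \<le> d y (\<gamma> y)))"

definition geodesic_line :: "'x set \<Rightarrow> ('x \<Rightarrow> 'x \<Rightarrow> real) \<Rightarrow> (real \<Rightarrow> 'x) \<Rightarrow> bool" where
  "geodesic_line X d c \<longleftrightarrow> range c \<subseteq> X \<and> (\<forall>s t. d (c s) (c t) = \<bar>s - t\<bar>)"

definition translation_axis ::
    "'x set \<Rightarrow> ('x \<Rightarrow> 'x \<Rightarrow> real) \<Rightarrow> ('x \<Rightarrow> 'x) \<Rightarrow> 'x set \<Rightarrow> bool" where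
  "translation_axis X d \<gamma> l \<longleftrightarrow>
     (\<exists>c \<tau>. geodesic_line X d c \<and> l = range c \<and> 0 < \<tau> \<and> (\<forall>t. \<gamma> (c t) = c (t + \<tau>)))"

definition parallel_lines :: "'x set \<Rightarrow> ('x \<Rightarrow> 'x \<Rightarrow> real) \<Rightarrow> 'x set \<Rightarrow> 'x set \<Rightarrow> bool" where
  "parallel_lines X d l l' \<longleftrightarrow>
     (\<exists>c c' K. geodesic_line X d c \<and> geodesic_line X d c' \<and> l = range c \<and> l' = range c' \<and>
        (\<forall>t. d (c t) (c' t) \<le> K))"

definition geodesically_convex :: "'x set \<Rightarrow> ('x \<Rightarrow> 'x \<Rightarrow> real) \<Rightarrow> 'x set \<Rightarrow> bool" where
  "geodesically_convex X d C \<longleftrightarrow> C \<subseteq> X \<and>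
     (\<forall>L\<ge>0. \<forall>c::real \<Rightarrow> 'x. c ` {0..L} \<subseteq> X \<longrightarrow> (\<forall>s\<in>{0..L}. \<forall>t\<in>{0..L}. d (c s) (c t) = \<bar>s - t\<bar>) \<longrightarrow>
        c 0 \<in> C \<longrightarrow> c L \<in> C \<longrightarrow> c ` {0..L} \<subseteq> C)"

definition flat_plane :: "'x set \<Rightarrow> ('x \<Rightarrow> 'x \<Rightarrow> real) \<Rightarrow> 'x set \<Rightarrow> bool" where
  "flat_plane X d P \<longleftrightarrow> P \<subseteq> X \<and>
     (\<exists>\<phi> :: real \<times> real \<Rightarrow> 'x. range \<phi> = P \<and> (\<forall>z w. d (\<phi> z) (\<phi> w) = dist z w))"

definition acts_cocompactly ::
    "'x set \<Rightarrow> ('x \<Rightarrow> 'x \<Rightarrow> real) \<Rightarrow> ('g \<Rightarrow> 'x \<Rightarrow> 'x) \<Rightarrow> 'g set \<Rightarrow> 'x set \<Rightarrow> bool" where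
  "acts_cocompactly X d act S P \<longleftrightarrow>
     (\<exists>K. K \<subseteq> P \<and> compactin (Metric_space.mtopology X d) K \<and> (\<Union>g\<in>S. act g ` K) = P)"

text \<open>\<open>P\<close> is an anti-torus spanned by \<open>\<gamma>\<^sub>1, \<gamma>\<^sub>2\<close>, as the convex hull of the axes \<open>l\<^sub>1\<close> of \<open>\<gamma>\<^sub>1\<close>
  and \<open>l\<^sub>2\<close> of \<open>\<gamma>\<^sub>2\<close>. The notion is meant for a proper and cocompact isometric action \<open>act\<close> of \<open>G\<close> on a
  CAT(0) space.\<close>

definition anti_torus ::
    "('g, 'm) monoid_scheme \<Rightarrow> 'x set \<Rightarrow> ('x \<Rightarrow> 'x \<Rightarrow> real) \<Rightarrow> ('g \<Rightarrow> 'x \<Rightarrow> 'x) \<Rightarrow>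
     'g \<Rightarrow> 'g \<Rightarrow> 'x set \<Rightarrow> 'x set \<Rightarrow> 'x set \<Rightarrow> bool" where
  "anti_torus G X d act \<gamma>\<^sub>1 \<gamma>\<^sub>2 l\<^sub>1 l\<^sub>2 P \<longleftrightarrow>
     \<gamma>\<^sub>1 \<in> carrier G \<and> \<gamma>\<^sub>2 \<in> carrier G \<and>
     hyperbolic_isometry X d (act \<gamma>\<^sub>1) \<and> hyperbolic_isometry X d (act \<gamma>\<^sub>2) \<and>
     translation_axis X d (act \<gamma>\<^sub>1) l\<^sub>1 \<and> translation_axis X d (act \<gamma>\<^sub>2) l\<^sub>2 \<and>
     \<not> parallel_lines X d l\<^sub>1 l\<^sub>2 \<and>
     flat_plane X d P \<and> P = geodesically_convex X d hull (l\<^sub>1 \<union> l\<^sub>2) \<and>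
     \<not> acts_cocompactly X d act {g \<in> carrier G. act g ` P = P} P"


section \<open>The groups associated with linear maps\<close>

text \<open>The generators \<open>V\<^sub>1 \<squnion> V\<^sub>2\<close> are the elements of the sum type, so that the two zero vectors are
  distinct generators.\<close>

definition bmw_relations ::
    "('v1::plus \<Rightarrow> 'v1) \<Rightarrow> ('v2::plus \<Rightarrow> 'v1) \<Rightarrow> ('v1 \<Rightarrow> 'v2) \<Rightarrow> ('v2 \<Rightarrow> 'v2) \<Rightarrow>
     (('v1 + 'v2) word \<times> ('v1 + 'v2) word) set" where
  "bmw_relations a b c d =
     {([(Inl v1, True), (Inr (c v1 + d v2), True)], [(Inr v2, True), (Inl (a v1 + b v2), True)])
      | v1 v2. True}"

definition bmw_group where
  "bmw_group a b c d = presented_group (bmw_relations a b c d)"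

definition gen1 where
  "gen1 a b c d v1 = pres_gen (bmw_relations a b c d) (Inl v1)"

definition gen2 where
  "gen2 a b c d v2 = pres_gen (bmw_relations a b c d) (Inr v2)"

text \<open>The trees. The vertex set of \<open>T\<^sub>1 \<times> T\<^sub>2\<close> is the group itself. Two vertices have the same
  projection to \<open>T\<^sub>1\<close> iff they are joined by a path all of whose edges are in the
  \<open>T\<^sub>2\<close>-direction, i.e. labelled by \<open>V\<^sub>2\<close>; hence the vertices of \<open>T\<^sub>1\<close> are the left cosets of
  \<open>\<langle>V\<^sub>2\<rangle>\<close>, and its edges are the projections of the edges labelled by \<open>V\<^sub>1\<close>. The same holds with
  the two factors exchanged. The group acts by left multiplication.\<close>

definition coset_graph :: "('g, 'm) monoid_scheme \<Rightarrow> 'g set \<Rightarrow> 'g set \<Rightarrow> 'g set ugraph" where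
  "coset_graph G H S =
     \<lparr>verts = {g <#\<^bsub>G\<^esub> H | g. g \<in> carrier G},
      edges = {{g <#\<^bsub>G\<^esub> H, (g \<otimes>\<^bsub>G\<^esub> s) <#\<^bsub>G\<^esub> H} | g s. g \<in> carrier G \<and> s \<in> S}\<rparr>"

definition left_translation :: "('g, 'm) monoid_scheme \<Rightarrow> 'g set ugraph \<Rightarrow> 'g \<Rightarrow> 'g set \<Rightarrow> 'g set" where
  "left_translation G T g = (\<lambda>x\<in>verts T. g <#\<^bsub>G\<^esub> x)"

definition base1 where
  "base1 a b c d = generate (bmw_group a b c d) (range (gen2 a b c d))"

definition base2 where
  "base2 a b c d = generate (bmw_group a b c d) (range (gen1 a b c d))"

definition tree1 where
  "tree1 a b c d = coset_graph (bmw_group a b c d) (base1 a b c d) (range (gen1 a b c d))"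

definition tree2 where
  "tree2 a b c d = coset_graph (bmw_group a b c d) (base2 a b c d) (range (gen2 a b c d))"

text \<open>The embedding into \<open>Aut T\<^sub>1 \<times> Aut T\<^sub>2\<close>; it is injective as soon as the action is regular on the
  vertices of \<open>T\<^sub>1 \<times> T\<^sub>2\<close>. Subgroups of the form \<open>\<Lambda>\<^sub>1 \<times> \<Lambda>\<^sub>2\<close> are understood through it.\<close>

definition bmw_rep where
  "bmw_rep a b c d g =
     (left_translation (bmw_group a b c d) (tree1 a b c d) g,
      left_translation (bmw_group a b c d) (tree2 a b c d) g)"

definition bmw_irreducible where
  "bmw_irreducible a b c d \<longleftrightarrow>
     \<not> (\<exists>H \<Lambda>\<^sub>1 \<Lambda>\<^sub>2. subgroup H (bmw_group a b c d) \<and> finite (rcosets\<^bsub>bmw_group a b c d\<^esub> H) \<and>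
          subgroup \<Lambda>\<^sub>1 (graph_aut (tree1 a b c d)) \<and> subgroup \<Lambda>\<^sub>2 (graph_aut (tree2 a b c d)) \<and>
          bmw_rep a b c d ` H = \<Lambda>\<^sub>1 \<times> \<Lambda>\<^sub>2)"

definition bmw_space where
  "bmw_space a b c d = realization (tree1 a b c d) \<times> realization (tree2 a b c d)"

definition bmw_dist where
  "bmw_dist a b c d = prod_dist (realization_dist (tree1 a b c d)) (realization_dist (tree2 a b c d))"

definition bmw_action where
  "bmw_action a b c d g =
     map_prod (realization_map (fst (bmw_rep a b c d g))) (realization_map (snd (bmw_rep a b c d g)))"

text \<open>The point of \<open>T\<^sub>1 \<times> T\<^sub>2\<close> corresponding to the vertex \<open>g\<close> of the Cayley graph.\<close>

definition bmw_vertex where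
  "bmw_vertex a b c d g =
     (vertex_point (g <#\<^bsub>bmw_group a b c d\<^esub> base1 a b c d),
      vertex_point (g <#\<^bsub>bmw_group a b c d\<^esub> base2 a b c d))"

text \<open>\<open>\<T>\<close> is the natural coloring of the flat \<open>P\<close> spanned by the axes of \<open>v1\<close> and \<open>v2\<close> through
  the identity vertex. Here \<open>g m n\<close> is the vertex of \<open>P\<close> with coordinates \<open>(v1\<^sup>m, v2\<^sup>n)\<close>, i.e. the one
  with the same projection to \<open>T\<^sub>1\<close> as \<open>v1\<^sup>m\<close> and the same projection to \<open>T\<^sub>2\<close> as \<open>v2\<^sup>n\<close>.\<close>

definition natural_coloring where
  "natural_coloring a b c d P v1 v2 \<T> \<longleftrightarrow>
     (let G = bmw_group a b c d in
      \<exists>g :: int \<Rightarrow> int \<Rightarrow> _. \<forall>m n.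
        g m n \<in> carrier G \<and> bmw_vertex a b c d (g m n) \<in> P \<and>
        fst (bmw_vertex a b c d (g m n)) = fst (bmw_vertex a b c d (gen1 a b c d v1 [^]\<^bsub>G\<^esub> m)) \<and>
        snd (bmw_vertex a b c d (g m n)) = snd (bmw_vertex a b c d (gen2 a b c d v2 [^]\<^bsub>G\<^esub> n)) \<and>
        inv\<^bsub>G\<^esub> (g m n) \<otimes>\<^bsub>G\<^esub> g (m + 1) n = gen1 a b c d (fst (\<T> (m, n))) \<and>
        inv\<^bsub>G\<^esub> (g m n) \<otimes>\<^bsub>G\<^esub> g m (n + 1) = gen2 a b c d (snd (\<T> (m, n))))"


section \<open>The determinant condition\<close>

definition matrix_of_map ::
    "('f::field \<Rightarrow> 'w::ab_group_add \<Rightarrow> 'w) \<Rightarrow> 'v list \<Rightarrow> 'w list \<Rightarrow> ('v \<Rightarrow> 'w) \<Rightarrow> 'f mat" where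
  "matrix_of_map sc bs cs f =
     mat (length cs) (length bs) (\<lambda>(i, j). module.representation sc (set cs) (f (bs ! j)) (cs ! i))"

text \<open>The ring \<open>F[x, y]\<close> is represented as \<open>F[x][y]\<close>.\<close>

definition indet_x :: "'f::field poly poly" where
  "indet_x = [:[:0, 1:]:]"

definition indet_y :: "'f::field poly poly" where
  "indet_y = [:0, 1:]"

definition const_mat :: "'f::field mat \<Rightarrow> 'f poly poly mat" where
  "const_mat = map_mat (\<lambda>k. [:[:k:]:])"

definition det_condition :: "'f::field mat \<Rightarrow> 'f mat \<Rightarrow> 'f mat \<Rightarrow> 'f mat \<Rightarrow> bool" where
  "det_condition A B C D \<longleftrightarrow>
     (let Ax = 1\<^sub>m (dim_row A) - indet_x \<cdot>\<^sub>m const_mat A;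
          Dy = 1\<^sub>m (dim_row D) - indet_y \<cdot>\<^sub>m const_mat D
      in det (four_block_mat Ax (indet_x \<cdot>\<^sub>m const_mat B) (indet_y \<cdot>\<^sub>m const_mat C) Dy)
           \<noteq> det Ax * det Dy)"


section \<open>Tilings and substitutions\<close>

definition tiling :: "'c set \<Rightarrow> (int \<times> int \<Rightarrow> 'c) \<Rightarrow> bool" where
  "tiling V \<T> \<longleftrightarrow> finite V \<and> range \<T> \<subseteq> V"

definition block_index :: "nat \<Rightarrow> (int \<times> int) set" where
  "block_index l = {0..<int l} \<times> {0..<int l}"

definition block_point :: "nat \<Rightarrow> int \<times> int \<Rightarrow> int \<times> int \<Rightarrow> int \<times> int" where
  "block_point l \<alpha> \<beta> = (int l * fst \<alpha> + fst \<beta>, int l * snd \<alpha> + snd \<beta>)"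

definition block_colors :: "nat \<Rightarrow> 'c set \<Rightarrow> (int \<times> int \<Rightarrow> 'c) set" where
  "block_colors l V = block_index l \<rightarrow>\<^sub>E V"

definition block_tiling :: "nat \<Rightarrow> (int \<times> int \<Rightarrow> 'c) \<Rightarrow> int \<times> int \<Rightarrow> (int \<times> int \<Rightarrow> 'c)" where
  "block_tiling l \<T> \<alpha> = (\<lambda>\<beta>\<in>block_index l. \<T> (block_point l \<alpha> \<beta>))"

definition substitution_invariant :: "'c set \<Rightarrow> nat \<Rightarrow> (int \<times> int \<Rightarrow> 'c) \<Rightarrow> bool" where
  "substitution_invariant V l \<T> \<longleftrightarrow> tiling V \<T> \<and> 2 \<le> l \<and>
     (\<exists>\<S>\<in>V \<rightarrow> block_colors l V. \<forall>\<alpha>. \<forall>\<beta>\<in>block_index l. \<T> (block_point l \<alpha> \<beta>) = \<S> (\<T> \<alpha>) \<beta>)"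

text \<open>Every finite set is in bijection with a finite set of natural numbers, so it is no loss of
  generality to take the auxiliary color set \<open>W\<close> in \<open>nat\<close>.\<close>

definition substitution_generated :: "'c set \<Rightarrow> nat \<Rightarrow> (int \<times> int \<Rightarrow> 'c) \<Rightarrow> bool" where
  "substitution_generated V l \<T> \<longleftrightarrow> tiling V \<T> \<and>
     (\<exists>(W :: nat set) \<T>' \<tau>. substitution_invariant W l \<T>' \<and> \<tau> \<in> W \<rightarrow> V \<and> \<T> = \<tau> \<circ> \<T>')"

end

theory Submission
  imports Defs "HOL-Library.Function_Algebras" "Jordan_Normal_Form.Char_Poly"
begin

text \<open>In coordinates a coloring is a family of arrays over \<open>F\<close> satisfying linear recurrences, so that
  every coordinate is annihilated by the determinant \<open>D\<close> of the theorem, a polynomial in the two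
  shifts. In characteristic \<open>p\<close> the powers \<open>D ^ (p ^ k)\<close> have the coefficients of \<open>D\<close> up to
  Frobenius, at exponents multiplied by \<open>p ^ k\<close>; moreover rows and columns are periodic.
  Hence there are only finitely many arrays obtained by decimating the coloring by powers of \<open>p\<close>,
  which is equivalent to being generated by a substitution.

  If all colorings were doubly periodic, then \<open>D\<close> would divide a product \<open>f(x) g(y)\<close> and so would be
  itself such a product; comparing with its restrictions to \<open>x = 0\<close> and \<open>y = 0\<close> gives
  \<open>D = det (1 - a x) det (1 - d y)\<close>. So some pair spans a flat whose coloring is not doubly periodic.
  The group acts on reduced words in the generators of either factor, which provides normal forms and
  shows that the two coset graphs are trees. An element stabilizing a flat translates its coloring,
  so a cocompact stabilizer would make the coloring doubly periodic; so would a finite index subgroup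
  that is a product.\<close>

section \<open>Tilings with finite kernel\<close>

text \<open>Row n is obtained from the axis by nested linear recurrences, so it is annihilated only
  by a power of 1 - S^N that grows with |n|, S being the horizontal shift. In characteristic p the
  power may be taken to be p^e, and (1 - S^N)^(p^e) = 1 - S^(N p^e); so row n has period N p^e once
  p^e is at least |n| + 2. Decimating by p^e divides this period by p^e, whence strips around the
  axes have a period independent of e in every decimation. A recurrence extends such data away from
  the axes only if it can be solved, in each quadrant, for the value farthest from the origin. Hence
  there are four determinants, one for each pair of signs; their constant terms do not vanish
  because the identity, a, d and the block matrix are invertible. The divisibility of f(x) g(y)
  comes from generating functions: over a fundamental domain of a doubly periodic coloring the
  recurrences telescope to boundary terms, which are constant along the axes. Colorings of the basis
  vectors, collected in a matrix, give a diagonal product whose determinant is f(x) g(y).\<close>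

definition decimate :: "nat \<Rightarrow> int \<times> int \<Rightarrow> (int \<times> int \<Rightarrow> 'c) \<Rightarrow> int \<times> int \<Rightarrow> 'c" where
  "decimate l \<beta> \<T> \<alpha> = \<T> (block_point l \<alpha> \<beta>)"

definition kernel_level :: "nat \<Rightarrow> (int \<times> int \<Rightarrow> 'c) \<Rightarrow> nat \<Rightarrow> (int \<times> int \<Rightarrow> 'c) set" where
  "kernel_level p \<T> k = (\<lambda>\<beta>. decimate (p ^ k) \<beta> \<T>) ` block_index (p ^ k)"

lemma block_point_block_point:
  "block_point l (block_point l' \<alpha> \<beta>) \<gamma> = block_point (l * l') \<alpha> (block_point l \<beta> \<gamma>)"
  by (simp add: block_point_def algebra_simps)

lemma decimate_decimate: "decimate l' \<gamma> (decimate l \<beta> \<T>) = decimate (l * l') (block_point l \<gamma> \<beta>) \<T>"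
  by (simp add: decimate_def fun_eq_iff block_point_block_point)

lemma block_point_in_index_1:
  fixes l l' :: nat and x y :: int
  assumes "0 \<le> x" "x < int l'" "0 \<le> y" "y < int l"
  shows "0 \<le> int l * x + y \<and> int l * x + y < int l * int l'"
proof -
  have "int l * x + y < int l * (x + 1)" using assms by (simp add: algebra_simps)
  also have "\<dots> \<le> int l * int l'" using assms by (intro mult_left_mono) auto
  finally show ?thesis using assms by simp
qed

lemma block_point_in_index:
  assumes "\<beta> \<in> block_index l'" "\<gamma> \<in> block_index l"
  shows "block_point l \<beta> \<gamma> \<in> block_index (l * l')"
  using assms block_point_in_index_1[of "fst \<beta>" l' "fst \<gamma>" l]
    block_point_in_index_1[of "snd \<beta>" l' "snd \<gamma>" l]
  by (auto simp: block_index_def block_point_def)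

lemma decimate_kernel_level:
  assumes "\<kappa> \<in> kernel_level p \<T> k" "\<gamma> \<in> block_index p"
  shows "decimate p \<gamma> \<kappa> \<in> kernel_level p \<T> (Suc k)"
proof -
  obtain \<beta> where \<beta>: "\<beta> \<in> block_index (p ^ k)" "\<kappa> = decimate (p ^ k) \<beta> \<T>"
    using assms(1) by (auto simp: kernel_level_def)
  have "block_point (p ^ k) \<gamma> \<beta> \<in> block_index (p ^ Suc k)"
    using block_point_in_index[OF assms(2) \<beta>(1)] by (simp add: mult.commute)
  then show ?thesis
    unfolding kernel_level_def \<beta>(2) decimate_decimate by (auto simp: mult.commute)
qed

lemma self_in_kernel_level_0: "\<T> \<in> kernel_level p \<T> 0"
  by (auto simp: kernel_level_def block_index_def decimate_def block_point_def
      intro!: image_eqI[where x = "(0, 0)"])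

lemma finite_block_index: "finite (block_index l)"
  by (simp add: block_index_def)

text \<open>The auxiliary color of \<alpha> records the values at \<alpha> of all kernel elements at
  once. Since \<kappa>(p \<alpha> + \<beta>) is the value at \<alpha> of the decimation of \<kappa>
  by \<beta>, and the kernel is closed under decimation, the color of \<alpha> determines the colors
  in its block. The tiling itself is one of the components.\<close>

lemma substitution_generated_of_finite_kernel:
  fixes \<T> :: "int \<times> int \<Rightarrow> 'c"
  assumes fin: "finite (\<Union>k. kernel_level p \<T> k)" and V: "tiling V \<T>" and p: "2 \<le> p"
  shows "substitution_generated V p \<T>"
proof -
  define K where "K = (\<Union>k. kernel_level p \<T> k)"
  define st where "st \<alpha> = (\<lambda>\<kappa>\<in>K. \<kappa> \<alpha>)" for \<alpha>
  have TK: "\<T> \<in> K" unfolding K_def using self_in_kernel_level_0 by blast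
  have dec: "decimate p \<beta> \<kappa> \<in> K" if "\<kappa> \<in> K" "\<beta> \<in> block_index p" for \<kappa> \<beta>
    using that decimate_kernel_level unfolding K_def by fastforce
  have val: "\<kappa> \<alpha> \<in> V" if "\<kappa> \<in> K" for \<kappa> \<alpha>
    using that V unfolding K_def kernel_level_def tiling_def decimate_def by auto
  have "finite (K \<rightarrow>\<^sub>E V)"
    using fin V by (auto simp: K_def tiling_def intro!: finite_PiE)
  \<comment> \<open>The states are functions; they are numbered because
    \<open>substitution_generated\<close> takes its colors in \<open>nat\<close>.\<close>
  then obtain enc :: "_ \<Rightarrow> nat" where enc: "inj_on enc (K \<rightarrow>\<^sub>E V)"
    using finite_imp_inj_to_nat_seg by blast
  define W where "W = enc ` (K \<rightarrow>\<^sub>E V)"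
  define cod where "cod = inv_into (K \<rightarrow>\<^sub>E V) enc"
  have st: "st \<alpha> \<in> K \<rightarrow>\<^sub>E V" for \<alpha> using val by (auto simp: st_def)
  have cod_st: "cod (enc (st \<alpha>)) = st \<alpha>" for \<alpha>
    using enc st by (simp add: cod_def)
  have cod: "cod w \<in> K \<rightarrow>\<^sub>E V" if "w \<in> W" for w
    using that unfolding W_def cod_def by (rule inv_into_into)
  define S where "S w = (\<lambda>\<beta>\<in>block_index p. enc (\<lambda>\<kappa>\<in>K. cod w (decimate p \<beta> \<kappa>)))" for w
  have inv: "substitution_invariant W p (enc \<circ> st)"
    unfolding substitution_invariant_def
  proof (intro conjI bexI[of _ S] allI ballI)
    show "tiling W (enc \<circ> st)"
      using \<open>finite (K \<rightarrow>\<^sub>E V)\<close> st by (auto simp: tiling_def W_def)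
    show "S \<in> W \<rightarrow> block_colors p W"
    proof
      fix w assume w: "w \<in> W"
      have "(\<lambda>\<kappa>\<in>K. cod w (decimate p \<beta> \<kappa>)) \<in> K \<rightarrow>\<^sub>E V" if "\<beta> \<in> block_index p" for \<beta>
        using cod[OF w] dec that by (auto simp: PiE_iff)
      then show "S w \<in> block_colors p W"
        by (auto simp: S_def block_colors_def W_def)
    qed
    fix \<alpha> \<beta> assume \<beta>: "\<beta> \<in> block_index p"
    have "st (block_point p \<alpha> \<beta>) = (\<lambda>\<kappa>\<in>K. st \<alpha> (decimate p \<beta> \<kappa>))"
      using dec[OF _ \<beta>] by (auto simp: st_def decimate_def fun_eq_iff)
    then show "(enc \<circ> st) (block_point p \<alpha> \<beta>) = S ((enc \<circ> st) \<alpha>) \<beta>"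
      using \<beta> by (simp add: S_def cod_st)
  qed (use p in simp)
  moreover have "(\<lambda>w. cod w \<T>) \<in> W \<rightarrow> V"
    using cod TK by blast
  moreover have "\<T> = (\<lambda>w. cod w \<T>) \<circ> (enc \<circ> st)"
    unfolding fun_eq_iff comp_def cod_st using TK by (simp add: st_def)
  ultimately show ?thesis
    unfolding substitution_generated_def using V by blast
qed

text \<open>Whether \<open>\<T>\<^sup>l\<close> with \<open>l = p ^ s\<close> is invariant depends only on the equality of two levels of
  the kernel, and the levels are eventually periodic.\<close>

lemma block_tiling_invariant_of_finite_kernel:
  fixes \<T> :: "int \<times> int \<Rightarrow> 'c"
  assumes fin: "finite (\<Union>k. kernel_level p \<T> k)" and V: "tiling V \<T>" and p: "2 \<le> p"
  obtains s t where "1 \<le> t"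
    "substitution_invariant (block_colors (p ^ s) V) (p ^ t) (block_tiling (p ^ s) \<T>)"
proof -
  have "range (kernel_level p \<T>) \<subseteq> Pow (\<Union>k. kernel_level p \<T> k)" by auto
  then have "finite (range (kernel_level p \<T>))"
    using fin by (meson finite_Pow_iff finite_subset)
  then have "\<not> inj (kernel_level p \<T>)"
    using finite_imageD infinite_UNIV_nat by blast
  then obtain s s' where "s < s'" "kernel_level p \<T> s = kernel_level p \<T> s'"
    unfolding inj_def by (metis linorder_neqE_nat)
  then obtain t where t: "1 \<le> t" and eq: "kernel_level p \<T> (s + t) = kernel_level p \<T> s"
    by (metis add_diff_inverse_nat less_imp_le_nat linorder_not_less zero_less_diff Suc_leI One_nat_def)
  \<comment> \<open>Entry \<gamma> of the block at p^t \<alpha> + \<beta> is a decimation of level s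
    + t evaluated at \<alpha>. As this level equals level s, the same value stands at some position
    \<delta> of the block at \<alpha>, with \<delta> independent of \<alpha>.\<close>
  have "\<forall>\<beta>\<in>block_index (p ^ t). \<forall>\<gamma>\<in>block_index (p ^ s). \<exists>\<delta>\<in>block_index (p ^ s).
      decimate (p ^ (s + t)) (block_point (p ^ s) \<beta> \<gamma>) \<T> = decimate (p ^ s) \<delta> \<T>"
  proof (intro ballI)
    fix \<beta> \<gamma> assume "\<beta> \<in> block_index (p ^ t)" "\<gamma> \<in> block_index (p ^ s)"
    then have "block_point (p ^ s) \<beta> \<gamma> \<in> block_index (p ^ (s + t))"
      by (simp add: power_add block_point_in_index)
    then have "decimate (p ^ (s + t)) (block_point (p ^ s) \<beta> \<gamma>) \<T> \<in> kernel_level p \<T> (s + t)"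
      by (simp add: kernel_level_def)
    then show "\<exists>\<delta>\<in>block_index (p ^ s).
      decimate (p ^ (s + t)) (block_point (p ^ s) \<beta> \<gamma>) \<T> = decimate (p ^ s) \<delta> \<T>"
      unfolding eq by (auto simp: kernel_level_def)
  qed
  then obtain \<delta> where \<delta>: "\<And>\<beta> \<gamma>. \<lbrakk>\<beta> \<in> block_index (p ^ t); \<gamma> \<in> block_index (p ^ s)\<rbrakk> \<Longrightarrow>
      \<delta> \<beta> \<gamma> \<in> block_index (p ^ s) \<and>
      decimate (p ^ (s + t)) (block_point (p ^ s) \<beta> \<gamma>) \<T> = decimate (p ^ s) (\<delta> \<beta> \<gamma>) \<T>"
    by metis
  define S where "S w = (\<lambda>\<beta>\<in>block_index (p ^ t). \<lambda>\<gamma>\<in>block_index (p ^ s). w (\<delta> \<beta> \<gamma>) :: 'c)" for w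
  have "substitution_invariant (block_colors (p ^ s) V) (p ^ t) (block_tiling (p ^ s) \<T>)"
    unfolding substitution_invariant_def
  proof (intro conjI bexI[of _ S] allI ballI)
    show "tiling (block_colors (p ^ s) V) (block_tiling (p ^ s) \<T>)"
      using V by (auto simp: tiling_def block_colors_def block_tiling_def finite_block_index intro!: finite_PiE)
    show "2 \<le> p ^ t"
      using p t self_le_power[of p t] by simp
    show "S \<in> block_colors (p ^ s) V \<rightarrow> block_colors (p ^ t) (block_colors (p ^ s) V)"
      using \<delta> by (auto simp: S_def block_colors_def PiE_iff)
    fix \<alpha> \<beta> assume \<beta>: "\<beta> \<in> block_index (p ^ t)"
    show "block_tiling (p ^ s) \<T> (block_point (p ^ t) \<alpha> \<beta>) = S (block_tiling (p ^ s) \<T> \<alpha>) \<beta>"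
    proof
      fix \<gamma>
      show "block_tiling (p ^ s) \<T> (block_point (p ^ t) \<alpha> \<beta>) \<gamma> = S (block_tiling (p ^ s) \<T> \<alpha>) \<beta> \<gamma>"
      proof (cases "\<gamma> \<in> block_index (p ^ s)")
        case True
        have "\<T> (block_point (p ^ s) (block_point (p ^ t) \<alpha> \<beta>) \<gamma>)
            = decimate (p ^ (s + t)) (block_point (p ^ s) \<beta> \<gamma>) \<T> \<alpha>"
          by (simp only: block_point_block_point decimate_def power_add)
        also have "\<dots> = \<T> (block_point (p ^ s) \<alpha> (\<delta> \<beta> \<gamma>))"
          using \<delta>[OF \<beta> True] by (simp add: decimate_def)
        finally show ?thesis
          using True \<beta> \<delta>[OF \<beta> True] by (simp add: block_tiling_def S_def)
      qed (use \<beta> in \<open>simp add: block_tiling_def S_def\<close>)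
    qed
  qed
  with t show ?thesis by (rule that)
qed

section \<open>The action on reduced words\<close>

type_synonym 'v sword = "('v \<times> bool) list"

definition flip :: "'v \<times> bool \<Rightarrow> 'v \<times> bool" where
  "flip l = (fst l, \<not> snd l)"

definition reduced :: "'v sword \<Rightarrow> bool" where
  "reduced u \<longleftrightarrow> successively (\<lambda>l l'. l' \<noteq> flip l) u"

definition lmul :: "'v \<times> bool \<Rightarrow> 'v sword \<Rightarrow> 'v sword" where
  "lmul l u = (case u of [] \<Rightarrow> [l] | l' # u' \<Rightarrow> if l' = flip l then u' else l # u)"

lemma flip_simps [simp]: "flip (v, e) = (v, \<not> e)" "flip (flip l) = l" "l = flip l' \<longleftrightarrow> l' = flip l"
  by (auto simp: flip_def prod_eq_iff)

lemma reduced_simps [simp]: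
  "reduced []" "reduced [l]" "reduced (l # l' # u) \<longleftrightarrow> l' \<noteq> flip l \<and> reduced (l' # u)"
  by (auto simp: reduced_def)

lemma reduced_ConsD: "reduced (l # u) \<Longrightarrow> reduced u"
  by (cases u) auto

lemma reduced_lmul: "reduced u \<Longrightarrow> reduced (lmul l u)"
  by (cases u) (auto simp: lmul_def dest: reduced_ConsD)

lemma lmul_of_reduced: "reduced (l # u) \<Longrightarrow> lmul l u = l # u"
  by (cases u) (auto simp: lmul_def)

text \<open>Reducedness matters when the first multiplication cancels a letter: the letter put back
  must not cancel in turn with the one that follows.\<close>

lemma lmul_flip: "reduced u \<Longrightarrow> lmul (flip l) (lmul l u) = u"
proof (cases u)
  case (Cons l' u')
  assume "reduced u"
  then show ?thesis
    using Cons lmul_of_reduced[of l' u'] by (auto simp: lmul_def[of l])(simp add: lmul_def)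
qed (simp add: lmul_def)

text \<open>A square complex with one vertex: the square with bottom edge \<open>v\<close> and left edge \<open>w\<close> has upper
  edge \<open>upper v w\<close> and right edge \<open>right v w\<close>; every corner determines the square. The generators
  are the horizontal edges \<open>i v\<close> and the vertical edges \<open>j w\<close>. The relations may be written
  in either direction, so that the two factors can be exchanged.\<close>

locale square_complex =
  fixes upper :: "'v \<Rightarrow> 'w \<Rightarrow> 'v" and right :: "'v \<Rightarrow> 'w \<Rightarrow> 'w"
  assumes bij_upper: "\<And>w. bij (\<lambda>v. upper v w)"
    and bij_right: "\<And>v. bij (\<lambda>w. right v w)"
    and bij_both: "bij (\<lambda>(v, w). (upper v w, right v w))"
begin

definition lower :: "'w \<Rightarrow> 'v \<Rightarrow> 'v" where "lower w = inv_into UNIV (\<lambda>v. upper v w)"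
definition left :: "'v \<Rightarrow> 'w \<Rightarrow> 'w" where "left v = inv_into UNIV (right v)"
definition corner :: "'v \<times> 'w \<Rightarrow> 'v \<times> 'w" where "corner = inv_into UNIV (\<lambda>(v, w). (upper v w, right v w))"

lemma upper_lower [simp]: "upper (lower w y) w = y"
  using bij_upper[of w] by (simp add: lower_def bij_is_surj surj_f_inv_f[of "\<lambda>v. upper v w"])

lemma lower_upper [simp]: "lower w (upper v w) = v"
  using bij_upper[of w] by (simp add: lower_def bij_is_inj inv_f_f[of "\<lambda>v. upper v w"])

lemma right_left [simp]: "right v (left v r) = r"
  using bij_right[of v] by (simp add: left_def bij_is_surj surj_f_inv_f)

lemma left_right [simp]: "left v (right v w) = w"
  using bij_right[of v] by (simp add: left_def bij_is_inj inv_f_f)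

lemma corner_upper_right [simp]: "corner (upper v w, right v w) = (v, w)"
  using inv_f_f[OF bij_is_inj[OF bij_both], of "(v, w)"] by (simp add: corner_def)

lemma upper_right_corner:
  "upper (fst (corner z)) (snd (corner z)) = fst z" "right (fst (corner z)) (snd (corner z)) = snd z"
  using surj_f_inv_f[OF bij_is_surj[OF bij_both], of z]
  by (auto simp: corner_def case_prod_unfold prod_eq_iff)

text \<open>In the group, \<open>j w\<close> times the word \<open>u\<close> is the word \<open>push w u\<close> times a word in the \<open>j\<close>'s;
  likewise \<open>pull w\<close> for the inverse of \<open>j w\<close>.\<close>

fun push :: "'w \<Rightarrow> 'v sword \<Rightarrow> 'v sword" where
  "push w [] = []"
| "push w ((y, True) # u) = (lower w y, True) # push (right (lower w y) w) u"
| "push w ((y, False) # u) = (fst (corner (y, w)), False) # push (snd (corner (y, w))) u"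

fun pull :: "'w \<Rightarrow> 'v sword \<Rightarrow> 'v sword" where
  "pull w [] = []"
| "pull w ((v, True) # u) = (upper v w, True) # pull (right v w) u"
| "pull w ((v, False) # u) = (upper v (left v w), False) # pull (left v w) u"

lemma pull_push: "pull w (push w u) = u"
proof (induction w u rule: push.induct)
  case (3 w y u)
  have "left (fst (corner (y, w))) w = snd (corner (y, w))"
    using upper_right_corner(2)[of "(y, w)"] by (metis left_right snd_conv)
  then show ?case using 3 by (simp add: upper_right_corner)
qed simp_all

lemma push_pull: "push w (pull w u) = u"
proof (induction w u rule: pull.induct)
  case (3 w v u)
  have "corner (upper v (left v w), w) = (v, left v w)"
    using corner_upper_right[of v "left v w"] by simp
  then show ?case using 3 by simp
qed simp_all

text \<open>The case to check is a cancellation. Crossing a letter and then a letter of opposite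
  sign leads through the same square twice exactly when the two letters cancel, and then the
  vertical edge returns to w.\<close>

lemma push_lmul_True:
  "push w (lmul (y, True) u) = lmul (lower w y, True) (push (right (lower w y) w) u)"
proof (cases u)
  case (Cons l u')
  obtain z e where l: "l = (z, e)" by fastforce
  define v where "v = lower w y"
  have y: "y = upper v w" by (simp add: v_def)
  show ?thesis
  proof (cases e)
    case True
    then show ?thesis by (simp add: Cons l lmul_def)
  next
    case False
    have "fst (corner (z, right v w)) = v \<longleftrightarrow> z = y"
      by (metis corner_upper_right fst_conv left_right snd_conv surjective_pairing upper_right_corner y)
    then show ?thesis using False by (auto simp: Cons l lmul_def y)
  qed
qed (simp add: lmul_def)

lemma push_lmul_False:
  "push w (lmul (y, False) u) = lmul (fst (corner (y, w)), False) (push (snd (corner (y, w))) u)"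
proof (cases u)
  case (Cons l u')
  obtain z e where l: "l = (z, e)" by fastforce
  obtain v x where vx: "corner (y, w) = (v, x)" by fastforce
  have y: "upper v x = y" and w: "right v x = w"
    using upper_right_corner[of "(y, w)"] vx by simp_all
  show ?thesis
  proof (cases e)
    case False
    then show ?thesis by (simp add: Cons l lmul_def)
  next
    case True
    have "lower x z = v \<longleftrightarrow> z = y" using y by (metis lower_upper upper_lower)
    moreover have "lower x y = v" using y lower_upper by metis
    ultimately show ?thesis using True by (auto simp: Cons l lmul_def vx w)
  qed
qed (simp add: lmul_def)

text \<open>A reduced word is built by \<open>lmul\<close>; pushing turns every such step into
  another \<open>lmul\<close>, which preserves reducedness.\<close>

lemma reduced_push: "reduced u \<Longrightarrow> reduced (push w u)"
proof (induction u arbitrary: w)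
  case (Cons l u)
  obtain y e where l: "l = (y, e)" by fastforce
  have "\<exists>l' w'. push w (lmul l u) = lmul l' (push w' u)"
    using push_lmul_True[of w y u] push_lmul_False[of w y u] unfolding l by (cases e) auto
  then obtain l' w' where "push w (l # u) = lmul l' (push w' u)"
    using Cons.prems by (auto simp: lmul_of_reduced)
  then show ?case
    using Cons.IH Cons.prems reduced_ConsD by (metis reduced_lmul)
qed simp

lemma pull_lmul_True: "pull w (lmul (v, True) u) = lmul (upper v w, True) (pull (right v w) u)"
  by (metis lower_upper pull_push push_lmul_True push_pull)

lemma pull_lmul_False: "pull w (lmul (v, False) u) = lmul (upper v (left v w), False) (pull (left v w) u)"
proof -
  have "corner (upper v (left v w), w) = (v, left v w)"
    using corner_upper_right[of v "left v w"] by simp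
  then have "push w (lmul (upper v (left v w), False) (pull (left v w) u)) = lmul (v, False) u"
    by (simp add: push_lmul_False push_pull)
  then show ?thesis by (metis pull_push)
qed

lemma reduced_pull: "reduced u \<Longrightarrow> reduced (pull w u)"
proof (induction u arbitrary: w)
  case (Cons l u)
  obtain y e where l: "l = (y, e)" by fastforce
  have "\<exists>l' w'. pull w (lmul l u) = lmul l' (pull w' u)"
    using pull_lmul_True[of w y u] pull_lmul_False[of w y u] unfolding l by (cases e) auto
  then obtain l' w' where "pull w (l # u) = lmul l' (pull w' u)"
    using Cons.prems by (auto simp: lmul_of_reduced)
  then show ?case
    using Cons.IH Cons.prems reduced_ConsD by (metis reduced_lmul)
qed simp

lemma swap: "square_complex (\<lambda>w v. right v w) (\<lambda>w v. upper v w)"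
proof
  have "(\<lambda>(w, v). (right v w, upper v w)) = prod.swap \<circ> (\<lambda>(v, w). (upper v w, right v w)) \<circ> prod.swap"
    by auto
  moreover have "bij (prod.swap \<circ> (\<lambda>(v, w). (upper v w, right v w)) \<circ> prod.swap)"
    by (intro bij_comp bij_swap bij_both)
  ultimately show "bij (\<lambda>(w, v). (right v w, upper v w))" by simp
qed (use bij_upper bij_right in auto)

end

section \<open>The presented group: action on reduced words and normal form\<close>

locale square_presentation = square_complex upper right
  for upper :: "'v \<Rightarrow> 'w \<Rightarrow> 'v" and right :: "'v \<Rightarrow> 'w \<Rightarrow> 'w" +
  fixes R :: "('g word \<times> 'g word) set" and i :: "'v \<Rightarrow> 'g" and j :: "'w \<Rightarrow> 'g"
  assumes inj_i: "inj i" and inj_j: "inj j" and i_neq_j: "\<And>v w. i v \<noteq> j w"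
    and generators: "\<And>x. (\<exists>v. x = i v) \<or> (\<exists>w. x = j w)"
    and R_imp_square: "\<And>l r. (l, r) \<in> R \<Longrightarrow> \<exists>v w.
        {l, r} = {[(i v, True), (j (right v w), True)], [(j w, True), (i (upper v w), True)]}"
    and square: "\<And>v w. pres_eq R [(i v, True), (j (right v w), True)] [(j w, True), (i (upper v w), True)]"
begin

definition act_letter :: "'g \<times> bool \<Rightarrow> 'v sword \<Rightarrow> 'v sword" where
  "act_letter l u =
     (if fst l \<in> range i then lmul (inv_into UNIV i (fst l), snd l) u
      else (if snd l then push else pull) (inv_into UNIV j (fst l)) u)"

definition act_word :: "'g word \<Rightarrow> 'v sword \<Rightarrow> 'v sword" where
  "act_word x u = foldr act_letter x u"

lemma j_not_range_i [simp]: "j w \<notin> range i"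
  using i_neq_j by (metis rangeE)

lemma act_letter_simps [simp]:
  "act_letter (i v, e) u = lmul (v, e) u"
  "act_letter (j w, True) u = push w u"
  "act_letter (j w, False) u = pull w u"
  using inj_i inj_j by (simp_all add: act_letter_def)

lemma act_word_simps [simp]:
  "act_word [] u = u" "act_word (l # x) u = act_letter l (act_word x u)"
  "act_word (x @ y) u = act_word x (act_word y u)"
  by (simp_all add: act_word_def)

lemma letter_cases:
  obtains v e where "l = (i v, e)" | w where "l = (j w, True)" | w where "l = (j w, False)"
  using generators by (metis surj_pair)

lemma reduced_act_letter: "reduced u \<Longrightarrow> reduced (act_letter l u)"
  by (rule letter_cases[of l]) (auto simp: reduced_lmul reduced_push reduced_pull)

lemma reduced_act_word: "reduced u \<Longrightarrow> reduced (act_word x u)"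
  by (induction x) (auto simp: reduced_act_letter)

text \<open>The relation of a square acts trivially by \<open>push_lmul_True\<close>, y being the
  upper edge; a cancelling pair does so by \<open>lmul_flip\<close>, or because \<open>push\<close>
  and \<open>pull\<close> are inverse to each other. So the group acts on reduced words.\<close>

lemma act_word_cong: "pres_eq R x y \<Longrightarrow> reduced u \<Longrightarrow> act_word x u = act_word y u"
proof (induction arbitrary: u rule: pres_eq.induct)
  case (pres_append u1 v1 u2 v2)
  then show ?case by (simp add: reduced_act_word)
next
  case (pres_cancel x e)
  show ?case
  proof (rule letter_cases[of "(x, e)"])
    fix v e' assume "(x, e) = (i v, e')"
    then show ?thesis using lmul_flip[of u "(v, \<not> e)"] pres_cancel by simp
  qed (auto simp: push_pull pull_push)
next
  case (pres_rel l r)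
  then obtain v w where vw:
    "{l, r} = {[(i v, True), (j (right v w), True)], [(j w, True), (i (upper v w), True)]}"
    using R_imp_square by blast
  have "act_word [(i v, True), (j (right v w), True)] u = act_word [(j w, True), (i (upper v w), True)] u"
    by (simp add: push_lmul_True)
  then show ?case using vw by (metis doubleton_eq_iff)
qed simp_all

text \<open>Both sides of a square relation contain one positive letter from \<open>i\<close>, so
  the exponent sum of these letters is a homomorphism to the integers. It separates the ends of an
  edge, bounds displacements from below and reads off the position along an axis.\<close>

definition letter_height :: "'g \<times> bool \<Rightarrow> int" where
  "letter_height l = (if fst l \<in> range i then if snd l then 1 else -1 else 0)"

definition word_height :: "'g word \<Rightarrow> int" where
  "word_height x = sum_list (map letter_height x)"

lemma word_height_cong: "pres_eq R x y \<Longrightarrow> word_height x = word_height y"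
proof (induction rule: pres_eq.induct)
  case (pres_rel l r)
  then obtain v w where vw:
    "{l, r} = {[(i v, True), (j (right v w), True)], [(j w, True), (i (upper v w), True)]}"
    using R_imp_square by blast
  then show ?case by (auto simp: word_height_def letter_height_def doubleton_eq_iff)
qed (auto simp: word_height_def letter_height_def)

abbreviation "G \<equiv> presented_group R"

definition gi :: "'v \<Rightarrow> 'g word set" where "gi v = pres_gen R (i v)"
definition gj :: "'w \<Rightarrow> 'g word set" where "gj w = pres_gen R (j w)"

definition H :: "'g word set set" where "H = generate G (range gj)"
definition K :: "'g word set set" where "K = generate G (range gi)"

text \<open>A representing word is chosen arbitrarily; on reduced words the choice does not matter,
  by \<open>act_word_cong\<close>.\<close>

definition gact :: "'g word set \<Rightarrow> 'v sword \<Rightarrow> 'v sword" where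
  "gact g u = act_word (SOME x. g = pres_class R x) u"

definition height :: "'g word set \<Rightarrow> int" where
  "height g = word_height (SOME x. g = pres_class R x)"

sublocale G: group G
  by (rule group_presented_group)

lemma some_word: "pres_eq R (SOME y. pres_class R x = pres_class R y) x"
  by (metis (mono_tags, lifting) pres_class_eq_iff someI_ex pres_sym)

lemma gact_class: "reduced u \<Longrightarrow> gact (pres_class R x) u = act_word x u"
  unfolding gact_def by (rule act_word_cong[OF some_word])

lemma height_class: "height (pres_class R x) = word_height x"
  unfolding height_def by (rule word_height_cong[OF some_word])

lemma carrierE:
  assumes "g \<in> carrier G"
  obtains x where "g = pres_class R x"
  using assms by (auto simp: carrier_presented_group)

lemma class_in_carrier [simp, intro]: "pres_class R x \<in> carrier G"
  by (simp add: carrier_presented_group)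

lemma class_Cons: "pres_class R (l # y) = pres_class R [l] \<otimes>\<^bsub>G\<^esub> pres_class R y"
  by (simp add: presented_group_mult)

lemma class_Nil: "pres_class R [] = \<one>\<^bsub>G\<^esub>"
  by (simp add: one_presented_group)

lemma gi_closed [simp, intro]: "gi v \<in> carrier G" and gj_closed [simp, intro]: "gj w \<in> carrier G"
  by (simp_all add: gi_def gj_def pres_gen_def)

lemma class_inverse: "pres_class R [(x, False)] = inv\<^bsub>G\<^esub> (pres_class R [(x, True)])"
proof -
  have "pres_class R [(x, False)] \<otimes>\<^bsub>G\<^esub> pres_class R [(x, True)] = \<one>\<^bsub>G\<^esub>"
    using pres_cancel[of R x False]
    by (simp add: presented_group_mult one_presented_group pres_class_eq_iff)
  then show ?thesis by (simp add: G.inv_equality)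
qed

lemma class_gi: "pres_class R [(i v, True)] = gi v" "pres_class R [(i v, False)] = inv\<^bsub>G\<^esub> (gi v)"
  and class_gj: "pres_class R [(j w, True)] = gj w" "pres_class R [(j w, False)] = inv\<^bsub>G\<^esub> (gj w)"
  by (simp_all add: gi_def gj_def pres_gen_def class_inverse)

lemma square_relation: "gi v \<otimes>\<^bsub>G\<^esub> gj (right v w) = gj w \<otimes>\<^bsub>G\<^esub> gi (upper v w)"
  using square[of v w] by (simp add: gi_def gj_def pres_gen_def presented_group_mult pres_class_eq_iff)

lemma gact_mult:
  assumes "g \<in> carrier G" "h \<in> carrier G" "reduced u"
  shows "gact (g \<otimes>\<^bsub>G\<^esub> h) u = gact g (gact h u)"
  using assms by (auto elim!: carrierE simp: presented_group_mult gact_class reduced_act_word)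

lemma reduced_gact: "reduced u \<Longrightarrow> reduced (gact g u)"
  by (simp add: gact_def reduced_act_word)

lemma height_mult:
  assumes "g \<in> carrier G" "h \<in> carrier G"
  shows "height (g \<otimes>\<^bsub>G\<^esub> h) = height g + height h"
  using assms by (auto elim!: carrierE simp: presented_group_mult height_class word_height_def)

lemma height_one: "height \<one>\<^bsub>G\<^esub> = 0"
  unfolding class_Nil[symmetric] height_class by (simp add: word_height_def)

lemma height_inv: "g \<in> carrier G \<Longrightarrow> height (inv\<^bsub>G\<^esub> g) = - height g"
  using height_mult[of g "inv\<^bsub>G\<^esub> g"] by (simp add: height_one)

lemma height_gi [simp]: "height (gi v) = 1" and height_gj [simp]: "height (gj w) = 0"
  unfolding class_gi[symmetric] class_gj[symmetric] height_class
  by (simp_all add: word_height_def letter_height_def)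

lemma height_nat_pow: "g \<in> carrier G \<Longrightarrow> height (g [^]\<^bsub>G\<^esub> (n::nat)) = int n * height g"
  by (induction n) (auto simp: height_one height_mult algebra_simps)

lemma height_int_pow: "g \<in> carrier G \<Longrightarrow> height (g [^]\<^bsub>G\<^esub> (n::int)) = n * height g"
  by (cases n rule: int_cases2)
    (auto simp: height_nat_pow height_inv G.int_pow_neg int_pow_int)

lemma subgroup_H: "subgroup H G" and subgroup_K: "subgroup K G"
  unfolding H_def K_def by (rule G.generate_is_subgroup; auto)+

lemma H_closed: "h \<in> H \<Longrightarrow> h \<in> carrier G"
  using subgroup_H by (rule subgroup.mem_carrier)

lemma gj_in_H: "gj w \<in> H"
  by (auto simp: H_def intro: generate.incl)

lemma height_H: "h \<in> H \<Longrightarrow> height h = 0"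
  unfolding H_def
proof (induction rule: generate.induct)
  case (eng h1 h2)
  then show ?case using H_closed by (simp add: height_mult H_def)
qed (auto simp: height_one height_inv)

lemma gact_H_Nil: "h \<in> H \<Longrightarrow> gact h [] = []"
  unfolding H_def
proof (induction rule: generate.induct)
  case one
  then show ?case unfolding class_Nil[symmetric] by (simp add: gact_class)
next
  case (incl h)
  then show ?case by (auto simp: class_gj[symmetric] gact_class)
next
  case (inv h)
  then show ?case by (auto simp: gact_class simp flip: class_gj(2))
next
  case (eng h1 h2)
  then show ?case using H_closed by (simp add: gact_mult H_def)
qed

text \<open>Neither \<open>push\<close> nor \<open>pull\<close> changes the sign of a letter, so the
  stabilizer \<open>H\<close> of the base vertex permutes the positively oriented edges issuing from
  it.\<close>

lemma gact_H_single: "h \<in> H \<Longrightarrow> \<exists>v'. gact h [(v, True)] = [(v', True)]"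
  unfolding H_def
proof (induction arbitrary: v rule: generate.induct)
  case one
  then show ?case unfolding class_Nil[symmetric] by (simp add: gact_class)
next
  case (incl h)
  then show ?case by (auto simp: class_gj[symmetric] gact_class)
next
  case (inv h)
  then show ?case by (auto simp: gact_class simp flip: class_gj(2))
next
  case (eng h1 h2)
  then show ?case using H_closed by (simp add: gact_mult H_def) metis
qed

definition word_elt :: "'v sword \<Rightarrow> 'g word set" where
  "word_elt u = pres_class R (map (\<lambda>(v, e). (i v, e)) u)"

lemma word_elt_closed [simp, intro]: "word_elt u \<in> carrier G"
  by (simp add: word_elt_def)

lemma word_elt_Nil: "word_elt [] = \<one>\<^bsub>G\<^esub>"
  by (simp add: word_elt_def class_Nil)

lemma word_elt_Cons: "word_elt ((v, e) # u) = pres_class R [(i v, e)] \<otimes>\<^bsub>G\<^esub> word_elt u"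
  by (simp add: word_elt_def presented_group_mult)

lemma class_flip: "pres_class R [(x, e)] \<otimes>\<^bsub>G\<^esub> pres_class R [(x, \<not> e)] = \<one>\<^bsub>G\<^esub>"
  by (simp add: presented_group_mult one_presented_group pres_class_eq_iff pres_cancel)

lemma word_elt_lmul: "word_elt (lmul (v, e) u) = pres_class R [(i v, e)] \<otimes>\<^bsub>G\<^esub> word_elt u"
proof (cases "\<exists>u'. u = (v, \<not> e) # u'")
  case True
  then obtain u' where u: "u = (v, \<not> e) # u'" by blast
  have "pres_class R [(i v, e)] \<otimes>\<^bsub>G\<^esub> word_elt u = word_elt u'"
    unfolding u word_elt_Cons by (simp add: G.m_assoc[symmetric] class_flip)
  then show ?thesis by (simp add: u lmul_def)
next
  case False
  then have "lmul (v, e) u = (v, e) # u" by (auto simp: lmul_def split: list.split)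
  then show ?thesis by (simp add: word_elt_Cons)
qed

lemma act_word_word_elt: "act_word (map (\<lambda>(v, e). (i v, e)) u) u' = foldr lmul u u'"
  by (induction u) auto

lemma foldr_lmul_reduced: "reduced (u @ u') \<Longrightarrow> foldr lmul u u' = u @ u'"
proof (induction u)
  case (Cons l u)
  then show ?case using reduced_ConsD[of l "u @ u'"] by (simp add: lmul_of_reduced)
qed simp

lemma gact_word_elt: "reduced u' \<Longrightarrow> gact (word_elt u) u' = foldr lmul u u'"
  by (simp add: word_elt_def gact_class act_word_word_elt)

lemma gact_word_elt_Nil: "reduced u \<Longrightarrow> gact (word_elt u) [] = u"
  using foldr_lmul_reduced[of u "[]"] by (simp add: gact_word_elt)

lemma push_word_elt: "\<exists>h\<in>H. gj w \<otimes>\<^bsub>G\<^esub> word_elt u = word_elt (push w u) \<otimes>\<^bsub>G\<^esub> h"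
proof (induction w u rule: push.induct)
  case (1 w)
  show ?case using gj_in_H[of w] by (intro bexI[of _ "gj w"]) (simp_all add: word_elt_Nil)
next
  case (2 w y u)
  let ?v = "lower w y" let ?r = "right ?v w"
  obtain h where h: "h \<in> H" "gj ?r \<otimes>\<^bsub>G\<^esub> word_elt u = word_elt (push ?r u) \<otimes>\<^bsub>G\<^esub> h" using 2 by blast
  have "gj w \<otimes>\<^bsub>G\<^esub> word_elt ((y, True) # u) = (gj w \<otimes>\<^bsub>G\<^esub> gi (upper ?v w)) \<otimes>\<^bsub>G\<^esub> word_elt u"
    by (simp add: word_elt_Cons class_gi G.m_assoc)
  also have "\<dots> = gi ?v \<otimes>\<^bsub>G\<^esub> (gj ?r \<otimes>\<^bsub>G\<^esub> word_elt u)"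
    unfolding square_relation[symmetric] by (simp add: G.m_assoc)
  also have "\<dots> = word_elt (push w ((y, True) # u)) \<otimes>\<^bsub>G\<^esub> h"
    using H_closed[OF h(1)] by (simp add: h(2) word_elt_Cons class_gi G.m_assoc)
  finally show ?case using h(1) by blast
next
  case (3 w y u)
  obtain v x where vx: "corner (y, w) = (v, x)" by fastforce
  have y: "upper v x = y" and w: "right v x = w"
    using upper_right_corner[of "(y, w)"] vx by simp_all
  obtain h where h: "h \<in> H" "gj x \<otimes>\<^bsub>G\<^esub> word_elt u = word_elt (push x u) \<otimes>\<^bsub>G\<^esub> h" using 3 vx by auto
  \<comment> \<open>For a negative letter the known edges of the square are the upper and the right
    one, so the square relation is solved for the product of the right edge and the inverse of the
    upper edge.\<close>
  have "gi v \<otimes>\<^bsub>G\<^esub> gj w = gj x \<otimes>\<^bsub>G\<^esub> gi y"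
    using square_relation[of v x] by (simp add: y w)
  then have "gi v \<otimes>\<^bsub>G\<^esub> gj w \<otimes>\<^bsub>G\<^esub> inv\<^bsub>G\<^esub> gi y = gj x"
    by (metis G.inv_solve_right G.m_closed gi_closed gj_closed)
  then have "gi v \<otimes>\<^bsub>G\<^esub> (gj w \<otimes>\<^bsub>G\<^esub> inv\<^bsub>G\<^esub> gi y) = gj x"
    by (simp add: G.m_assoc)
  then have "gj w \<otimes>\<^bsub>G\<^esub> inv\<^bsub>G\<^esub> gi y = inv\<^bsub>G\<^esub> gi v \<otimes>\<^bsub>G\<^esub> gj x"
    using G.inv_solve_left[of "gj w \<otimes>\<^bsub>G\<^esub> inv\<^bsub>G\<^esub> gi y" "gi v" "gj x"] by simp
  then have "gj w \<otimes>\<^bsub>G\<^esub> word_elt ((y, False) # u) = (inv\<^bsub>G\<^esub> gi v \<otimes>\<^bsub>G\<^esub> gj x) \<otimes>\<^bsub>G\<^esub> word_elt u"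
    by (simp add: word_elt_Cons class_gi G.m_assoc[symmetric])
  also have "\<dots> = inv\<^bsub>G\<^esub> gi v \<otimes>\<^bsub>G\<^esub> (gj x \<otimes>\<^bsub>G\<^esub> word_elt u)"
    by (simp add: G.m_assoc)
  also have "\<dots> = word_elt (push w ((y, False) # u)) \<otimes>\<^bsub>G\<^esub> h"
    using H_closed[OF h(1)] by (simp add: h(2) vx word_elt_Cons class_gi G.m_assoc)
  finally show ?case using h(1) by blast
qed

lemma pull_word_elt: "\<exists>h\<in>H. inv\<^bsub>G\<^esub> (gj w) \<otimes>\<^bsub>G\<^esub> word_elt u = word_elt (pull w u) \<otimes>\<^bsub>G\<^esub> h"
proof -
  obtain h where h: "h \<in> H" "gj w \<otimes>\<^bsub>G\<^esub> word_elt (pull w u) = word_elt u \<otimes>\<^bsub>G\<^esub> h"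
    using push_word_elt[of w "pull w u"] by (auto simp: push_pull)
  have hc: "h \<in> carrier G" using h(1) by (rule H_closed)
  have "word_elt u = (gj w \<otimes>\<^bsub>G\<^esub> word_elt (pull w u)) \<otimes>\<^bsub>G\<^esub> inv\<^bsub>G\<^esub> h"
    using h(2) hc G.inv_solve_right[of "word_elt u" "gj w \<otimes>\<^bsub>G\<^esub> word_elt (pull w u)" h] by blast
  then have "word_elt u = gj w \<otimes>\<^bsub>G\<^esub> (word_elt (pull w u) \<otimes>\<^bsub>G\<^esub> inv\<^bsub>G\<^esub> h)"
    using hc by (simp add: G.m_assoc)
  then have "inv\<^bsub>G\<^esub> (gj w) \<otimes>\<^bsub>G\<^esub> word_elt u = word_elt (pull w u) \<otimes>\<^bsub>G\<^esub> inv\<^bsub>G\<^esub> h"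
    using hc G.inv_solve_left[of "word_elt (pull w u) \<otimes>\<^bsub>G\<^esub> inv\<^bsub>G\<^esub> h" "gj w" "word_elt u"] by simp
  then show ?thesis using subgroup.m_inv_closed[OF subgroup_H h(1)] by blast
qed

text \<open>Every left coset of \<open>H\<close> contains a word in the generators \<open>i\<close>,
  and the action computes it. For empty u this is the normal form \<open>decompose\<close>.\<close>

lemma class_word_elt: "\<exists>h\<in>H. pres_class R x \<otimes>\<^bsub>G\<^esub> word_elt u = word_elt (act_word x u) \<otimes>\<^bsub>G\<^esub> h"
proof (induction x)
  case Nil
  show ?case using subgroup.one_closed[OF subgroup_H]
    by (intro bexI[of _ "\<one>\<^bsub>G\<^esub>"]) (simp_all add: class_Nil)
next
  case (Cons l x)
  then obtain h where h: "h \<in> H" "pres_class R x \<otimes>\<^bsub>G\<^esub> word_elt u = word_elt (act_word x u) \<otimes>\<^bsub>G\<^esub> h"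
    by blast
  have hc: "h \<in> carrier G" using h(1) by (rule H_closed)
  let ?u = "act_word x u"
  have "\<exists>h'\<in>H. pres_class R [l] \<otimes>\<^bsub>G\<^esub> word_elt ?u = word_elt (act_letter l ?u) \<otimes>\<^bsub>G\<^esub> h'"
  proof (rule letter_cases[of l])
    fix v e assume "l = (i v, e)"
    then show ?thesis
      using subgroup.one_closed[OF subgroup_H] by (auto simp: word_elt_lmul intro!: bexI[of _ "\<one>\<^bsub>G\<^esub>"])
  next
    fix w assume "l = (j w, True)"
    then show ?thesis using push_word_elt by (simp add: class_gj)
  next
    fix w assume "l = (j w, False)"
    then show ?thesis using pull_word_elt by (simp add: class_gj)
  qed
  then obtain h' where h': "h' \<in> H" "pres_class R [l] \<otimes>\<^bsub>G\<^esub> word_elt ?u = word_elt (act_letter l ?u) \<otimes>\<^bsub>G\<^esub> h'"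
    by blast
  have h'c: "h' \<in> carrier G" using h'(1) by (rule H_closed)
  have "pres_class R (l # x) \<otimes>\<^bsub>G\<^esub> word_elt u = pres_class R [l] \<otimes>\<^bsub>G\<^esub> (pres_class R x \<otimes>\<^bsub>G\<^esub> word_elt u)"
    unfolding class_Cons[of l x] by (simp add: G.m_assoc)
  also have "\<dots> = (pres_class R [l] \<otimes>\<^bsub>G\<^esub> word_elt ?u) \<otimes>\<^bsub>G\<^esub> h"
    using hc by (simp add: h(2) G.m_assoc)
  also have "\<dots> = word_elt (act_word (l # x) u) \<otimes>\<^bsub>G\<^esub> (h' \<otimes>\<^bsub>G\<^esub> h)"
    using hc h'c by (simp add: h'(2) G.m_assoc)
  finally show ?case using subgroup.m_closed[OF subgroup_H h'(1) h(1)] by blast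
qed

lemma decompose:
  assumes "g \<in> carrier G"
  obtains h where "h \<in> H" "g = word_elt (gact g []) \<otimes>\<^bsub>G\<^esub> h"
proof -
  obtain x where x: "g = pres_class R x" using assms by (rule carrierE)
  show ?thesis
    using class_word_elt[of x "[]"] that by (auto simp: x gact_class word_elt_Nil)
qed

lemma gact_mult_H: "g \<in> carrier G \<Longrightarrow> h \<in> H \<Longrightarrow> gact (g \<otimes>\<^bsub>G\<^esub> h) [] = gact g []"
  by (simp add: gact_mult H_closed gact_H_Nil)

lemma K_word_elt: "k \<in> K \<Longrightarrow> \<exists>u. reduced u \<and> k = word_elt u"
  unfolding K_def
proof (induction rule: generate.induct)
  case one
  show ?case by (intro exI[of _ "[]"]) (simp add: word_elt_Nil)
next
  case (incl h)
  then obtain v where "h = gi v" by blast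
  then show ?case by (intro exI[of _ "[(v, True)]"]) (simp add: word_elt_Cons word_elt_Nil class_gi)
next
  case (inv h)
  then obtain v where "h = gi v" by blast
  then show ?case by (intro exI[of _ "[(v, False)]"]) (simp add: word_elt_Cons word_elt_Nil class_gi)
next
  case (eng h1 h2)
  then obtain u1 u2 where u: "reduced u1" "h1 = word_elt u1" "reduced u2" "h2 = word_elt u2" by blast
  have "word_elt u1 \<otimes>\<^bsub>G\<^esub> word_elt u2 = word_elt (foldr lmul u1 u2)"
  proof (induction u1)
    case (Cons l u1)
    then show ?case by (cases l) (simp add: word_elt_Cons word_elt_lmul G.m_assoc)
  qed (simp add: word_elt_Nil)
  moreover have "reduced (foldr lmul u1 u2)"
    using u(3) by (induction u1) (auto simp: reduced_lmul)
  ultimately show ?case using u by metis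
qed

text \<open>Applied to the empty word, an element of \<open>K\<close> gives its own reduced word,
  whereas an element of \<open>H\<close> gives the empty word. Since \<open>H\<close> and
  \<open>K\<close> stabilize the base vertices of the two trees, the action on pairs of vertices
  will be free.\<close>

lemma K_Int_H: "K \<inter> H = {\<one>\<^bsub>G\<^esub>}"
proof -
  have "k = \<one>\<^bsub>G\<^esub>" if "k \<in> K" "k \<in> H" for k
    using that K_word_elt[of k] gact_H_Nil[of k] gact_word_elt_Nil by (auto simp: word_elt_Nil)
  then show ?thesis
    using subgroup.one_closed[OF subgroup_H] subgroup.one_closed[OF subgroup_K] by blast
qed

text \<open>Neighbours differ by one final letter, as in the Cayley tree of a free group: the label
  of the edge is carried through the \<open>H\<close> part of g, which keeps it a single positive
  letter, and is then appended or cancels.\<close>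

lemma edge_words:
  assumes "g \<in> carrier G"
  shows "\<exists>l. gact (g \<otimes>\<^bsub>G\<^esub> gi v) [] = gact g [] @ [l] \<or> gact g [] = gact (g \<otimes>\<^bsub>G\<^esub> gi v) [] @ [l]"
proof -
  define u where "u = gact g []"
  have red: "reduced u" by (simp add: u_def reduced_gact)
  obtain h where h: "h \<in> H" "g = word_elt u \<otimes>\<^bsub>G\<^esub> h" using decompose[OF assms] u_def by blast
  obtain v' where v': "gact h [(v, True)] = [(v', True)]" using gact_H_single[OF h(1)] by blast
  have "gact (gi v) [] = [(v, True)]"
    by (simp add: class_gi(1)[symmetric] gact_class lmul_def)
  then have "gact (g \<otimes>\<^bsub>G\<^esub> gi v) [] = gact (word_elt u) (gact h [(v, True)])"
    using h assms H_closed by (simp add: gact_mult)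
  then have *: "gact (g \<otimes>\<^bsub>G\<^esub> gi v) [] = foldr lmul u [(v', True)]"
    by (simp add: v' gact_word_elt)
  show ?thesis
  proof (cases "u \<noteq> [] \<and> last u = (v', False)")
    case True
    then obtain u' where u': "u = u' @ [(v', False)]" by (metis append_butlast_last_id)
    have "reduced u'" using red by (simp add: u' reduced_def successively_append_iff)
    then have "foldr lmul u [(v', True)] = u'"
      using foldr_lmul_reduced[of u' "[]"] by (simp add: u' lmul_def)
    then show ?thesis using * u' u_def by metis
  next
    case False
    then have "reduced (u @ [(v', True)])"
      using red by (auto simp: reduced_def successively_append_iff)
    then show ?thesis using * foldr_lmul_reduced u_def by metis
  qed
qed

end

section \<open>Metric graphs\<close>


definition affine_ext :: "('a \<Rightarrow> real) \<Rightarrow> ('a \<Rightarrow> real) \<Rightarrow> real" where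
  "affine_ext k \<xi> = (\<Sum>x | \<xi> x \<noteq> 0. k x * \<xi> x)"

lemma closed_cell_support: "\<xi> \<in> closed_cell s \<Longrightarrow> {x. \<xi> x \<noteq> 0} \<subseteq> s"
  by (auto simp: closed_cell_def)

lemma affine_ext_cell:
  assumes "\<xi> \<in> closed_cell s" "finite s"
  shows "affine_ext k \<xi> = (\<Sum>x\<in>s. k x * \<xi> x)"
  unfolding affine_ext_def
  using assms closed_cell_support[OF assms(1)] by (intro sum.mono_neutral_left) auto

lemma cell_dist_cell:
  assumes "\<xi> \<in> closed_cell s" "\<eta> \<in> closed_cell s" "finite s"
  shows "cell_dist \<xi> \<eta> = (\<Sum>x\<in>s. \<bar>\<xi> x - \<eta> x\<bar>) / 2"
proof -
  have "(\<Sum>x | \<xi> x \<noteq> 0 \<or> \<eta> x \<noteq> 0. \<bar>\<xi> x - \<eta> x\<bar>) = (\<Sum>x\<in>s. \<bar>\<xi> x - \<eta> x\<bar>)"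
    using assms closed_cell_support[OF assms(1)] closed_cell_support[OF assms(2)]
    by (intro sum.mono_neutral_left) auto
  then show ?thesis by (simp add: cell_dist_def)
qed

lemma closed_cell_doubleton:
  assumes "p \<noteq> q"
  shows "\<xi> \<in> closed_cell {p, q} \<longleftrightarrow>
    0 \<le> \<xi> p \<and> 0 \<le> \<xi> q \<and> \<xi> p + \<xi> q = 1 \<and> (\<forall>x. x \<noteq> p \<longrightarrow> x \<noteq> q \<longrightarrow> \<xi> x = 0)"
  using assms by (auto simp: closed_cell_def)

lemma closed_cell_singleton: "\<xi> \<in> closed_cell {p} \<longleftrightarrow> \<xi> = vertex_point p"
proof
  assume "\<xi> \<in> closed_cell {p}"
  then show "\<xi> = vertex_point p" by (auto simp: closed_cell_def vertex_point_def)
qed (simp add: closed_cell_def vertex_point_def)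

lemma cell_dist_nonneg: "0 \<le> cell_dist \<xi> \<eta>"
  by (simp add: cell_dist_def sum_nonneg)

lemma cell_dist_refl [simp]: "cell_dist \<xi> \<xi> = 0"
  by (simp add: cell_dist_def)

lemma cell_dist_sym: "cell_dist \<xi> \<eta> = cell_dist \<eta> \<xi>"
  by (simp add: cell_dist_def abs_minus_commute disj_commute)

lemma cell_dist_superset:
  assumes "finite s" "{x. \<xi> x \<noteq> 0} \<subseteq> s" "{x. \<eta> x \<noteq> 0} \<subseteq> s"
  shows "cell_dist \<xi> \<eta> = (\<Sum>x\<in>s. \<bar>\<xi> x - \<eta> x\<bar>) / 2"
proof -
  have "(\<Sum>x | \<xi> x \<noteq> 0 \<or> \<eta> x \<noteq> 0. \<bar>\<xi> x - \<eta> x\<bar>) = (\<Sum>x\<in>s. \<bar>\<xi> x - \<eta> x\<bar>)"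
    using assms by (intro sum.mono_neutral_left) auto
  then show ?thesis by (simp add: cell_dist_def)
qed

lemma cell_dist_triangle:
  assumes "finite {x. \<xi> x \<noteq> 0}" "finite {x. \<eta> x \<noteq> 0}" "finite {x. \<zeta> x \<noteq> 0}"
  shows "cell_dist \<xi> \<zeta> \<le> cell_dist \<xi> \<eta> + cell_dist \<eta> \<zeta>"
proof -
  let ?s = "{x. \<xi> x \<noteq> 0} \<union> {x. \<eta> x \<noteq> 0} \<union> {x. \<zeta> x \<noteq> 0}"
  have fin: "finite ?s" using assms by simp
  have "(\<Sum>x\<in>?s. \<bar>\<xi> x - \<zeta> x\<bar>) \<le> (\<Sum>x\<in>?s. \<bar>\<xi> x - \<eta> x\<bar> + \<bar>\<eta> x - \<zeta> x\<bar>)"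
    by (intro sum_mono) linarith
  moreover have "cell_dist \<xi> \<zeta> = (\<Sum>x\<in>?s. \<bar>\<xi> x - \<zeta> x\<bar>) / 2"
    "cell_dist \<xi> \<eta> = (\<Sum>x\<in>?s. \<bar>\<xi> x - \<eta> x\<bar>) / 2" "cell_dist \<eta> \<zeta> = (\<Sum>x\<in>?s. \<bar>\<eta> x - \<zeta> x\<bar>) / 2"
    by (rule cell_dist_superset[OF fin]; auto)+
  ultimately show ?thesis by (simp add: sum.distrib)
qed

lemma cell_dist_pos:
  assumes "finite {x. \<xi> x \<noteq> 0}" "finite {x. \<eta> x \<noteq> 0}" "\<xi> \<noteq> \<eta>"
  shows "0 < cell_dist \<xi> \<eta>"
proof -
  obtain x where x: "\<xi> x \<noteq> \<eta> x" using assms(3) by blast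
  have "finite {x. \<xi> x \<noteq> 0 \<or> \<eta> x \<noteq> 0}"
    unfolding Collect_disj_eq using assms by blast
  then have "0 < (\<Sum>x | \<xi> x \<noteq> 0 \<or> \<eta> x \<noteq> 0. \<bar>\<xi> x - \<eta> x\<bar>)"
    using x by (intro sum_pos2[of _ x]) auto
  then show ?thesis by (simp add: cell_dist_def)
qed

lemma pl_path_single: "pl_path T \<xi> \<eta> [z] \<longleftrightarrow> \<xi> = z \<and> \<eta> = z \<and> z \<in> realization T"
  by (auto simp: pl_path_def)

lemma pl_path_Cons:
  "pl_path T \<xi> \<eta> (z # z' # zs) \<longleftrightarrow> \<xi> = z \<and> z \<in> realization T \<and>
     (\<exists>s\<in>graph_cells T. z \<in> closed_cell s \<and> z' \<in> closed_cell s) \<and> pl_path T z' \<eta> (z' # zs)"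
proof -
  have "(\<forall>i. Suc i < length (z # z' # zs) \<longrightarrow> P ((z # z' # zs) ! i) ((z # z' # zs) ! Suc i)) \<longleftrightarrow>
      P z z' \<and> (\<forall>i. Suc i < length (z' # zs) \<longrightarrow> P ((z' # zs) ! i) ((z' # zs) ! Suc i))" for P
    using All_less_Suc2[of "length zs" "\<lambda>i. P ((z # z' # zs) ! i) ((z # z' # zs) ! Suc i)"]
    by simp
  from this[of "\<lambda>z z'. \<exists>s\<in>graph_cells T. z \<in> closed_cell s \<and> z' \<in> closed_cell s"] show ?thesis
    unfolding pl_path_def by (simp only: list.sel last.simps list.set) auto
qed

lemma pl_length_single [simp]: "pl_length [z] = 0"
  by (simp add: pl_length_def)

lemma pl_length_Cons [simp]: "pl_length (z # z' # zs) = cell_dist z z' + pl_length (z' # zs)"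
  by (simp add: pl_length_def sum.lessThan_Suc_shift del: sum.lessThan_Suc)

lemma pl_length_nonneg: "0 \<le> pl_length zs"
  by (simp add: pl_length_def sum_nonneg cell_dist_nonneg)

lemma pl_path_append:
  "pl_path T \<xi> \<eta> zs \<Longrightarrow> pl_path T \<eta> \<zeta> ws \<Longrightarrow>
     \<exists>us. pl_path T \<xi> \<zeta> us \<and> pl_length us = pl_length zs + pl_length ws"
proof (induction zs arbitrary: \<xi> rule: induct_list012)
  case 1
  then show ?case by (simp add: pl_path_def)
next
  case (2 z)
  then show ?case by (intro exI[of _ ws]) (simp add: pl_path_single)
next
  case (3 z z' zs)
  then obtain us where us: "pl_path T z' \<zeta> us" "pl_length us = pl_length (z' # zs) + pl_length ws"
    by (auto simp: pl_path_Cons)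
  then obtain us' where us': "us = z' # us'" by (cases us) (auto simp: pl_path_def)
  show ?case
    using us 3 unfolding us' by (intro exI[of _ "z # z' # us'"]) (auto simp: pl_path_Cons)
qed

lemma pl_path_rev:
  "pl_path T \<xi> \<eta> zs \<Longrightarrow> \<exists>us. pl_path T \<eta> \<xi> us \<and> pl_length us = pl_length zs"
proof (induction zs arbitrary: \<xi> rule: induct_list012)
  case 1
  then show ?case by (simp add: pl_path_def)
next
  case (2 z)
  then show ?case by (intro exI[of _ "[z]"]) (simp add: pl_path_single)
next
  case (3 z z' zs)
  then obtain us where us: "pl_path T \<eta> z' us" "pl_length us = pl_length (z' # zs)"
    by (auto simp: pl_path_Cons)
  have "pl_path T z' \<xi> [z', z]"
    using 3 by (auto simp: pl_path_Cons pl_path_single realization_def)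
  from pl_path_append[OF us(1) this] us(2) show ?case
    by (simp add: cell_dist_sym algebra_simps)
qed

section \<open>The length metric of a connected graph\<close>

locale metric_graph =
  fixes T :: "'a ugraph"
  assumes edge: "\<And>e. e \<in> edges T \<Longrightarrow> \<exists>x y. e = {x, y} \<and> x \<noteq> y \<and> x \<in> verts T \<and> y \<in> verts T"
    and connected: "\<And>x y. x \<in> verts T \<Longrightarrow> y \<in> verts T \<Longrightarrow> (x, y) \<in> {(x, y). {x, y} \<in> edges T}\<^sup>*"
begin

lemma cell_finite: "s \<in> graph_cells T \<Longrightarrow> finite s"
  and cell_subset: "s \<in> graph_cells T \<Longrightarrow> s \<subseteq> verts T"
  using edge by (fastforce simp: graph_cells_def)+

lemma cellE:
  assumes "s \<in> graph_cells T"
  obtains x where "s = {x}" "x \<in> verts T"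
  | x y where "s = {x, y}" "x \<noteq> y" "x \<in> verts T" "y \<in> verts T" "{x, y} \<in> edges T"
proof (cases "s \<in> edges T")
  case True
  then show ?thesis using edge[OF True] that(2) by metis
next
  case False
  then show ?thesis using assms that(1) by (auto simp: graph_cells_def)
qed

lemma realization_support:
  assumes "\<xi> \<in> realization T"
  shows "finite {x. \<xi> x \<noteq> 0}" "{x. \<xi> x \<noteq> 0} \<subseteq> verts T"
proof -
  obtain s where s: "s \<in> graph_cells T" "\<xi> \<in> closed_cell s"
    using assms by (auto simp: realization_def)
  show "finite {x. \<xi> x \<noteq> 0}" "{x. \<xi> x \<noteq> 0} \<subseteq> verts T"
    using closed_cell_support[OF s(2)] cell_finite[OF s(1)] cell_subset[OF s(1)]
    by (auto dest: finite_subset)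
qed

definition pl_connected :: "('a \<Rightarrow> real) \<Rightarrow> ('a \<Rightarrow> real) \<Rightarrow> bool" where
  "pl_connected \<xi> \<eta> \<longleftrightarrow> (\<exists>zs. pl_path T \<xi> \<eta> zs)"

lemma pl_connected_trans: "pl_connected \<xi> \<eta> \<Longrightarrow> pl_connected \<eta> \<zeta> \<Longrightarrow> pl_connected \<xi> \<zeta>"
  unfolding pl_connected_def using pl_path_append by blast

lemma pl_connected_sym: "pl_connected \<xi> \<eta> \<Longrightarrow> pl_connected \<eta> \<xi>"
  unfolding pl_connected_def using pl_path_rev by blast

lemma cell_path:
  assumes "s \<in> graph_cells T" "\<xi> \<in> closed_cell s" "\<eta> \<in> closed_cell s"
  shows "pl_path T \<xi> \<eta> [\<xi>, \<eta>]"
  using assms by (auto simp: pl_path_Cons pl_path_single realization_def)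

lemma vertex_point_cell: "x \<in> s \<Longrightarrow> finite s \<Longrightarrow> vertex_point x \<in> closed_cell s"
  by (auto simp: closed_cell_def vertex_point_def)

lemma vertex_point_realization: "x \<in> verts T \<Longrightarrow> vertex_point x \<in> realization T"
  by (auto simp: realization_def graph_cells_def closed_cell_singleton)

lemma pl_connected_vertices:
  assumes "x \<in> verts T" "y \<in> verts T"
  shows "pl_connected (vertex_point x) (vertex_point y)"
  using connected[OF assms]
proof (induction rule: rtrancl_induct)
  case base
  then show ?case
    unfolding pl_connected_def using vertex_point_realization[OF assms(1)] pl_path_single by blast
next
  case (step y z)
  then have s: "{y, z} \<in> graph_cells T" by (auto simp: graph_cells_def)
  have "pl_connected (vertex_point y) (vertex_point z)"
    unfolding pl_connected_def
    using cell_path[OF s vertex_point_cell vertex_point_cell] by blast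
  then show ?case using step.IH pl_connected_trans by blast
qed

lemma pl_connected_realization:
  assumes "\<xi> \<in> realization T" "\<eta> \<in> realization T"
  shows "pl_connected \<xi> \<eta>"
proof -
  have *: "\<exists>x\<in>verts T. pl_connected \<xi> (vertex_point x)" if "\<xi> \<in> realization T" for \<xi>
  proof -
    obtain s where s: "s \<in> graph_cells T" "\<xi> \<in> closed_cell s"
      using \<open>\<xi> \<in> realization T\<close> by (auto simp: realization_def)
    then have "s \<noteq> {}" by (auto simp: closed_cell_def)
    then obtain x where x: "x \<in> s" by blast
    then have "pl_connected \<xi> (vertex_point x)"
      unfolding pl_connected_def
      using cell_path[OF s vertex_point_cell[OF x cell_finite[OF s(1)]]] by blast
    then show ?thesis using x cell_subset[OF s(1)] by blast
  qed
  then show ?thesis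
    using assms pl_connected_vertices pl_connected_trans pl_connected_sym by meson
qed

abbreviation "D \<equiv> realization_dist T"

lemma dist_le_pl_length:
  assumes "pl_path T \<xi> \<eta> zs"
  shows "D \<xi> \<eta> \<le> pl_length zs"
proof -
  have "\<xi> \<in> realization T" "\<eta> \<in> realization T"
    using assms by (auto simp: pl_path_def)
  moreover have "bdd_below (pl_length ` {zs. pl_path T \<xi> \<eta> zs})"
    by (rule bdd_belowI[of _ 0]) (auto simp: pl_length_nonneg)
  ultimately show ?thesis
    using assms by (auto simp: realization_dist_def intro: cInf_lower)
qed

lemma dist_geI:
  assumes "\<xi> \<in> realization T" "\<eta> \<in> realization T" "\<And>zs. pl_path T \<xi> \<eta> zs \<Longrightarrow> e \<le> pl_length zs"
  shows "e \<le> D \<xi> \<eta>"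
  using assms pl_connected_realization[OF assms(1,2)]
  by (auto simp: realization_dist_def pl_connected_def intro!: cInf_greatest)

lemma dist_lessE:
  assumes "\<xi> \<in> realization T" "\<eta> \<in> realization T" "D \<xi> \<eta> < e"
  obtains zs where "pl_path T \<xi> \<eta> zs" "pl_length zs < e"
  using dist_geI[OF assms(1,2), of e] assms(3) by force

lemma dist_le_cell_dist:
  assumes "s \<in> graph_cells T" "\<xi> \<in> closed_cell s" "\<eta> \<in> closed_cell s"
  shows "D \<xi> \<eta> \<le> cell_dist \<xi> \<eta>"
  using dist_le_pl_length[OF cell_path[OF assms]] by simp

text \<open>A bound on single cells propagates along piecewise linear paths if it obeys the triangle
  inequality. With \<delta> = \<open>cell_dist\<close> this gives positivity of the distance, and
  with differences of an affine extension it gives Lipschitz bounds.\<close>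

lemma dist_lower_bound:
  assumes "\<xi> \<in> realization T" "\<eta> \<in> realization T"
    and refl: "\<And>z. z \<in> realization T \<Longrightarrow> \<delta> z z \<le> 0"
    and tri: "\<And>x y z. \<lbrakk>x \<in> realization T; y \<in> realization T; z \<in> realization T\<rbrakk> \<Longrightarrow> \<delta> x z \<le> \<delta> x y + \<delta> y z"
    and cell: "\<And>s x y. \<lbrakk>s \<in> graph_cells T; x \<in> closed_cell s; y \<in> closed_cell s\<rbrakk> \<Longrightarrow> \<delta> x y \<le> cell_dist x y"
  shows "\<delta> \<xi> \<eta> \<le> D \<xi> \<eta>"
proof (rule dist_geI[OF assms(1,2)])
  have \<eta>: "\<eta> \<in> realization T" by fact
  fix zs assume "pl_path T \<xi> \<eta> zs"
  then show "\<delta> \<xi> \<eta> \<le> pl_length zs"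
  proof (induction zs arbitrary: \<xi> rule: induct_list012)
    case 1
    then show ?case by (simp add: pl_path_def)
  next
    case (2 z)
    then show ?case using refl by (simp add: pl_path_single)
  next
    case (3 z z' zs)
    then have IH: "\<delta> z' \<eta> \<le> pl_length (z' # zs)" and z: "\<xi> = z" "z \<in> realization T" and
      "\<exists>s\<in>graph_cells T. z \<in> closed_cell s \<and> z' \<in> closed_cell s"
      by (auto simp: pl_path_Cons)
    then have "z' \<in> realization T" "\<delta> z z' \<le> cell_dist z z'"
      using cell by (auto simp: realization_def)
    then show ?case using IH z tri[OF z(2) \<open>z' \<in> realization T\<close> \<eta>] by simp
  qed
qed

lemma cell_dist_le_dist:
  assumes "\<xi> \<in> realization T" "\<eta> \<in> realization T"
  shows "cell_dist \<xi> \<eta> \<le> D \<xi> \<eta>"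
  using assms by (rule dist_lower_bound) (auto intro!: cell_dist_triangle realization_support)

text \<open>On an edge with ends p and q, where distance is the change of the coordinate at p, the
  extension is affine with slope k p - k q.\<close>

lemma affine_ext_lipschitz:
  assumes "\<xi> \<in> realization T" "\<eta> \<in> realization T"
    and lip: "\<And>p q. {p, q} \<in> edges T \<Longrightarrow> \<bar>k p - k q\<bar> \<le> 1"
  shows "\<bar>affine_ext k \<xi> - affine_ext k \<eta>\<bar> \<le> D \<xi> \<eta>"
  using assms(1,2)
proof (rule dist_lower_bound)
  fix s x y assume s: "s \<in> graph_cells T" "x \<in> closed_cell s" "y \<in> closed_cell s"
  then show "\<bar>affine_ext k x - affine_ext k y\<bar> \<le> cell_dist x y"
  proof (cases s rule: cellE)
    case (1 p)
    then show ?thesis using s by (simp add: closed_cell_singleton)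
  next
    case (2 p q)
    have fin: "finite s" using 2 by simp
    have xy: "x q = 1 - x p" "y q = 1 - y p"
      using s 2 by (auto simp: closed_cell_doubleton[OF 2(2)] algebra_simps)
    have "affine_ext k x - affine_ext k y = (k p - k q) * (x p - y p)"
      unfolding affine_ext_cell[OF s(2) fin] affine_ext_cell[OF s(3) fin]
      using 2(1,2) by (simp add: xy algebra_simps)
    moreover have "cell_dist x y = \<bar>x p - y p\<bar>"
      unfolding cell_dist_cell[OF s(2,3) fin] using 2(1,2) xy by simp
    moreover have "\<bar>k p - k q\<bar> * \<bar>x p - y p\<bar> \<le> 1 * \<bar>x p - y p\<bar>"
      using lip 2 by (intro mult_right_mono) auto
    ultimately show ?thesis by (simp add: abs_mult)
  qed
qed auto

lemma dist_nonneg: "0 \<le> D \<xi> \<eta>"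
proof (cases "\<xi> \<in> realization T \<and> \<eta> \<in> realization T")
  case True
  then show ?thesis using cell_dist_le_dist[of \<xi> \<eta>] cell_dist_nonneg[of \<xi> \<eta>] by linarith
qed (auto simp: realization_dist_def)

lemma dist_sym: "D \<xi> \<eta> = D \<eta> \<xi>"
proof -
  have le: "D \<xi> \<eta> \<le> D \<eta> \<xi>" if "\<xi> \<in> realization T" "\<eta> \<in> realization T" for \<xi> \<eta>
  proof (rule dist_geI[OF that(2,1)])
    fix zs assume "pl_path T \<eta> \<xi> zs"
    then obtain us where "pl_path T \<xi> \<eta> us" "pl_length us = pl_length zs"
      using pl_path_rev by blast
    then show "D \<xi> \<eta> \<le> pl_length zs" using dist_le_pl_length by metis
  qed
  show ?thesis
  proof (cases "\<xi> \<in> realization T \<and> \<eta> \<in> realization T")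
    case True
    then show ?thesis using le[of \<xi> \<eta>] le[of \<eta> \<xi>] by linarith
  qed (auto simp: realization_dist_def)
qed

lemma dist_triangle:
  assumes "\<xi> \<in> realization T" "\<eta> \<in> realization T" "\<zeta> \<in> realization T"
  shows "D \<xi> \<zeta> \<le> D \<xi> \<eta> + D \<eta> \<zeta>"
proof (rule field_le_epsilon)
  fix e :: real assume e: "0 < e"
  obtain zs where zs: "pl_path T \<xi> \<eta> zs" "pl_length zs < D \<xi> \<eta> + e / 2"
    using dist_lessE[OF assms(1,2), of "D \<xi> \<eta> + e / 2"] e by auto
  obtain ws where ws: "pl_path T \<eta> \<zeta> ws" "pl_length ws < D \<eta> \<zeta> + e / 2"
    using dist_lessE[OF assms(2,3), of "D \<eta> \<zeta> + e / 2"] e by auto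
  obtain us where us: "pl_path T \<xi> \<zeta> us" "pl_length us = pl_length zs + pl_length ws"
    using pl_path_append[OF zs(1) ws(1)] by blast
  then show "D \<xi> \<zeta> \<le> D \<xi> \<eta> + D \<eta> \<zeta> + e"
    using dist_le_pl_length[OF us(1)] us(2) zs(2) ws(2) by (simp add: field_simps)
qed

lemma dist_refl: "\<xi> \<in> realization T \<Longrightarrow> D \<xi> \<xi> = 0"
  using dist_le_pl_length[of \<xi> \<xi> "[\<xi>]"] dist_nonneg[of \<xi> \<xi>] by (simp add: pl_path_single)

lemma metric_space: "Metric_space (realization T) D"
proof
  fix x y assume xy: "x \<in> realization T" "y \<in> realization T"
  show "D x y = 0 \<longleftrightarrow> x = y"
    using cell_dist_le_dist[OF xy] dist_refl[OF xy(1)]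
      cell_dist_pos[OF realization_support(1)[OF xy(1)] realization_support(1)[OF xy(2)]]
    by fastforce
qed (auto simp: dist_nonneg dist_sym dist_triangle)

end

section \<open>Automorphisms acting on the realization\<close>

locale graph_automorphism = metric_graph +
  fixes f :: "'a \<Rightarrow> 'a"
  assumes bij: "bij_betw f (verts T) (verts T)"
    and f_edge: "\<And>x y. x \<in> verts T \<Longrightarrow> y \<in> verts T \<Longrightarrow> {f x, f y} \<in> edges T \<longleftrightarrow> {x, y} \<in> edges T"
begin

lemma map_apply:
  assumes "\<xi> \<in> realization T" "x \<in> verts T"
  shows "realization_map f \<xi> (f x) = \<xi> x"
proof -
  have "{y. \<xi> y \<noteq> 0 \<and> f y = f x} = (if \<xi> x = 0 then {} else {x})"
    using assms bij realization_support(2)[OF assms(1)] by (auto simp: bij_betw_def inj_on_def)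
  then show ?thesis by (simp add: realization_map_def)
qed

lemma map_outside:
  assumes "\<xi> \<in> realization T" "y \<notin> verts T"
  shows "realization_map f \<xi> y = 0"
proof -
  have "{x. \<xi> x \<noteq> 0 \<and> f x = y} = {}"
    using assms bij realization_support(2)[OF assms(1)] by (auto simp: bij_betw_def)
  then show ?thesis unfolding realization_map_def by (simp only: sum.empty)
qed

lemma map_eqI:
  assumes "\<xi> \<in> realization T" "\<And>x. x \<in> verts T \<Longrightarrow> \<eta> (f x) = \<xi> x" "\<And>y. y \<notin> verts T \<Longrightarrow> \<eta> y = 0"
  shows "realization_map f \<xi> = \<eta>"
proof
  fix y
  show "realization_map f \<xi> y = \<eta> y"
  proof (cases "y \<in> verts T")
    case True
    then obtain x where "x \<in> verts T" "y = f x" using bij by (auto simp: bij_betw_def)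
    then show ?thesis using assms(1,2) by (simp add: map_apply)
  qed (use assms(1,3) map_outside in simp)
qed

lemma f_verts: "x \<in> verts T \<Longrightarrow> f x \<in> verts T"
  using bij by (auto simp: bij_betw_def)

lemma map_vertex: "x \<in> verts T \<Longrightarrow> realization_map f (vertex_point x) = vertex_point (f x)"
  using bij f_verts
  by (intro map_eqI vertex_point_realization) (auto simp: vertex_point_def bij_betw_def inj_on_def)

lemma map_cell:
  assumes "s \<in> graph_cells T"
  shows "f ` s \<in> graph_cells T"
  using assms by (cases s rule: cellE) (auto simp: graph_cells_def f_verts f_edge)

lemma inj_f: "inj_on f (verts T)"
  using bij by (simp add: bij_betw_def)

lemma map_closed_cell:
  assumes s: "s \<in> graph_cells T" and \<xi>: "\<xi> \<in> closed_cell s"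
  shows "realization_map f \<xi> \<in> closed_cell (f ` s)"
proof -
  have real: "\<xi> \<in> realization T" using assms by (auto simp: realization_def)
  have sub: "s \<subseteq> verts T" using s by (rule cell_subset)
  have "0 \<le> realization_map f \<xi> y" for y
    using \<xi> by (auto simp: realization_map_def closed_cell_def intro: sum_nonneg)
  moreover have "realization_map f \<xi> y = 0" if "y \<notin> f ` s" for y
  proof -
    have "{x. \<xi> x \<noteq> 0 \<and> f x = y} = {}" using that closed_cell_support[OF \<xi>] by auto
    then show ?thesis unfolding realization_map_def by (simp only: sum.empty)
  qed
  moreover have "sum (realization_map f \<xi>) (f ` s) = sum \<xi> s"
    using sub by (subst sum.reindex[OF inj_on_subset[OF inj_f sub]]) (auto intro!: sum.cong map_apply[OF real])
  ultimately show ?thesis using \<xi> by (auto simp: closed_cell_def)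
qed

lemma map_realization: "\<xi> \<in> realization T \<Longrightarrow> realization_map f \<xi> \<in> realization T"
  using map_closed_cell map_cell by (fastforce simp: realization_def)

lemma map_cell_dist:
  assumes s: "s \<in> graph_cells T" and \<xi>: "\<xi> \<in> closed_cell s" and \<eta>: "\<eta> \<in> closed_cell s"
  shows "cell_dist (realization_map f \<xi>) (realization_map f \<eta>) = cell_dist \<xi> \<eta>"
proof -
  have real: "\<xi> \<in> realization T" "\<eta> \<in> realization T" using assms by (auto simp: realization_def)
  have sub: "s \<subseteq> verts T" using s by (rule cell_subset)
  have fin: "finite s" using s by (rule cell_finite)
  have "(\<Sum>y\<in>f ` s. \<bar>realization_map f \<xi> y - realization_map f \<eta> y\<bar>) = (\<Sum>x\<in>s. \<bar>\<xi> x - \<eta> x\<bar>)"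
    using sub real
    by (subst sum.reindex[OF inj_on_subset[OF inj_f sub]]) (auto intro!: sum.cong simp: map_apply subset_iff)
  then show ?thesis
    using cell_dist_cell[OF map_closed_cell[OF s \<xi>] map_closed_cell[OF s \<eta>]] cell_dist_cell[OF \<xi> \<eta> fin] fin
    by simp
qed

lemma map_path:
  "pl_path T \<xi> \<eta> zs \<Longrightarrow> pl_path T (realization_map f \<xi>) (realization_map f \<eta>) (map (realization_map f) zs)
     \<and> pl_length (map (realization_map f) zs) = pl_length zs"
proof (induction zs arbitrary: \<xi> rule: induct_list012)
  case 1
  then show ?case by (simp add: pl_path_def)
next
  case (2 z)
  then show ?case by (simp add: pl_path_single map_realization)
next
  case (3 z z' zs)
  then obtain s where s: "s \<in> graph_cells T" "z \<in> closed_cell s" "z' \<in> closed_cell s"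
    by (auto simp: pl_path_Cons)
  from 3 have "pl_path T (realization_map f z') (realization_map f \<eta>) (map (realization_map f) (z' # zs))
     \<and> pl_length (map (realization_map f) (z' # zs)) = pl_length (z' # zs)"
    by (auto simp: pl_path_Cons)
  then show ?case
    using 3 map_closed_cell[OF s(1,2)] map_closed_cell[OF s(1,3)] map_cell[OF s(1)] map_cell_dist[OF s]
    by (auto simp: pl_path_Cons map_realization)
qed

lemma map_dist_le:
  assumes "\<xi> \<in> realization T" "\<eta> \<in> realization T"
  shows "D (realization_map f \<xi>) (realization_map f \<eta>) \<le> D \<xi> \<eta>"
  using assms by (rule dist_geI) (use map_path dist_le_pl_length in metis)

lemma inverse: "graph_automorphism T (inv_into (verts T) f)"
proof
  show "bij_betw (inv_into (verts T) f) (verts T) (verts T)"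
    using bij by (rule bij_betw_inv_into)
  fix x y assume "x \<in> verts T" "y \<in> verts T"
  then show "{inv_into (verts T) f x, inv_into (verts T) f y} \<in> edges T \<longleftrightarrow> {x, y} \<in> edges T"
    using f_edge[of "inv_into (verts T) f x" "inv_into (verts T) f y"] bij
    by (simp add: bij_betw_def f_inv_into_f inv_into_into)
qed

lemma map_inverse:
  assumes "\<xi> \<in> realization T"
  shows "realization_map (inv_into (verts T) f) (realization_map f \<xi>) = \<xi>"
    "realization_map f (realization_map (inv_into (verts T) f) \<xi>) = \<xi>"
proof -
  interpret I: graph_automorphism T "inv_into (verts T) f" by (rule inverse)
  have out: "\<xi> y = 0" if "y \<notin> verts T" for y
    using that realization_support(2)[OF assms] by auto
  show "realization_map (inv_into (verts T) f) (realization_map f \<xi>) = \<xi>"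
  proof (rule I.map_eqI[OF map_realization[OF assms]])
    fix x assume "x \<in> verts T"
    then show "\<xi> (inv_into (verts T) f x) = realization_map f \<xi> x"
      using map_apply[OF assms, of "inv_into (verts T) f x"] bij
      by (simp add: bij_betw_def f_inv_into_f inv_into_into)
  qed (rule out)
  show "realization_map f (realization_map (inv_into (verts T) f) \<xi>) = \<xi>"
  proof (rule map_eqI[OF I.map_realization[OF assms]])
    fix x assume x: "x \<in> verts T"
    show "\<xi> (f x) = realization_map (inv_into (verts T) f) \<xi> x"
      using I.map_apply[OF assms f_verts[OF x]] inj_f x by simp
  qed (rule out)
qed

lemma map_isometry: "isometry_of (realization T) D (realization_map f)"
  unfolding isometry_of_def
proof (intro conjI ballI)
  interpret I: graph_automorphism T "inv_into (verts T) f" by (rule inverse)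
  show "bij_betw (realization_map f) (realization T) (realization T)"
    by (rule bij_betwI[where g = "realization_map (inv_into (verts T) f)"])
      (auto simp: map_realization I.map_realization map_inverse)
  fix \<xi> \<eta> assume *: "\<xi> \<in> realization T" "\<eta> \<in> realization T"
  show "D (realization_map f \<xi>) (realization_map f \<eta>) = D \<xi> \<eta>"
    using map_dist_le[OF *] I.map_dist_le[OF map_realization map_realization, of \<xi> \<eta>] *
    by (simp add: map_inverse)
qed

text \<open>The constant e survives unchanged because barycentric coordinates sum to 1.\<close>

lemma affine_ext_map:
  assumes "\<xi> \<in> realization T" "\<And>x. x \<in> verts T \<Longrightarrow> k (f x) = k x + e"
  shows "affine_ext k (realization_map f \<xi>) = affine_ext k \<xi> + e"
proof -
  obtain s where s: "s \<in> graph_cells T" "\<xi> \<in> closed_cell s"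
    using assms by (auto simp: realization_def)
  have sub: "s \<subseteq> verts T" using s(1) by (rule cell_subset)
  have fin: "finite s" using s(1) by (rule cell_finite)
  have "affine_ext k (realization_map f \<xi>) = (\<Sum>y\<in>f ` s. k y * realization_map f \<xi> y)"
    using affine_ext_cell[OF map_closed_cell[OF s]] fin by simp
  also have "\<dots> = (\<Sum>x\<in>s. (k x + e) * \<xi> x)"
    using sub assms
    by (subst sum.reindex[OF inj_on_subset[OF inj_f sub]]) (auto intro!: sum.cong simp: map_apply subset_iff)
  also have "\<dots> = (\<Sum>x\<in>s. k x * \<xi> x) + e * sum \<xi> s"
    by (simp add: algebra_simps sum.distrib sum_distrib_left)
  finally show ?thesis using s(2) affine_ext_cell[OF s(2) fin] by (simp add: closed_cell_def)
qed

end

text \<open>A line in a graph, with the position \<open>pos\<close> of the projection of a vertex to the line and the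
  distance \<open>off\<close> to the line. Both \<open>pos + off\<close> and \<open>pos - off\<close> are \<open>1\<close>-Lipschitz, which is all that
  is needed of a tree.\<close>

locale graph_axis = metric_graph +
  fixes x :: "int \<Rightarrow> 'a" and pos off :: "'a \<Rightarrow> int"
  assumes x_verts: "\<And>k. x k \<in> verts T"
    and x_edge: "\<And>k. {x k, x (k + 1)} \<in> edges T"
    and pos_x: "\<And>k. pos (x k) = k" and off_x: "\<And>k. off (x k) = 0"
    and off_nonneg: "\<And>y. y \<in> verts T \<Longrightarrow> 0 \<le> off y"
    and off_eq_0: "\<And>y. y \<in> verts T \<Longrightarrow> off y = 0 \<Longrightarrow> y = x (pos y)"
    and lipschitz: "\<And>y z. {y, z} \<in> edges T \<Longrightarrow>
      \<bar>(pos y + off y) - (pos z + off z)\<bar> \<le> 1 \<and> \<bar>(pos y - off y) - (pos z - off z)\<bar> \<le> 1"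
begin

definition point :: "real \<Rightarrow> 'a \<Rightarrow> real" where
  "point t = (\<lambda>y. if y = x \<lfloor>t\<rfloor> then 1 - frac t else if y = x (\<lfloor>t\<rfloor> + 1) then frac t else 0)"

lemma x_eq_iff [simp]: "x k = x l \<longleftrightarrow> k = l"
  using pos_x by metis

text \<open>At an integer the formulas of the two adjacent segments agree, so closed segments can be
  used at both ends.\<close>

lemma point_seg:
  assumes "of_int k \<le> t" "t \<le> of_int k + 1"
  shows "point t = (\<lambda>y. if y = x k then of_int k + 1 - t else if y = x (k + 1) then t - of_int k else 0)"
proof (cases "t = of_int k + 1")
  case True
  then have "\<lfloor>t\<rfloor> = k + 1" "frac t = 0" by (auto simp: frac_def floor_add_int)
  then show ?thesis using True by (auto simp: point_def fun_eq_iff)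
next
  case False
  then have "\<lfloor>t\<rfloor> = k" using assms by (simp add: floor_eq_iff)
  then show ?thesis by (auto simp: point_def fun_eq_iff frac_def)
qed

lemma seg_cell: "{x k, x (k + 1)} \<in> graph_cells T"
  using x_edge by (simp add: graph_cells_def)

lemma point_in_seg:
  assumes "of_int k \<le> t" "t \<le> of_int k + 1"
  shows "point t \<in> closed_cell {x k, x (k + 1)}"
  using assms by (subst closed_cell_doubleton) (auto simp: point_seg[OF assms])

lemma point_realization [simp]: "point t \<in> realization T"
  using point_in_seg[of "\<lfloor>t\<rfloor>" t] seg_cell by (fastforce simp: realization_def)

lemma point_int: "point (of_int k) = vertex_point (x k)"
  by (subst point_seg[of k]) (auto simp: vertex_point_def)

lemma point_dist_seg:
  assumes "of_int k \<le> s" "s \<le> of_int k + 1" "of_int k \<le> t" "t \<le> of_int k + 1"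
  shows "D (point s) (point t) \<le> \<bar>s - t\<bar>"
proof -
  have "cell_dist (point s) (point t) = \<bar>s - t\<bar>"
    using cell_dist_cell[OF point_in_seg[OF assms(1,2)] point_in_seg[OF assms(3,4)]]
    by (simp add: point_seg[OF assms(1,2)] point_seg[OF assms(3,4)])
  then show ?thesis
    using dist_le_cell_dist[OF seg_cell point_in_seg[OF assms(1,2)] point_in_seg[OF assms(3,4)]] by simp
qed

lemma point_dist_le:
  assumes "s \<le> t"
  shows "D (point s) (point t) \<le> t - s"
proof -
  have "s \<le> t \<Longrightarrow> \<lfloor>t\<rfloor> - \<lfloor>s\<rfloor> \<le> int n \<Longrightarrow> D (point s) (point t) \<le> t - s" for n
  proof (induction n arbitrary: s)
    case 0
    then have "\<lfloor>t\<rfloor> = \<lfloor>s\<rfloor>" using floor_mono[of s t] by simp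
    moreover have "of_int \<lfloor>s\<rfloor> \<le> s" "s \<le> of_int \<lfloor>s\<rfloor> + 1" "of_int \<lfloor>t\<rfloor> \<le> t" "t \<le> of_int \<lfloor>t\<rfloor> + 1"
      by linarith+
    ultimately show ?case using point_dist_seg[of "\<lfloor>s\<rfloor>" s t] 0 by simp
  next
    case (Suc n)
    let ?k = "\<lfloor>s\<rfloor> + 1"
    show ?case
    proof (cases "of_int ?k \<le> t")
      case True
      have "D (point s) (point (of_int ?k)) \<le> of_int ?k - s"
        using point_dist_seg[of "\<lfloor>s\<rfloor>" s "of_int ?k"] by simp
      moreover have "D (point (of_int ?k)) (point t) \<le> t - of_int ?k"
        using True Suc.prems by (intro Suc.IH) auto
      ultimately show ?thesis
        using dist_triangle[of "point s" "point (of_int ?k)" "point t"] by simp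
    next
      case False
      then show ?thesis using point_dist_seg[of "\<lfloor>s\<rfloor>" s t] Suc.prems by simp linarith
    qed
  qed
  from this[of "nat (\<lfloor>t\<rfloor> - \<lfloor>s\<rfloor>)"] show ?thesis using assms floor_mono[OF assms] by simp
qed

abbreviation "pos_ext \<equiv> affine_ext (\<lambda>y. real_of_int (pos y))"

lemma affine_ext_point:
  assumes "\<And>k. K (x k) = of_int k"
  shows "affine_ext K (point t) = t"
proof -
  define k where "k = \<lfloor>t\<rfloor>"
  have k: "of_int k \<le> t" "t \<le> of_int k + 1" by (auto simp: k_def)
  show ?thesis
    unfolding affine_ext_cell[OF point_in_seg[OF k], simplified] using assms
    by (simp add: point_seg[OF k] algebra_simps)
qed

lemma pos_lipschitz: "{y, z} \<in> edges T \<Longrightarrow> \<bar>real_of_int (pos y) - real_of_int (pos z)\<bar> \<le> 1"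
  using lipschitz[of y z] by linarith

text \<open>The path along the line gives the upper bound. The lower one holds because the position
  is 1-Lipschitz, being the mean of pos + off and pos - off.\<close>

lemma point_dist: "D (point s) (point t) = \<bar>s - t\<bar>"
proof (rule antisym)
  show "D (point s) (point t) \<le> \<bar>s - t\<bar>"
    using point_dist_le[of s t] point_dist_le[of t s] dist_sym[of "point s" "point t"] by linarith
  have "\<bar>pos_ext (point s) - pos_ext (point t)\<bar> \<le> D (point s) (point t)"
    by (rule affine_ext_lipschitz[OF _ _ pos_lipschitz]) simp_all
  then show "\<bar>s - t\<bar> \<le> D (point s) (point t)"
    by (simp add: affine_ext_point pos_x)
qed

lemma off_ext_nonneg:
  assumes "\<xi> \<in> realization T"
  shows "0 \<le> affine_ext (\<lambda>y. real_of_int (off y)) \<xi>"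
proof -
  obtain s where "s \<in> graph_cells T" "\<xi> \<in> closed_cell s"
    using assms by (auto simp: realization_def)
  then show ?thesis
    unfolding affine_ext_def using realization_support(2)[OF assms] off_nonneg
    by (intro sum_nonneg) (auto simp: closed_cell_def)
qed

text \<open>A sum of offsets with non-negative weights vanishes only if every vertex in the support
  is on the line. If there are two such vertices, they are consecutive because the position changes
  by at most 1 along an edge.\<close>

lemma point_of_off_ext_0:
  assumes "\<xi> \<in> realization T" "affine_ext (\<lambda>y. real_of_int (off y)) \<xi> \<le> 0"
  shows "\<xi> \<in> range point"
proof -
  obtain s where s: "s \<in> graph_cells T" "\<xi> \<in> closed_cell s"
    using assms by (auto simp: realization_def)
  have nn: "0 \<le> real_of_int (off y) * \<xi> y" if "y \<in> verts T" for y
    using that s(2) off_nonneg by (auto simp: closed_cell_def)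
  have sum0: "(\<Sum>y\<in>s. real_of_int (off y) * \<xi> y) = 0"
    using assms(2) off_ext_nonneg[OF assms(1)]
    unfolding affine_ext_cell[OF s(2) cell_finite[OF s(1)]] by linarith
  have on: "y = x (pos y)" if "y \<in> s" "\<xi> y \<noteq> 0" for y
  proof -
    have y: "y \<in> verts T" using that cell_subset[OF s(1)] by blast
    have "real_of_int (off y) * \<xi> y = 0"
      using sum0 nn cell_subset[OF s(1)] cell_finite[OF s(1)] that
      by (subst (asm) sum_nonneg_eq_0_iff) auto
    then show ?thesis using that off_eq_0[OF y] by simp
  qed
  have vertex: "vertex_point y \<in> range point" if "y = x (pos y)" for y
    using point_int[of "pos y"] that by (metis rangeI)
  have seg: "\<xi> \<in> range point" if k: "\<xi> \<in> closed_cell {x k, x (k + 1)}" for k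
  proof -
    have *: "0 \<le> \<xi> (x k)" "0 \<le> \<xi> (x (k + 1))" "\<xi> (x k) = 1 - \<xi> (x (k + 1))"
      "\<And>y. y \<noteq> x k \<Longrightarrow> y \<noteq> x (k + 1) \<Longrightarrow> \<xi> y = 0"
      using k by (auto simp: closed_cell_doubleton)
    then have "point (of_int k + \<xi> (x (k + 1))) = \<xi>"
      by (subst point_seg[of k]) (auto simp: fun_eq_iff)
    then show ?thesis by (metis rangeI)
  qed
  show ?thesis
  proof (cases rule: cellE[OF s(1)])
    case (1 p)
    then have \<xi>: "\<xi> = vertex_point p" using s(2) by (simp add: closed_cell_singleton)
    then show ?thesis using on[of p] 1 vertex by (simp add: vertex_point_def)
  next
    case (2 p q)
    then have \<xi>: "0 \<le> \<xi> p" "0 \<le> \<xi> q" "\<xi> p + \<xi> q = 1" "\<And>y. y \<noteq> p \<Longrightarrow> y \<noteq> q \<Longrightarrow> \<xi> y = 0"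
      using s(2) by (auto simp: closed_cell_doubleton)
    consider "\<xi> p = 0" | "\<xi> q = 0" | "\<xi> p \<noteq> 0" "\<xi> q \<noteq> 0" by blast
    then show ?thesis
    proof cases
      case 1
      then have "\<xi> = vertex_point q"
        unfolding vertex_point_def fun_eq_iff using \<xi>(3,4) by (metis add_0)
      then show ?thesis using on[of q] 1 2 \<xi>(3) vertex by auto
    next
      case c2: 2
      then have "\<xi> = vertex_point p"
        unfolding vertex_point_def fun_eq_iff using \<xi>(3,4) by (metis add.right_neutral)
      then show ?thesis using on[of p] c2 2 \<xi>(3) vertex by auto
    next
      case 3
      have pq: "p = x (pos p)" "q = x (pos q)" using on 2 3 by auto
      have "\<bar>pos p - pos q\<bar> \<le> 1" using pos_lipschitz[OF 2(5)] by linarith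
      moreover have "pos p \<noteq> pos q" using pq 2(2) by metis
      ultimately have "pos q = pos p + 1 \<or> pos p = pos q + 1" by linarith
      then show ?thesis
      proof
        assume "pos q = pos p + 1"
        then show ?thesis using seg[of "pos p"] s(2) 2(1) pq by metis
      next
        assume "pos p = pos q + 1"
        then show ?thesis using seg[of "pos q"] s(2) 2(1) pq by (metis insert_commute)
      qed
    qed
  qed
qed

text \<open>Adding (pos + off)(\<xi>) - s \<le> D(point s, \<xi>) and t - (pos - off)(\<xi>) \<le>
  D(\<xi>, point t) gives 2 off(\<xi>) \<le> 0. This is the form of uniqueness of geodesics behind
  the convexity of the flat.\<close>

lemma between_points_le:
  assumes "\<xi> \<in> realization T" "s \<le> t" "D (point s) \<xi> + D \<xi> (point t) = \<bar>s - t\<bar>"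
  shows "\<xi> \<in> range point"
proof (rule point_of_off_ext_0[OF assms(1)])
  define po where "po e = affine_ext (\<lambda>y. real_of_int (pos y + e * off y))" for e
  have lip: "\<bar>po e \<eta> - po e \<zeta>\<bar> \<le> D \<eta> \<zeta>" if "\<eta> \<in> realization T" "\<zeta> \<in> realization T" "e = 1 \<or> e = -1" for \<eta> \<zeta> e
    unfolding po_def
  proof (rule affine_ext_lipschitz[OF that(1,2)])
    fix p q assume "{p, q} \<in> edges T"
    then show "\<bar>real_of_int (pos p + e * off p) - real_of_int (pos q + e * off q)\<bar> \<le> 1"
      using lipschitz[of p q] that(3) by (auto simp flip: of_int_diff of_int_abs)
  qed
  have pt: "po e (point t) = t" for e t
    unfolding po_def by (rule affine_ext_point) (simp add: pos_x off_x)
  have split: "po e \<eta> = pos_ext \<eta> + e * affine_ext (\<lambda>y. real_of_int (off y)) \<eta>" for e \<eta>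
    by (simp add: po_def affine_ext_def sum.distrib sum_distrib_left algebra_simps)
  have "po 1 \<xi> - s \<le> D (point s) \<xi>"
    using lip[OF point_realization assms(1), of 1 s] by (simp add: pt)
  moreover have "t - po (- 1) \<xi> \<le> D \<xi> (point t)"
    using lip[OF assms(1) point_realization, of "- 1" t] by (simp add: pt)
  ultimately show "affine_ext (\<lambda>y. real_of_int (off y)) \<xi> \<le> 0"
    using assms(2,3) by (simp add: split)
qed

lemma between_points:
  assumes "\<xi> \<in> realization T" "D (point s) \<xi> + D \<xi> (point t) = \<bar>s - t\<bar>"
  shows "\<xi> \<in> range point"
proof (cases "s \<le> t")
  case True
  then show ?thesis using between_points_le assms by blast
next
  case False
  then show ?thesis
    using between_points_le[of \<xi> t s] assms by (simp add: dist_sym add.commute abs_minus_commute)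
qed

end


section \<open>Flats in products\<close>

locale two_lines = Metric_space12 M1 d1 M2 d2
  for M1 :: "'a set" and d1 and M2 :: "'b set" and d2 +
  fixes c1 :: "real \<Rightarrow> 'a" and c2 :: "real \<Rightarrow> 'b"
  assumes c1_in: "\<And>t. c1 t \<in> M1" and c2_in: "\<And>t. c2 t \<in> M2"
    and c1_dist: "\<And>s t. d1 (c1 s) (c1 t) = \<bar>s - t\<bar>"
    and c2_dist: "\<And>s t. d2 (c2 s) (c2 t) = \<bar>s - t\<bar>"
    and between1: "\<And>z s t. z \<in> M1 \<Longrightarrow> d1 (c1 s) z + d1 z (c1 t) = \<bar>s - t\<bar> \<Longrightarrow> z \<in> range c1"
    and between2: "\<And>z s t. z \<in> M2 \<Longrightarrow> d2 (c2 s) z + d2 z (c2 t) = \<bar>s - t\<bar> \<Longrightarrow> z \<in> range c2"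
begin

abbreviation "X \<equiv> M1 \<times> M2"
abbreviation "d \<equiv> prod_dist d1 d2"
abbreviation "L1 \<equiv> range c1 \<times> {c2 0}"
abbreviation "L2 \<equiv> {c1 0} \<times> range c2"
abbreviation "P \<equiv> range c1 \<times> range c2"

lemma d_flat: "d (c1 s, c2 t) (c1 s', c2 t') = dist (s, t) (s', t')"
  by (simp add: prod_dist_def c1_dist c2_dist dist_prod_def dist_real_def)

lemma P_subset: "P \<subseteq> X"
  using c1_in c2_in by auto

lemma flat: "flat_plane X d P"
  unfolding flat_plane_def
proof (intro conjI exI[of _ "\<lambda>(s, t). (c1 s, c2 t)"] allI)
  show "range (\<lambda>(s, t). (c1 s, c2 t)) = P" by auto
  show "d (case z of (s, t) \<Rightarrow> (c1 s, c2 t)) (case w of (s, t) \<Rightarrow> (c1 s, c2 t)) = dist z w" for z w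
    by (cases z; cases w) (simp add: d_flat)
qed (rule P_subset)

lemma line1: "geodesic_line X d (\<lambda>t. (c1 t, c2 0))"
  and line2: "geodesic_line X d (\<lambda>t. (c1 0, c2 t))"
  using c1_in c2_in by (auto simp: geodesic_line_def d_flat dist_prod_def dist_real_def)


text \<open>By Minkowski's inequality the left side is at least the norm of (x1 + y1, x2 + y2),
  which dominates (z1, z2) coordinatewise; equal norms then force equality in each
  coordinate.\<close>

lemma sqrt_eq_imp:
  fixes x1 :: real
  assumes "0 \<le> x1" "0 \<le> x2" "0 \<le> y1" "0 \<le> y2" "0 \<le> z1" "0 \<le> z2"
    and "z1 \<le> x1 + y1" "z2 \<le> x2 + y2"
    and eq: "sqrt (x1\<^sup>2 + x2\<^sup>2) + sqrt (y1\<^sup>2 + y2\<^sup>2) \<le> sqrt (z1\<^sup>2 + z2\<^sup>2)"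
  shows "x1 + y1 = z1 \<and> x2 + y2 = z2"
proof -
  have "sqrt ((x1 + y1)\<^sup>2 + (x2 + y2)\<^sup>2) \<le> sqrt (x1\<^sup>2 + x2\<^sup>2) + sqrt (y1\<^sup>2 + y2\<^sup>2)"
    by (rule real_sqrt_sum_squares_triangle_ineq)
  then have "sqrt ((x1 + y1)\<^sup>2 + (x2 + y2)\<^sup>2) \<le> sqrt (z1\<^sup>2 + z2\<^sup>2)" using eq by linarith
  then have *: "(x1 + y1)\<^sup>2 + (x2 + y2)\<^sup>2 \<le> z1\<^sup>2 + z2\<^sup>2" by simp
  have "z1\<^sup>2 \<le> (x1 + y1)\<^sup>2" "z2\<^sup>2 \<le> (x2 + y2)\<^sup>2" using assms by (auto intro: power_mono)
  with * have "(x1 + y1)\<^sup>2 = z1\<^sup>2" "(x2 + y2)\<^sup>2 = z2\<^sup>2" by linarith+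
  then show ?thesis using assms by (auto simp: power2_eq_iff_nonneg)
qed

text \<open>A point of a geodesic attains equality in the triangle inequality of the product, hence
  in both factors by \<open>sqrt_eq_imp\<close>; there it lies on the lines.\<close>

lemma convex: "geodesically_convex X d P"
  unfolding geodesically_convex_def
proof (intro conjI allI impI P_subset subsetI)
  fix L :: real and c y
  assume L: "0 \<le> L" and cX: "c ` {0..L} \<subseteq> X"
    and geo: "\<forall>s\<in>{0..L}. \<forall>t\<in>{0..L}. d (c s) (c t) = \<bar>s - t\<bar>"
    and c0: "c 0 \<in> P" and cL: "c L \<in> P" and y: "y \<in> c ` {0..L}"
  obtain t where t: "0 \<le> t" "t \<le> L" "y = c t" using y by auto
  obtain s1 s2 where s: "c 0 = (c1 s1, c2 s2)" using c0 by auto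
  obtain r1 r2 where r: "c L = (c1 r1, c2 r2)" using cL by auto
  obtain y1 y2 where y12: "y = (y1, y2)" by fastforce
  have yM: "y1 \<in> M1" "y2 \<in> M2" using y cX y12 by auto
  have "d (c 0) y = t" "d y (c L) = L - t" "d (c 0) (c L) = L"
    using geo t L by auto
  then have "sqrt ((d1 (c1 s1) y1)\<^sup>2 + (d2 (c2 s2) y2)\<^sup>2) + sqrt ((d1 y1 (c1 r1))\<^sup>2 + (d2 y2 (c2 r2))\<^sup>2)
      \<le> sqrt ((d1 (c1 s1) (c1 r1))\<^sup>2 + (d2 (c2 s2) (c2 r2))\<^sup>2)"
    unfolding s r y12 by (simp add: prod_dist_def)
  then have "d1 (c1 s1) y1 + d1 y1 (c1 r1) = d1 (c1 s1) (c1 r1) \<and>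
      d2 (c2 s2) y2 + d2 y2 (c2 r2) = d2 (c2 s2) (c2 r2)"
    using M1.triangle M2.triangle yM c1_in c2_in by (intro sqrt_eq_imp) auto
  then show "y \<in> P"
    using between1[OF yM(1), of s1 r1] between2[OF yM(2), of s2 r2] by (simp add: c1_dist c2_dist y12)
qed

text \<open>Every point of the flat is the midpoint of a segment from one axis to the other.\<close>

lemma hull: "P = geodesically_convex X d hull (L1 \<union> L2)"
proof (rule antisym)
  show "geodesically_convex X d hull (L1 \<union> L2) \<subseteq> P"
    by (rule hull_minimal) (auto simp: convex)
  show "P \<subseteq> geodesically_convex X d hull (L1 \<union> L2)"
    unfolding hull_def
  proof (rule Inter_greatest)
    fix C assume "C \<in> {C. geodesically_convex X d C \<and> L1 \<union> L2 \<subseteq> C}"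
    then have conv: "geodesically_convex X d C" and sub: "L1 \<union> L2 \<subseteq> C" by auto
    show "P \<subseteq> C"
    proof
      fix y assume "y \<in> P"
      then obtain s t where y: "y = (c1 s, c2 t)" by auto
      define h where "h = sqrt (s\<^sup>2 + t\<^sup>2)"
      \<comment> \<open>The segment of length 2h, parametrized by arc length, from the point 2s of
        the first axis to the point 2t of the second; its midpoint is (s, t).\<close>
      define c where "c r = (c1 (2 * s - s * r / h), c2 (t * r / h))" for r
      show "y \<in> C"
      proof (cases "h = 0")
        case True
        then have "s = 0" "t = 0" by (auto simp: h_def sum_power2_eq_zero_iff)
        then show ?thesis using sub y by auto
      next
        case False
        have h: "0 < h" using False by (simp add: h_def less_le)
        have hh: "h\<^sup>2 = s\<^sup>2 + t\<^sup>2" by (simp add: h_def)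
        have "d (c r) (c r') = \<bar>r - r'\<bar>" for r r'
        proof -
          have "(2 * s - s * r / h - (2 * s - s * r' / h))\<^sup>2 + (t * r / h - t * r' / h)\<^sup>2
              = (- (s * ((r - r') / h)))\<^sup>2 + (t * ((r - r') / h))\<^sup>2"
            by (simp add: diff_divide_distrib algebra_simps)
          also have "\<dots> = ((r - r') / h)\<^sup>2 * (s\<^sup>2 + t\<^sup>2)"
            by (simp only: power2_minus power_mult_distrib) (simp add: algebra_simps)
          also have "\<dots> = (r - r')\<^sup>2"
            using h by (simp add: hh[symmetric] power_divide)
          finally show ?thesis
            by (simp add: c_def d_flat dist_prod_def dist_real_def)
        qed
        moreover have "c ` {0..2 * h} \<subseteq> X" using c1_in c2_in by (auto simp: c_def)
        moreover have "c 0 \<in> C" using sub by (auto simp: c_def)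
        moreover have "c (2 * h) \<in> C" using sub h by (auto simp: c_def)
        ultimately have "c ` {0..2 * h} \<subseteq> C"
          using conv h by (simp add: geodesically_convex_def)
        moreover have "c h = y" using h by (simp add: c_def y)
        ultimately show ?thesis using h by (auto simp: image_subset_iff)
      qed
    qed
  qed
qed

text \<open>The distance of a point of \<open>L1\<close> from any point of \<open>L2\<close> is at
  least the absolute value of its parameter, so lines at bounded distance would keep the parameter f
  bounded, although f changes by |t| between 0 and t.\<close>

lemma not_parallel: "\<not> parallel_lines X d L1 L2"
proof
  assume "parallel_lines X d L1 L2"
  then obtain c c' K where g: "geodesic_line X d c" and r: "range c = L1" "range c' = L2"
    and K: "\<And>t. d (c t) (c' t) \<le> K"
    unfolding parallel_lines_def by metis
  have "\<exists>s. c t = (c1 s, c2 0)" for t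
  proof -
    have "c t \<in> L1" unfolding r(1)[symmetric] by (rule rangeI)
    then show ?thesis by auto
  qed
  then obtain f where f: "\<And>t. c t = (c1 (f t), c2 0)" by metis
  have "\<exists>s. c' t = (c1 0, c2 s)" for t
  proof -
    have "c' t \<in> L2" unfolding r(2)[symmetric] by (rule rangeI)
    then show ?thesis by auto
  qed
  then obtain f' where f': "\<And>t. c' t = (c1 0, c2 (f' t))" by metis
  have ft: "\<bar>f t\<bar> \<le> K" for t
  proof -
    have "\<bar>f t\<bar> \<le> d (c t) (c' t)"
      unfolding f f' d_flat dist_prod_def by (simp add: dist_real_def real_le_rsqrt)
    then show ?thesis using K[of t] by simp
  qed
  have "\<bar>f t - f 0\<bar> = \<bar>t\<bar>" for t
  proof -
    have "d (c t) (c 0) = \<bar>t - 0\<bar>" using g unfolding geodesic_line_def by blast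
    then show ?thesis by (simp add: f d_flat dist_prod_def dist_real_def)
  qed
  from this[of "2 * K + 1"] ft[of 0] ft[of "2 * K + 1"] show False by linarith
qed

end

section \<open>Polynomials acting on doubly infinite arrays\<close>

locale ring_action =
  fixes \<alpha> :: "'r::comm_ring_1 \<Rightarrow> 'x::ab_group_add \<Rightarrow> 'x"
  assumes add_left: "\<alpha> (r + s) \<phi> = \<alpha> r \<phi> + \<alpha> s \<phi>"
    and add_right: "\<alpha> r (\<phi> + \<psi>) = \<alpha> r \<phi> + \<alpha> r \<psi>"
    and mult: "\<alpha> (r * s) \<phi> = \<alpha> r (\<alpha> s \<phi>)"
    and one: "\<alpha> 1 \<phi> = \<phi>"
begin

lemma zero_left [simp]: "\<alpha> 0 \<phi> = 0"
  using add_left[of 0 0 \<phi>] by simp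

lemma zero_right [simp]: "\<alpha> r 0 = 0"
  using add_right[of r 0 0] by simp

lemma sum_right: "\<alpha> r (\<Sum>i\<in>I. \<phi> i) = (\<Sum>i\<in>I. \<alpha> r (\<phi> i))"
  by (induction I rule: infinite_finite_induct) (auto simp: add_right)

lemma sum_left: "\<alpha> (\<Sum>i\<in>I. r i) \<phi> = (\<Sum>i\<in>I. \<alpha> (r i) \<phi>)"
  by (induction I rule: infinite_finite_induct) (auto simp: add_left)

end

text \<open>The extension of the action to polynomials in which the indeterminate acts as S. It is
  used twice, first for F[x] and then for F[x][y].\<close>

definition poly_action :: "('r::zero \<Rightarrow> 'x \<Rightarrow> 'x) \<Rightarrow> ('x \<Rightarrow> 'x) \<Rightarrow> 'r poly \<Rightarrow> 'x \<Rightarrow> 'x::comm_monoid_add" where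
  "poly_action \<alpha> S P \<phi> = (\<Sum>j\<le>degree P. \<alpha> (coeff P j) ((S ^^ j) \<phi>))"

locale shift_action = ring_action \<alpha>
  for \<alpha> :: "'r::comm_ring_1 \<Rightarrow> 'x::ab_group_add \<Rightarrow> 'x" +
  fixes S :: "'x \<Rightarrow> 'x"
  assumes S_add: "S (\<phi> + \<psi>) = S \<phi> + S \<psi>"
    and S_action: "S (\<alpha> r \<phi>) = \<alpha> r (S \<phi>)"
begin

abbreviation "act \<equiv> poly_action \<alpha> S"

lemma S_zero [simp]: "S 0 = 0"
  using S_add[of 0 0] by simp

lemma S_sum: "S (\<Sum>i\<in>I. \<phi> i) = (\<Sum>i\<in>I. S (\<phi> i))"
  by (induction I rule: infinite_finite_induct) (auto simp: S_add)

lemma pow_add: "(S ^^ j) (\<phi> + \<psi>) = (S ^^ j) \<phi> + (S ^^ j) \<psi>"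
  by (induction j) (auto simp: S_add)

lemma act_bound:
  assumes "degree P \<le> N"
  shows "act P \<phi> = (\<Sum>j\<le>N. \<alpha> (coeff P j) ((S ^^ j) \<phi>))"
  unfolding poly_action_def using assms
  by (intro sum.mono_neutral_left) (auto simp: coeff_eq_0)

lemma act_add_left: "act (P + Q) \<phi> = act P \<phi> + act Q \<phi>"
proof -
  let ?N = "max (degree P) (degree Q)"
  show ?thesis
    using act_bound[of "P + Q" ?N] act_bound[of P ?N] act_bound[of Q ?N] degree_add_le_max[of P Q]
    by (simp add: add_left sum.distrib)
qed

lemma act_add_right: "act P (\<phi> + \<psi>) = act P \<phi> + act P \<psi>"
  by (simp add: poly_action_def pow_add add_right sum.distrib)

lemma act_pCons: "act (pCons c P) \<phi> = \<alpha> c \<phi> + S (act P \<phi>)"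
proof -
  have "act (pCons c P) \<phi> = (\<Sum>j\<le>Suc (degree P). \<alpha> (coeff (pCons c P) j) ((S ^^ j) \<phi>))"
    by (rule act_bound) (auto simp: degree_pCons_le)
  then show ?thesis
    by (subst (asm) sum.atMost_Suc_shift) (simp add: poly_action_def S_sum S_action)
qed

lemma act_0 [simp]: "act 0 \<phi> = 0"
  by (simp add: poly_action_def)

lemma act_smult: "act (smult c P) \<phi> = \<alpha> c (act P \<phi>)"
  by (induction P) (auto simp: act_pCons add_right mult S_action)

lemma act_mult: "act (P * Q) \<phi> = act P (act Q \<phi>)"
  by (induction P) (auto simp: act_pCons act_add_left act_smult)

lemma act_one: "act 1 \<phi> = \<phi>"
  by (simp add: one_pCons act_pCons one)

lemma act_monom: "act (monom c j) \<phi> = \<alpha> c ((S ^^ j) \<phi>)"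
  by (induction j) (auto simp: monom_0 monom_Suc act_pCons S_action)

lemma is_action: "ring_action act"
  by unfold_locales (auto simp: act_add_left act_add_right act_mult act_one)

end

definition scale_array :: "'f::field \<Rightarrow> (int \<Rightarrow> int \<Rightarrow> 'f) \<Rightarrow> int \<Rightarrow> int \<Rightarrow> 'f" where
  "scale_array r \<phi> = (\<lambda>m n. r * \<phi> m n)"

text \<open>In the determinant x goes with a and b, which lead from row n to row n + 1; hence x
  shifts the second index and y the first. The sign is that of generating functions: multiplication
  by x moves entries towards larger n.\<close>

definition shift_x :: "(int \<Rightarrow> int \<Rightarrow> 'f) \<Rightarrow> int \<Rightarrow> int \<Rightarrow> 'f" where
  "shift_x \<phi> = (\<lambda>m n. \<phi> m (n - 1))"

definition shift_y :: "(int \<Rightarrow> int \<Rightarrow> 'f) \<Rightarrow> int \<Rightarrow> int \<Rightarrow> 'f" where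
  "shift_y \<phi> = (\<lambda>m n. \<phi> (m - 1) n)"

interpretation scale_array: ring_action scale_array
  by unfold_locales (auto simp: scale_array_def fun_eq_iff algebra_simps)

interpretation act_x: shift_action scale_array shift_x
  by unfold_locales (auto simp: scale_array_def shift_x_def fun_eq_iff)

lemma shift_y_act_x: "shift_y (act_x.act P \<phi>) = act_x.act P (shift_y \<phi>)"
proof (induction P)
  case (pCons c P)
  have comm: "shift_y (shift_x \<psi>) = shift_x (shift_y \<psi>)" for \<psi> :: "int \<Rightarrow> int \<Rightarrow> 'a"
    by (simp add: shift_x_def shift_y_def)
  have add: "shift_y (\<psi> + \<theta>) = shift_y \<psi> + shift_y \<theta>" for \<psi> \<theta> :: "int \<Rightarrow> int \<Rightarrow> 'a"
    by (simp add: shift_y_def fun_eq_iff)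
  have scale: "shift_y (scale_array c \<phi>) = scale_array c (shift_y \<phi>)"
    by (simp add: shift_y_def scale_array_def)
  show ?case
    unfolding act_x.act_pCons by (simp only: comm add scale pCons.IH)
qed (simp add: shift_y_def fun_eq_iff)

interpretation act_x: ring_action act_x.act
  by (rule act_x.is_action)

interpretation act_xy: shift_action act_x.act shift_y
  by unfold_locales (auto simp: shift_y_act_x, simp add: shift_y_def fun_eq_iff)

interpretation act_xy: ring_action act_xy.act
  by (rule act_xy.is_action)

lemma shift_x_pow: "(shift_x ^^ i) \<phi> = (\<lambda>m n. \<phi> m (n - int i))"
  by (induction i arbitrary: \<phi>) (auto simp: shift_x_def fun_eq_iff algebra_simps)

lemma shift_y_pow: "(shift_y ^^ i) \<phi> = (\<lambda>m n. \<phi> (m - int i) n)"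
  by (induction i arbitrary: \<phi>) (auto simp: shift_y_def fun_eq_iff algebra_simps)

lemma act_xy_monom:
  "act_xy.act (monom (monom c i) j) \<phi> m n = c * \<phi> (m - int j) (n - int i)"
  by (simp add: act_xy.act_monom act_x.act_monom shift_x_pow shift_y_pow scale_array_def)

lemma act_xy_inner: "act_xy.act [:[:r, s:]:] \<phi> m n = r * \<phi> m n + s * \<phi> m (n - 1)"
  by (simp add: act_xy.act_pCons act_x.act_pCons scale_array_def shift_x_def shift_y_def)

lemma act_xy_outer: "act_xy.act [:[:r:], [:s:]:] \<phi> m n = r * \<phi> m n + s * \<phi> (m - 1) n"
  by (simp add: act_xy.act_pCons act_x.act_pCons scale_array_def shift_x_def shift_y_def)

lemma sum_fun_apply2: "(\<Sum>i\<in>I. f i) m n = (\<Sum>i\<in>I. f i m n)"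
  by (induction I rule: infinite_finite_induct) auto

definition inner_degree_bound :: "'f::zero poly poly \<Rightarrow> nat" where
  "inner_degree_bound P = Max ((\<lambda>j. degree (coeff P j)) ` {..degree P})"

lemma poly_poly_as_sum:
  fixes P :: "'f::comm_ring_1 poly poly"
  assumes "degree P \<le> N" "inner_degree_bound P \<le> N"
  shows "P = (\<Sum>(j, i)\<in>{..N} \<times> {..N}. monom (monom (coeff (coeff P j) i) i) j)"
proof -
  have inner: "degree (coeff P j) \<le> N" if "j \<le> degree P" for j
  proof -
    have "degree (coeff P j) \<le> inner_degree_bound P"
      unfolding inner_degree_bound_def using that by (intro Max_ge) auto
    then show ?thesis using assms(2) by simp
  qed
  have "degree (coeff P j) \<le> N" for j
    using inner[of j] by (cases "j \<le> degree P") (auto simp: coeff_eq_0)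
  then have "coeff P j = (\<Sum>i\<le>N. monom (coeff (coeff P j) i) i)" for j
    using poly_as_sum_of_monoms' by metis
  then have "(\<Sum>j\<le>N. monom (coeff P j) j) = (\<Sum>j\<le>N. monom (\<Sum>i\<le>N. monom (coeff (coeff P j) i) i) j)"
    by metis
  also have "\<dots> = (\<Sum>j\<le>N. \<Sum>i\<le>N. monom (monom (coeff (coeff P j) i) i) j)"
    by (simp add: monom_sum)
  finally show ?thesis
    using poly_as_sum_of_monoms'[OF assms(1)] by (simp add: sum.cartesian_product)
qed


text \<open>By the freshman's dream the q-th power has the terms of P with coefficients raised to
  the power q and exponents multiplied by q. The range N of the sum therefore does not grow with
  k.\<close>

lemma act_xy_frobenius:
  fixes P :: "'f::{field,finite} poly poly"
  assumes "degree P \<le> N" "inner_degree_bound P \<le> N" and q: "q = CHAR('f) ^ k"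
  shows "act_xy.act (P ^ q) \<phi> m n =
    (\<Sum>(j, i)\<in>{..N} \<times> {..N}. coeff (coeff P j) i ^ q * \<phi> (m - int q * int j) (n - int q * int i))"
proof -
  have char: "prime CHAR('f poly poly)" "q = CHAR('f poly poly) ^ k"
    using prime_CHAR_semidom[where ?'a = 'f] finite_imp_CHAR_pos[where ?'a = 'f] q by auto
  have "P ^ q = (\<Sum>(j, i)\<in>{..N} \<times> {..N}. monom (monom (coeff (coeff P j) i) i) j ^ q)"
    by (subst (1) poly_poly_as_sum[OF assms(1,2)], subst freshmans_dream_sum'[OF char])
      (simp add: case_prod_unfold)
  also have "\<dots> = (\<Sum>(j, i)\<in>{..N} \<times> {..N}. monom (monom (coeff (coeff P j) i ^ q) (q * i)) (q * j))"
    by (simp add: monom_power mult.commute)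
  finally show ?thesis
    by (simp add: act_xy.sum_left sum_fun_apply2 act_xy_monom case_prod_unfold)
qed


text \<open>Cramer's rule over F[x][y]: applying the adjugate to the system isolates each
  unknown.\<close>

lemma act_xy_det:
  fixes M :: "'f::field poly poly mat"
  assumes M: "M \<in> carrier_mat k k"
    and sys: "\<And>i. i < k \<Longrightarrow> (\<Sum>j<k. act_xy.act (M $$ (i, j)) (\<phi> j)) = 0" and l: "l < k"
  shows "act_xy.act (det M) (\<phi> l) = 0"
proof -
  have adj: "adj_mat M \<in> carrier_mat k k" "adj_mat M * M = det M \<cdot>\<^sub>m 1\<^sub>m k"
    using adj_mat[OF M] by auto
  have entry: "(\<Sum>i<k. adj_mat M $$ (l, i) * M $$ (i, j)) = (if j = l then det M else 0)" if j: "j < k" for j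
  proof -
    have "(adj_mat M * M) $$ (l, j) = (\<Sum>i<k. adj_mat M $$ (l, i) * M $$ (i, j))"
      using adj(1) M l j by (simp add: scalar_prod_def atLeast0LessThan)
    moreover have "(adj_mat M * M) $$ (l, j) = (if j = l then det M else 0)"
      using l j by (auto simp: adj(2))
    ultimately show ?thesis by simp
  qed
  have "act_xy.act (det M) (\<phi> l) = (\<Sum>j<k. act_xy.act (if j = l then det M else 0) (\<phi> j))"
    using l by (subst sum.remove[of _ l]) (auto intro!: sum.neutral)
  also have "\<dots> = (\<Sum>j<k. \<Sum>i<k. act_xy.act (adj_mat M $$ (l, i)) (act_xy.act (M $$ (i, j)) (\<phi> j)))"
    by (intro sum.cong refl) (simp add: entry[symmetric] act_xy.sum_left act_xy.act_mult)
  also have "\<dots> = (\<Sum>i<k. act_xy.act (adj_mat M $$ (l, i)) (\<Sum>j<k. act_xy.act (M $$ (i, j)) (\<phi> j)))"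
    by (subst sum.swap) (simp add: act_xy.sum_right)
  also have "\<dots> = 0" by (intro sum.neutral ballI) (simp add: sys)
  finally show ?thesis .
qed

section \<open>Linear recurrences in the four quadrants and their finitely many solutions\<close>

definition sgn_int :: "bool \<Rightarrow> int \<Rightarrow> int" where
  "sgn_int e x = (if e then x else - x)"

lemma sgn_int_simps [simp]: "sgn_int True x = x" "sgn_int False x = - x"
  by (simp_all add: sgn_int_def)

lemma periodic_mod:
  fixes f :: "int \<Rightarrow> 'a" and N :: int
  assumes "\<And>x. f (x + N) = f x"
  shows "f (x mod N) = f x"
proof -
  have nat: "f (x + int t * N) = f x" for x t
  proof (induction t)
    case (Suc t)
    then show ?case using assms[of "x + int t * N"] by (simp add: algebra_simps)
  qed simp
  have "f (x + t * N) = f x" for x t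
    using nat[of x "nat t"] nat[of "x + t * N" "nat (- t)"] by (cases "0 \<le> t") auto
  from this[of x "- (x div N)"] show ?thesis by (simp add: minus_div_mult_eq_mod)
qed


text \<open>Off the cross |m| \<le> N or |n| \<le> N, the recurrence for the quadrant of (m, n)
  expresses the value there by values closer to the origin: steps of length at most N do not leave
  the quadrant, so every other term has a smaller |m| + |n|.\<close>

lemma recurrence_unique:
  fixes \<delta> :: "int \<Rightarrow> int \<Rightarrow> 'f::field" and r :: "bool \<Rightarrow> bool \<Rightarrow> nat \<Rightarrow> nat \<Rightarrow> 'f"
  assumes r: "\<And>\<sigma> \<tau>. r \<sigma> \<tau> 0 0 \<noteq> 0"
    and rec: "\<And>\<sigma> \<tau> m n. (\<Sum>(j, i)\<in>{..N} \<times> {..N}. r \<sigma> \<tau> j i * \<delta> (m - sgn_int \<sigma> (int j)) (n - sgn_int \<tau> (int i))) = 0"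
    and cross: "\<And>m n. \<bar>m\<bar> \<le> int N \<or> \<bar>n\<bar> \<le> int N \<Longrightarrow> \<delta> m n = 0"
  shows "\<delta> m n = 0"
proof (induction "nat (\<bar>m\<bar> + \<bar>n\<bar>)" arbitrary: m n rule: less_induct)
  case less
  show ?case
  proof (cases "\<bar>m\<bar> \<le> int N \<or> \<bar>n\<bar> \<le> int N")
    case True
    then show ?thesis by (rule cross)
  next
    case False
    define \<sigma> \<tau> where "\<sigma> = (0 < m)" and "\<tau> = (0 < n)"
    let ?f = "\<lambda>(j, i). r \<sigma> \<tau> j i * \<delta> (m - sgn_int \<sigma> (int j)) (n - sgn_int \<tau> (int i))"
    have "?f z = 0" if "z \<in> {..N} \<times> {..N} - {(0, 0)}" for z
    proof -
      obtain j i where z: "z = (j, i)" by fastforce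
      have le: "j \<le> N" "i \<le> N" and pos: "0 < j + i" using that z by auto
      have abs: "\<bar>x - sgn_int (0 < x) (int j)\<bar> = \<bar>x\<bar> - int j" if "int j < \<bar>x\<bar>" for x j
        using that by (cases "0 < x") simp_all
      have "\<bar>m - sgn_int \<sigma> (int j)\<bar> = \<bar>m\<bar> - int j"
        unfolding \<sigma>_def by (rule abs) (use False le in linarith)
      moreover have "\<bar>n - sgn_int \<tau> (int i)\<bar> = \<bar>n\<bar> - int i"
        unfolding \<tau>_def by (rule abs) (use False le in linarith)
      ultimately have "nat (\<bar>m - sgn_int \<sigma> (int j)\<bar> + \<bar>n - sgn_int \<tau> (int i)\<bar>) < nat (\<bar>m\<bar> + \<bar>n\<bar>)"
        unfolding zless_nat_conj using False pos by auto
      then have "\<delta> (m - sgn_int \<sigma> (int j)) (n - sgn_int \<tau> (int i)) = 0" by (rule less)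
      then show ?thesis by (simp add: z)
    qed
    then have "sum ?f ({..N} \<times> {..N} - {(0, 0)}) = 0" by (intro sum.neutral ballI)
    moreover have "sum ?f ({..N} \<times> {..N}) = ?f (0, 0) + sum ?f ({..N} \<times> {..N} - {(0, 0)})"
      by (rule sum.remove) auto
    ultimately have "?f (0, 0) = 0" using rec[of \<sigma> \<tau> m n] by (simp only: add_0_right)
    then show ?thesis using r[of \<sigma> \<tau>] by (simp add: sgn_int_def split: if_splits)
  qed
qed

definition recurrence_solutions ::
    "nat \<Rightarrow> int \<Rightarrow> (bool \<times> bool \<times> nat \<times> nat \<Rightarrow> 'f::field) \<Rightarrow> (int \<times> int \<Rightarrow> 'f) set" where
  "recurrence_solutions N Q r = {\<kappa>.
     (\<forall>\<sigma> \<tau> m n. (\<Sum>(j, i)\<in>{..N} \<times> {..N}. r (\<sigma>, \<tau>, j, i) *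
        \<kappa> (m - sgn_int \<sigma> (int j), n - sgn_int \<tau> (int i))) = 0) \<and>
     (\<forall>m n. \<bar>m\<bar> \<le> int N \<longrightarrow> \<kappa> (m, n + Q) = \<kappa> (m, n)) \<and>
     (\<forall>m n. \<bar>n\<bar> \<le> int N \<longrightarrow> \<kappa> (m + Q, n) = \<kappa> (m, n))}"

text \<open>A solution is determined by its values on the cross, and these by the finite set B
  because of the period Q.\<close>

lemma finite_recurrence_solutions:
  fixes r :: "bool \<times> bool \<times> nat \<times> nat \<Rightarrow> 'f::{field,finite}"
  assumes r: "\<And>\<sigma> \<tau>. r (\<sigma>, \<tau>, 0, 0) \<noteq> 0" and Q: "0 < Q"
  shows "finite (recurrence_solutions N Q r)"
proof -
  define B where "B = {- int N..int N} \<times> {0..<Q} \<union> {0..<Q} \<times> {- int N..int N}"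
  have "inj_on (\<lambda>\<kappa>. restrict \<kappa> B) (recurrence_solutions N Q r)"
  proof
    fix \<kappa> \<kappa>' assume k: "\<kappa> \<in> recurrence_solutions N Q r" "\<kappa>' \<in> recurrence_solutions N Q r"
      and eq: "restrict \<kappa> B = restrict \<kappa>' B"
    have eqB: "\<kappa> z = \<kappa>' z" if "z \<in> B" for z
      using eq that by (metis restrict_apply')
    define \<delta> where "\<delta> m n = \<kappa> (m, n) - \<kappa>' (m, n)" for m n
    have "\<delta> m n = 0" for m n
    proof (rule recurrence_unique[where r = "\<lambda>\<sigma> \<tau> j i. r (\<sigma>, \<tau>, j, i)"])
      fix \<sigma> \<tau> m n
      have "(\<Sum>(j, i)\<in>{..N} \<times> {..N}. r (\<sigma>, \<tau>, j, i) * \<delta> (m - sgn_int \<sigma> (int j)) (n - sgn_int \<tau> (int i)))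
        = (\<Sum>(j, i)\<in>{..N} \<times> {..N}. r (\<sigma>, \<tau>, j, i) * \<kappa> (m - sgn_int \<sigma> (int j), n - sgn_int \<tau> (int i)))
        - (\<Sum>(j, i)\<in>{..N} \<times> {..N}. r (\<sigma>, \<tau>, j, i) * \<kappa>' (m - sgn_int \<sigma> (int j), n - sgn_int \<tau> (int i)))"
        by (simp add: \<delta>_def algebra_simps sum_subtractf case_prod_unfold)
      then show "(\<Sum>(j, i)\<in>{..N} \<times> {..N}. r (\<sigma>, \<tau>, j, i) * \<delta> (m - sgn_int \<sigma> (int j)) (n - sgn_int \<tau> (int i))) = 0"
        using k by (simp add: recurrence_solutions_def)
    next
      fix m n assume mn: "\<bar>m\<bar> \<le> int N \<or> \<bar>n\<bar> \<le> int N"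
      show "\<delta> m n = 0"
      proof (cases "\<bar>m\<bar> \<le> int N")
        case True
        then have "\<kappa> (m, n mod Q) = \<kappa> (m, n)" "\<kappa>' (m, n mod Q) = \<kappa>' (m, n)"
          using k periodic_mod[of "\<lambda>n. \<kappa> (m, n)" Q n] periodic_mod[of "\<lambda>n. \<kappa>' (m, n)" Q n]
          by (auto simp: recurrence_solutions_def)
        moreover have "(m, n mod Q) \<in> B" using True Q by (auto simp: B_def)
        ultimately show ?thesis using eqB by (metis \<delta>_def right_minus_eq)
      next
        case False
        then have n: "\<bar>n\<bar> \<le> int N" using mn by simp
        then have "\<kappa> (m mod Q, n) = \<kappa> (m, n)" "\<kappa>' (m mod Q, n) = \<kappa>' (m, n)"
          using k periodic_mod[of "\<lambda>m. \<kappa> (m, n)" Q m] periodic_mod[of "\<lambda>m. \<kappa>' (m, n)" Q m]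
          by (auto simp: recurrence_solutions_def)
        moreover have "(m mod Q, n) \<in> B" using n Q by (auto simp: B_def)
        ultimately show ?thesis using eqB by (metis \<delta>_def right_minus_eq)
      qed
    qed (use r in simp)
    then show "\<kappa> = \<kappa>'" by (auto simp: \<delta>_def fun_eq_iff)
  qed
  moreover have "(\<lambda>\<kappa>. restrict \<kappa> B) ` recurrence_solutions N Q r \<subseteq> B \<rightarrow>\<^sub>E UNIV" by auto
  moreover have "finite (B \<rightarrow>\<^sub>E (UNIV :: 'f set))"
    by (intro finite_PiE) (auto simp: B_def)
  ultimately show ?thesis by (meson finite_imageD finite_subset)
qed

text \<open>Coordinates of a coloring: the first \<open>k1\<close> arrays are determined by the row below,
  the others by the column to the left.\<close>

locale linear_arrays =
  fixes k k1 :: nat and E :: "nat \<Rightarrow> nat \<Rightarrow> 'f::{field,finite}" and w :: "nat \<Rightarrow> int \<Rightarrow> int \<Rightarrow> 'f"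
    and period :: nat
  assumes up: "\<And>i m n. i < k \<Longrightarrow> i < k1 \<Longrightarrow> w i m (n + 1) = (\<Sum>j<k. E i j * w j m n)"
    and right: "\<And>i m n. i < k \<Longrightarrow> \<not> i < k1 \<Longrightarrow> w i (m + 1) n = (\<Sum>j<k. E i j * w j m n)"
    and nonsingular: "\<And>\<sigma> \<tau>. det (mat k k (\<lambda>(i, j). if (if i < k1 then \<tau> else \<sigma>) then (if i = j then 1 else 0) else - E i j)) \<noteq> 0"
    and period_pos: "0 < period"
    and column_period: "\<And>i m n e. i < k \<Longrightarrow> \<bar>m\<bar> + 2 \<le> int CHAR('f) ^ e \<Longrightarrow>
      w i m (n + int period * int CHAR('f) ^ e) = w i m n"
    and row_period: "\<And>i m n e. i < k \<Longrightarrow> \<bar>n\<bar> + 2 \<le> int CHAR('f) ^ e \<Longrightarrow>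
      w i (m + int period * int CHAR('f) ^ e) n = w i m n"
begin

text \<open>The relations for the array reflected according to the signs, which turns each quadrant
  into the first one. Where the direction of a relation is reversed, the shift falls on the identity
  part instead of the part with E. The constant terms form the matrices of
  \<open>nonsingular\<close>.\<close>

definition system :: "bool \<Rightarrow> bool \<Rightarrow> 'f poly poly mat" where
  "system \<sigma> \<tau> = mat k k (\<lambda>(i, j). let o1 = (if i = j then 1 else 0) in
     if i < k1 then if \<tau> then [:[:o1, - E i j:]:] else [:[:- E i j, o1:]:]
     else if \<sigma> then [:[:o1:], [:- E i j:]:] else [:[:- E i j:], [:o1:]:])"

definition den :: "bool \<Rightarrow> bool \<Rightarrow> 'f poly poly" where
  "den \<sigma> \<tau> = det (system \<sigma> \<tau>)"

lemma den_const: "coeff (coeff (den \<sigma> \<tau>) 0) 0 \<noteq> 0"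
proof -
  interpret ev: comm_ring_hom "\<lambda>P :: 'f poly poly. poly (poly P 0) 0"
    by unfold_locales auto
  have eq: "map_mat (\<lambda>P. poly (poly P 0) 0) (system \<sigma> \<tau>)
      = mat k k (\<lambda>(i, j). if (if i < k1 then \<tau> else \<sigma>) then (if i = j then 1 else 0) else - E i j)"
    by (intro eq_matI) (auto simp: system_def Let_def)
  have "poly (poly (den \<sigma> \<tau>) 0) 0 \<noteq> 0"
    unfolding den_def ev.hom_det[symmetric] eq by (rule nonsingular)
  then show ?thesis by (simp add: poly_0_coeff_0)
qed

lemma sum_delta: "i < k \<Longrightarrow> (\<Sum>j<k. (if i = j then 1 else 0) * f j) = (f i :: 'f)"
  by (simp add: if_distrib[of "\<lambda>x. x * _"] cong: if_cong)

lemma den_act: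
  assumes l: "l < k"
  shows "act_xy.act (den \<sigma> \<tau>) (\<lambda>m n. w l (sgn_int \<sigma> m) (sgn_int \<tau> n)) = 0"
  unfolding den_def
proof (rule act_xy_det[where k = k and \<phi> = "\<lambda>l m n. w l (sgn_int \<sigma> m) (sgn_int \<tau> n)"])
  show "system \<sigma> \<tau> \<in> carrier_mat k k" by (simp add: system_def)
  fix i assume i: "i < k"
  let ?\<phi> = "\<lambda>l m n. w l (sgn_int \<sigma> m) (sgn_int \<tau> n)"
  show "(\<Sum>j<k. act_xy.act (system \<sigma> \<tau> $$ (i, j)) (?\<phi> j)) = 0"
  proof (intro ext)
    fix m n
    have "(\<Sum>j<k. act_xy.act (system \<sigma> \<tau> $$ (i, j)) (?\<phi> j) m n) = 0"
    proof (cases "i < k1")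
      case True
      show ?thesis
      proof (cases \<tau>)
        case tau: True
        have "(\<Sum>j<k. act_xy.act (system \<sigma> \<tau> $$ (i, j)) (?\<phi> j) m n)
          = (\<Sum>j<k. (if i = j then 1 else 0) * ?\<phi> j m n) - (\<Sum>j<k. E i j * ?\<phi> j m (n - 1))"
          using i True tau
          by (simp add: system_def Let_def act_xy_inner sum_subtractf del: sgn_int_simps)
        then show ?thesis
          using up[OF i True, of "sgn_int \<sigma> m" "n - 1"] tau by (simp only: sum_delta[OF i]) simp
      next
        case tau: False
        have "(\<Sum>j<k. act_xy.act (system \<sigma> \<tau> $$ (i, j)) (?\<phi> j) m n)
          = (\<Sum>j<k. (if i = j then 1 else 0) * ?\<phi> j m (n - 1)) - (\<Sum>j<k. E i j * ?\<phi> j m n)"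
          using i True tau
          by (simp add: system_def Let_def act_xy_inner sum_subtractf del: sgn_int_simps)
        then show ?thesis
          using up[OF i True, of "sgn_int \<sigma> m" "- n"] tau by (simp only: sum_delta[OF i]) simp
      qed
    next
      case False
      show ?thesis
      proof (cases \<sigma>)
        case sig: True
        have "(\<Sum>j<k. act_xy.act (system \<sigma> \<tau> $$ (i, j)) (?\<phi> j) m n)
          = (\<Sum>j<k. (if i = j then 1 else 0) * ?\<phi> j m n) - (\<Sum>j<k. E i j * ?\<phi> j (m - 1) n)"
          using i False sig
          by (simp add: system_def Let_def act_xy_outer sum_subtractf del: sgn_int_simps)
        then show ?thesis
          using right[OF i False, of "m - 1" "sgn_int \<tau> n"] sig by (simp only: sum_delta[OF i]) simp
      next
        case sig: False
        have "(\<Sum>j<k. act_xy.act (system \<sigma> \<tau> $$ (i, j)) (?\<phi> j) m n)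
          = (\<Sum>j<k. (if i = j then 1 else 0) * ?\<phi> j (m - 1) n) - (\<Sum>j<k. E i j * ?\<phi> j m n)"
          using i False sig
          by (simp add: system_def Let_def act_xy_outer sum_subtractf del: sgn_int_simps)
        then show ?thesis
          using right[OF i False, of "- m" "sgn_int \<tau> n"] sig by (simp only: sum_delta[OF i]) simp
      qed
    qed
    then show "(\<Sum>j<k. act_xy.act (system \<sigma> \<tau> $$ (i, j)) (?\<phi> j)) m n = 0 m n"
      by (simp add: sum_fun_apply2)
  qed
qed (rule l)

definition bound :: nat where
  "bound = Max ((\<lambda>(\<sigma>, \<tau>). max (degree (den \<sigma> \<tau>)) (inner_degree_bound (den \<sigma> \<tau>))) ` UNIV)"

lemma bound: "degree (den \<sigma> \<tau>) \<le> bound" "inner_degree_bound (den \<sigma> \<tau>) \<le> bound"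
proof -
  have "max (degree (den \<sigma> \<tau>)) (inner_degree_bound (den \<sigma> \<tau>)) \<le> bound"
    unfolding bound_def by (intro Max_ge) (auto intro: image_eqI[where x = "(\<sigma>, \<tau>)"])
  then show "degree (den \<sigma> \<tau>) \<le> bound" "inner_degree_bound (den \<sigma> \<tau>) \<le> bound" by simp_all
qed

text \<open>The determinant annihilates the reflected array, hence so does its q-th power, which is
  sparse; undoing the reflection gives a recurrence whose steps are multiples of q.\<close>

lemma frobenius_recurrence:
  assumes l: "l < k" and q: "q = CHAR('f) ^ e"
  shows "(\<Sum>(j, i)\<in>{..bound} \<times> {..bound}. coeff (coeff (den \<sigma> \<tau>) j) i ^ q *
    w l (m - int q * sgn_int \<sigma> (int j)) (n - int q * sgn_int \<tau> (int i))) = 0"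
proof -
  let ?\<phi> = "\<lambda>m n. w l (sgn_int \<sigma> m) (sgn_int \<tau> n)"
  have "0 < q" using q finite_imp_CHAR_pos[where ?'a = 'f] by simp
  then obtain q' where "q = Suc q'" using gr0_implies_Suc by blast
  then have "act_xy.act (den \<sigma> \<tau> ^ q) ?\<phi> = 0"
    by (simp add: power_Suc2 act_xy.act_mult den_act[OF l] del: power_Suc)
  then have "act_xy.act (den \<sigma> \<tau> ^ q) ?\<phi> (sgn_int \<sigma> m) (sgn_int \<tau> n) = 0" by simp
  moreover have "sgn_int \<epsilon> (sgn_int \<epsilon> x - int q * int j) = x - int q * sgn_int \<epsilon> (int j)" for \<epsilon> x j
    by (cases \<epsilon>) auto
  ultimately show ?thesis
    by (subst (asm) act_xy_frobenius[OF bound q]) simp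
qed

text \<open>A decimation by q = p^e satisfies recurrences of the same range, with coefficients
  raised to the power q; over a finite field these have finitely many possibilities r. Near the axes
  it has the period Q, the same for all e.\<close>

lemma finite_kernel:
  assumes l: "l < k"
  shows "finite (\<Union>e. kernel_level CHAR('f) (\<lambda>(m, n). w l m n) e)"
proof -
  let ?p = "CHAR('f)"
  have p: "2 \<le> ?p"
    using prime_CHAR_semidom[where ?'a = 'f] finite_imp_CHAR_pos[where ?'a = 'f] prime_ge_2_nat by auto
  define I where "I = (UNIV :: bool set) \<times> (UNIV :: bool set) \<times> {..bound} \<times> {..bound}"
  define C where "C = {r \<in> I \<rightarrow>\<^sub>E (UNIV :: 'f set). \<forall>\<sigma> \<tau>. r (\<sigma>, \<tau>, 0, 0) \<noteq> 0}"
  \<comment> \<open>For |m| \<le> \<open>bound\<close> and 0 \<le> b < q one has |q m + b| + 2 \<le>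
    q (\<open>bound\<close> + 3), because q is at least 1. So p^e0 has to reach \<open>bound\<close>
    + 3, which it does since n < 2^n.\<close>
  define e0 where "e0 = bound + 3"
  have e0: "bound + 3 \<le> ?p ^ e0"
    using less_exp[of e0] power_mono[OF p, of e0] unfolding e0_def by linarith
  define Q where "Q = int period * int ?p ^ e0"
  have "finite C" unfolding C_def I_def by (rule finite_subset[OF _ finite_PiE[of I "\<lambda>_. UNIV"]]) (auto simp: I_def)
  then have fin: "finite (\<Union>r\<in>C. recurrence_solutions bound Q r)"
    using period_pos p by (intro finite_UN_I finite_recurrence_solutions) (auto simp: C_def Q_def)
  have "kernel_level ?p (\<lambda>(m, n). w l m n) e \<subseteq> (\<Union>r\<in>C. recurrence_solutions bound Q r)" for e
  proof
    fix \<kappa> assume "\<kappa> \<in> kernel_level ?p (\<lambda>(m, n). w l m n) e"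
    then obtain b1 b2 where b: "0 \<le> b1" "b1 < int (?p ^ e)" "0 \<le> b2" "b2 < int (?p ^ e)"
      and \<kappa>: "\<And>m n. \<kappa> (m, n) = w l (int (?p ^ e) * m + b1) (int (?p ^ e) * n + b2)"
      by (auto simp: kernel_level_def block_index_def decimate_def block_point_def)
    define q where "q = ?p ^ e"
    define r where "r = (\<lambda>(\<sigma>, \<tau>, j, i)\<in>I. coeff (coeff (den \<sigma> \<tau>) j) i ^ q)"
    have rI: "r (\<sigma>, \<tau>, j, i) = coeff (coeff (den \<sigma> \<tau>) j) i ^ q" if "j \<le> bound" "i \<le> bound" for \<sigma> \<tau> j i
      using that by (simp add: r_def I_def)
    have "r \<in> C" using den_const by (auto simp: C_def rI) (simp add: r_def)
    moreover have "\<kappa> \<in> recurrence_solutions bound Q r"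
      unfolding recurrence_solutions_def
    proof (intro CollectI conjI allI impI)
      fix \<sigma> \<tau> m n
      have "(\<Sum>(j, i)\<in>{..bound} \<times> {..bound}. r (\<sigma>, \<tau>, j, i) * \<kappa> (m - sgn_int \<sigma> (int j), n - sgn_int \<tau> (int i)))
        = (\<Sum>(j, i)\<in>{..bound} \<times> {..bound}. coeff (coeff (den \<sigma> \<tau>) j) i ^ q *
          w l ((int q * m + b1) - int q * sgn_int \<sigma> (int j)) ((int q * n + b2) - int q * sgn_int \<tau> (int i)))"
        by (intro sum.cong refl) (auto simp: rI \<kappa> q_def algebra_simps)
      also have "\<dots> = 0" by (rule frobenius_recurrence[OF l]) (simp add: q_def)
      finally show "(\<Sum>(j, i)\<in>{..bound} \<times> {..bound}. r (\<sigma>, \<tau>, j, i) *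
        \<kappa> (m - sgn_int \<sigma> (int j), n - sgn_int \<tau> (int i))) = 0" .
    next
      have abs: "\<bar>int (?p ^ e) * m + x\<bar> + 2 \<le> int ?p ^ (e + e0)"
        if "\<bar>m\<bar> \<le> int bound" "0 \<le> x" "x < int (?p ^ e)" for m x
      proof -
        have "\<bar>int (?p ^ e) * m + x\<bar> + 2 \<le> int (?p ^ e) * \<bar>m\<bar> + \<bar>x\<bar> + 2"
          by (metis abs_mult abs_of_nat abs_triangle_ineq add_right_mono)
        also have "\<dots> \<le> int (?p ^ e) * int bound + int (?p ^ e) * 3"
          using that mult_left_mono[OF that(1), of "int (?p ^ e)"] by simp
        also have "\<dots> = int (?p ^ e) * int (bound + 3)" by (simp add: algebra_simps)
        also have "\<dots> \<le> int (?p ^ e) * int (?p ^ e0)"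
          using e0 by (intro mult_left_mono) (simp_all only: of_nat_le_iff of_nat_0_le_iff)
        finally show ?thesis by (simp add: power_add)
      qed
      have Q: "int (?p ^ e) * (z + Q) + x = (int (?p ^ e) * z + x) + int period * int ?p ^ (e + e0)" for z x
        by (simp add: Q_def power_add algebra_simps)
      show "\<kappa> (m, n + Q) = \<kappa> (m, n)" if "\<bar>m\<bar> \<le> int bound" for m n
        unfolding \<kappa> Q by (rule column_period[OF l abs[OF that b(1,2)]])
      show "\<kappa> (m + Q, n) = \<kappa> (m, n)" if "\<bar>n\<bar> \<le> int bound" for m n
        unfolding \<kappa> Q by (rule row_period[OF l abs[OF that b(3,4)]])
    qed
    ultimately show "\<kappa> \<in> (\<Union>r\<in>C. recurrence_solutions bound Q r)" by blast
  qed
  then show ?thesis using fin by (meson UN_least finite_subset)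
qed

end

text \<open>Recursion in both directions over the integers. Only the existence of successors and
  predecessors within X is asked for, so Q may be a relation that determines neither.\<close>

lemma int_chain:
  assumes x0: "X x0" and fwd: "\<And>x. X x \<Longrightarrow> \<exists>y. X y \<and> Q x y" and bwd: "\<And>y. X y \<Longrightarrow> \<exists>x. X x \<and> Q x y"
  shows "\<exists>z :: int \<Rightarrow> 'a. z 0 = x0 \<and> (\<forall>k. X (z k) \<and> Q (z k) (z (k + 1)))"
proof -
  obtain f where f: "\<And>x. X x \<Longrightarrow> X (f x) \<and> Q x (f x)" using fwd by metis
  obtain g where g: "\<And>y. X y \<Longrightarrow> X (g y) \<and> Q (g y) y" using bwd by metis
  define z where "z k = (if 0 \<le> k then (f ^^ nat k) x0 else (g ^^ nat (- k)) x0)" for k :: int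
  have Xf: "X ((f ^^ n) x0)" for n by (induction n) (use x0 f in auto)
  have Xg: "X ((g ^^ n) x0)" for n by (induction n) (use x0 g in auto)
  show ?thesis
  proof (intro exI[of _ z] conjI allI)
    show "z 0 = x0" by (simp add: z_def)
    show "X (z k)" for k by (simp add: z_def Xf Xg)
    show "Q (z k) (z (k + 1))" for k
    proof (cases "0 \<le> k")
      case True
      then have "nat (k + 1) = Suc (nat k)" by simp
      then show ?thesis using True f[OF Xf[of "nat k"]] by (simp add: z_def)
    next
      case False
      then obtain n where n: "nat (- k) = Suc n" by (cases "nat (- k)") auto
      then have "nat (- (k + 1)) = n" by simp
      moreover have "z (k + 1) = (g ^^ nat (- (k + 1))) x0"
        using False by (cases "k = - 1") (auto simp: z_def)
      ultimately show ?thesis using False n g[OF Xg[of n]] by (simp add: z_def)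
    qed
  qed
qed

text \<open>A tiling of the plane by squares, with the given labels on the two axes: the columns are
  constructed one after the other, each together with the column of horizontal edges to its right.\<close>

context square_complex
begin

lemma plane_exists:
  fixes v1 :: 'v and v2 :: 'w
  obtains u1 :: "int \<Rightarrow> int \<Rightarrow> 'v" and u2 :: "int \<Rightarrow> int \<Rightarrow> 'w" where "\<And>m n. u1 m (n + 1) = upper (u1 m n) (u2 m n)"
    "\<And>m n. u2 (m + 1) n = right (u1 m n) (u2 m n)"
    "\<And>m. u1 m 0 = v1" "\<And>n. u2 0 n = v2"
proof -
  define X where "X = (\<lambda>(h, y). h 0 = v1 \<and> (\<forall>n :: int. h (n + 1) = upper (h n) (y n)))"
  define Q where "Q = (\<lambda>(h, y) (h' :: int \<Rightarrow> 'v, y'). \<forall>n :: int. y' n = right (h n) (y n))"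
  have bottom: "\<exists>h. h 0 = v1 \<and> (\<forall>n :: int. h (n + 1) = F n (h n))"
    if surj: "\<And>n z. \<exists>x. F n x = z" for F
  proof -
    \<comment> \<open>The relation in \<open>int_chain\<close> does not see the position, so the
      position is carried along as a first component.\<close>
    have "\<exists>z :: int \<Rightarrow> int \<times> 'v. z 0 = (0, v1) \<and>
        (\<forall>k. True \<and> snd (z (k + 1)) = F (fst (z k)) (snd (z k)) \<and> fst (z (k + 1)) = fst (z k) + 1)"
    proof (rule int_chain)
      fix y :: "int \<times> 'v"
      obtain x where "F (fst y - 1) x = snd y" using surj by blast
      then show "\<exists>x. True \<and> snd y = F (fst x) (snd x) \<and> fst y = fst x + 1"
        by (intro exI[of _ "(fst y - 1, x)"]) simp
    qed auto
    then obtain z :: "int \<Rightarrow> int \<times> 'v" where z: "z 0 = (0, v1)"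
      "\<And>k. snd (z (k + 1)) = F (fst (z k)) (snd (z k)) \<and> fst (z (k + 1)) = fst (z k) + 1"
      by blast
    have "fst (z k) = k" for k
    proof (induction k rule: int_induct[where k = 0])
      case (step2 i)
      then show ?case using z(2)[of "i - 1"] by simp
    qed (use z in simp_all)
    then show ?thesis using z by (intro exI[of _ "\<lambda>k. snd (z k)"]) simp
  qed
  have row: "\<exists>h. X (h, y)" for y
  proof -
    have "\<exists>x. upper x (y n) = z" for n z by (metis upper_lower)
    then show ?thesis using bottom[of "\<lambda>n x. upper x (y n)"] by (auto simp: X_def)
  qed
  obtain h0 where h0: "X (h0, \<lambda>_. v2)" using row by blast
  have "\<exists>z :: int \<Rightarrow> _. z 0 = (h0, \<lambda>_. v2) \<and> (\<forall>k. X (z k) \<and> Q (z k) (z (k + 1)))"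
  proof (rule int_chain)
    show "X (h0, \<lambda>_. v2)" by (rule h0)
    fix s assume "X s"
    show "\<exists>y. X y \<and> Q s y"
      using row[of "\<lambda>n. right (fst s n) (snd s n)"] by (force simp: Q_def case_prod_unfold)
  next
    fix s' assume "X s'"
    \<comment> \<open>Extending to the left, the right edges r of the new column are given. The
      passage x \<mapsto> \<open>upper x (left x r)\<close> from a lower to an upper edge is
      surjective because the upper right corner determines a square.\<close>
    obtain h where h: "h 0 = v1" "\<And>n :: int. h (n + 1) = upper (h n) (left (h n) (snd s' n))"
    proof -
      have "\<exists>x. upper x (left x r) = z" for r z
        by (metis fst_conv left_right snd_conv upper_right_corner)
      then show ?thesis using that bottom[of "\<lambda>n x. upper x (left x (snd s' n))"] by blast
    qed
    have "X (h, \<lambda>n. left (h n) (snd s' n))" using h by (simp add: X_def)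
    moreover have "Q (h, \<lambda>n. left (h n) (snd s' n)) s'" by (simp add: Q_def case_prod_unfold)
    ultimately show "\<exists>x. X x \<and> Q x s'" by blast
  qed
  then obtain z :: "int \<Rightarrow> _" where z: "z 0 = (h0, \<lambda>_. v2)" "\<And>k. X (z k)" "\<And>k. Q (z k) (z (k + 1))"
    by blast
  show ?thesis
  proof (rule that[of "\<lambda>m. fst (z m)" "\<lambda>m. snd (z m)"])
    fix m n
    show "fst (z m) (n + 1) = upper (fst (z m) n) (snd (z m) n)" "fst (z m) 0 = v1"
      using z(2)[of m] by (auto simp: X_def case_prod_unfold)
    show "snd (z (m + 1)) n = right (fst (z m) n) (snd (z m) n)"
      using z(3)[of m] by (auto simp: Q_def case_prod_unfold)
    show "snd (z 0) n = v2" by (simp add: z(1))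
  qed
qed

end


section \<open>Periods of rows and columns\<close>

definition delta :: "int \<Rightarrow> (int \<Rightarrow> 'x::ab_group_add) \<Rightarrow> int \<Rightarrow> 'x" where
  "delta N f = (\<lambda>m. f m - f (m - N))"

lemma delta_pow_shift: "(delta N ^^ j) (\<lambda>m. f (m + s)) = (\<lambda>m. (delta N ^^ j) f (m + s))"
  by (induction j) (auto simp: delta_def fun_eq_iff algebra_simps)

lemma additive_0:
  fixes A :: "'x::ab_group_add \<Rightarrow> 'y::ab_group_add"
  assumes "\<And>x y. A (x + y) = A x + A y"
  shows "A 0 = 0"
  using assms[of 0 0] by simp

lemma additive_diff:
  fixes A :: "'x::ab_group_add \<Rightarrow> 'y::ab_group_add"
  assumes "\<And>x y. A (x + y) = A x + A y"
  shows "A (x - y) = A x - A y"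
  using assms[of "x - y" y] by (simp add: algebra_simps)

lemma delta_pow_additive:
  assumes "\<And>x y. A (x + y) = A x + A y"
  shows "(delta N ^^ j) (\<lambda>m. A (f m)) = (\<lambda>m. A ((delta N ^^ j) f m))"
  by (induction j) (auto simp: delta_def fun_eq_iff additive_diff[OF assms])

lemma delta_pow_add: "(delta N ^^ j) (\<lambda>m. f m + g m) = (\<lambda>m. (delta N ^^ j) f m + (delta N ^^ j) g m)"
  by (induction j) (auto simp: delta_def fun_eq_iff algebra_simps)

text \<open>Annihilated by the j-th power of 1 - S^N, where S is the unit shift; for j = 1 this says
  that N is a period.\<close>

definition killed :: "int \<Rightarrow> nat \<Rightarrow> (int \<Rightarrow> 'x::ab_group_add) \<Rightarrow> bool" where
  "killed N j f \<longleftrightarrow> (delta N ^^ j) f = (\<lambda>_. 0)"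

lemma killed_mono:
  assumes "killed N i f" "i \<le> j"
  shows "killed N j f"
proof -
  have "(delta N ^^ k) (\<lambda>_. 0 :: 'a) = (\<lambda>_. 0)" for k
    by (induction k) (auto simp: delta_def)
  moreover have "(delta N ^^ j) f = (delta N ^^ (j - i)) ((delta N ^^ i) f)"
    using assms(2) by (metis comp_apply funpow_add le_add_diff_inverse2)
  ultimately show ?thesis using assms(1) by (simp add: killed_def)
qed

lemma killed_comb:
  assumes "killed N j f" "killed N j g"
    and "\<And>x y. A (x + y) = A x + A y" "\<And>x y. B (x + y) = B x + B y"
  shows "killed N j (\<lambda>m. A (f m) + B (g m))"
  using assms additive_0[of A] additive_0[of B]
  by (simp add: killed_def delta_pow_add delta_pow_additive)

lemma killed_additive:
  assumes "killed N j f" "\<And>x y. A (x + y) = A x + A y"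
  shows "killed N j (\<lambda>m. A (f m))"
  using assms additive_0[of A, OF assms(2)] by (simp add: killed_def delta_pow_additive[of A, OF assms(2)])


text \<open>The j-th difference v of u satisfies v(m + 1) = A(v m), as the inhomogeneous term is
  killed. Since A^N = id, v has period N, so one more difference kills u.\<close>

lemma killed_recurrence:
  assumes rec: "\<And>m. u (m + 1) = A (u m) + g m" and g: "killed (int N) j g"
    and A: "\<And>x y. A (x + y) = A x + A y" and N: "A ^^ N = id"
  shows "killed (int N) (Suc j) u"
proof -
  define v where "v = (delta (int N) ^^ j) u"
  have "(delta (int N) ^^ j) (\<lambda>m. u (m + 1)) = (delta (int N) ^^ j) (\<lambda>m. A (u m) + g m)"
    by (simp only: rec)
  then have eq: "(\<lambda>m. v (m + 1)) = (\<lambda>m. A (v m) + (delta (int N) ^^ j) g m)"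
    by (simp only: delta_pow_shift delta_pow_add delta_pow_additive[OF A] v_def)
  have step: "v (m + 1) = A (v m)" for m
    using fun_cong[OF eq, of m] g by (simp add: killed_def)
  have "v (m + int n) = (A ^^ n) (v m)" for m n
  proof (induction n)
    case (Suc n)
    have "m + int (Suc n) = (m + int n) + 1" by simp
    then show ?case using step[of "m + int n"] Suc by (simp only: funpow.simps comp_apply)
  qed simp
  from this[of "m - int N" N for m] have "v m = v (m - int N)" for m by (simp add: N)
  then show ?thesis by (simp add: killed_def v_def delta_def fun_eq_iff)
qed

text \<open>Starting from the constant row \<open>u1 m 0\<close>, each row costs one more
  difference. Going up, u2 obeys a recurrence with matrix d. Going down, \<open>up\<close> must be
  solved for the lower edge, which involves the unknown u2 of the same row; substituting this in
  \<open>right\<close> yields a recurrence with the Schur complement d - c a^(-1) b, whence the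
  second assumption on N.\<close>

lemma row_killed:
  fixes u1 :: "int \<Rightarrow> int \<Rightarrow> 'v::ab_group_add" and u2 :: "int \<Rightarrow> int \<Rightarrow> 'w::ab_group_add"
  assumes a: "\<And>x y. a (x + y) = a x + a y" and b: "\<And>x y. b (x + y) = b x + b y"
    and c: "\<And>x y. c (x + y) = c x + c y" and d: "\<And>x y. d (x + y) = d x + d y"
    and up: "\<And>m n. u1 m (n + 1) = a (u1 m n) + b (u2 m n)"
    and right: "\<And>m n. u2 (m + 1) n = c (u1 m n) + d (u2 m n)"
    and base: "\<And>m. u1 m 0 = v1"
    and a'a: "\<And>x. a' (a x) = x" and a': "\<And>x y. a' (x + y) = a' x + a' y"
    and dN: "d ^^ N = id" and d'N: "(\<lambda>x. d x - c (a' (b x))) ^^ N = id"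
  shows "killed (int N) (nat \<bar>n\<bar> + 1) (\<lambda>m. u1 m n) \<and> killed (int N) (nat \<bar>n\<bar> + 2) (\<lambda>m. u2 m n)"
proof -
  have next_u2: "killed (int N) (Suc j) (\<lambda>m. u2 m n)" if "killed (int N) j (\<lambda>m. u1 m n)" for j n
  proof (rule killed_recurrence[where A = d and g = "\<lambda>m. c (u1 m n)"])
    show "killed (int N) j (\<lambda>m. c (u1 m n))" using that c by (rule killed_additive)
    show "u2 (m + 1) n = d (u2 m n) + c (u1 m n)" for m using right[of m n] by (simp add: add.commute)
  qed (rule d dN)+
  have pos: "killed (int N) (n + 1) (\<lambda>m. u1 m (int n)) \<and> killed (int N) (n + 2) (\<lambda>m. u2 m (int n))" for n
  proof (induction n)
    case 0
    have "killed (int N) 1 (\<lambda>m. u1 m 0)" by (simp add: killed_def base delta_def)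
    then show ?case using next_u2[of 1 0] by (simp add: numeral_2_eq_2)
  next
    case (Suc n)
    have "killed (int N) (n + 2) (\<lambda>m. u1 m (int (Suc n)))"
      using killed_comb[OF killed_mono[of "int N" "n + 1" _ "n + 2"] _ a b, of "\<lambda>m. u1 m (int n)" "\<lambda>m. u2 m (int n)"]
        Suc up[of _ "int n"] by (simp add: add.commute)
    then show ?case using next_u2[of "n + 2" "int (Suc n)"] by simp
  qed
  have neg: "killed (int N) (n + 1) (\<lambda>m. u1 m (- int n)) \<and> killed (int N) (n + 2) (\<lambda>m. u2 m (- int n))" for n
  proof (induction n)
    case 0
    then show ?case using pos[of 0] by simp
  next
    case (Suc n)
    let ?r = "- int (Suc n)"
    have u1: "u1 m ?r = a' (u1 m (- int n)) + (- a' (b (u2 m ?r)))" for m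
    proof -
      have "u1 m (- int n) = a (u1 m ?r) + b (u2 m ?r)" using up[of m ?r] by simp
      then show ?thesis by (simp add: a' a'a)
    qed
    have k2: "killed (int N) (Suc (n + 1)) (\<lambda>m. u2 m ?r)"
    proof (rule killed_recurrence[where A = "\<lambda>x. d x - c (a' (b x))" and g = "\<lambda>m. c (a' (u1 m (- int n)))"])
      show "u2 (m + 1) ?r = d (u2 m ?r) - c (a' (b (u2 m ?r))) + c (a' (u1 m (- int n)))" for m
        unfolding right[of m ?r] u1[of m] by (simp add: c additive_diff[of c, OF c])
      have "killed (int N) (n + 1) (\<lambda>m. a' (u1 m (- int n)))"
        using conjunct1[OF Suc] a' by (rule killed_additive)
      then show "killed (int N) (n + 1) (\<lambda>m. c (a' (u1 m (- int n))))"
        using c by (rule killed_additive)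
      show "d (x + y) - c (a' (b (x + y))) = d x - c (a' (b x)) + (d y - c (a' (b y)))" for x y
        by (simp add: a' b c d)
    qed (rule d'N)
    have "killed (int N) (n + 2) (\<lambda>m. a' (u1 m (- int n)) + (- a' (b (u2 m ?r))))"
    proof (rule killed_comb[where A = a' and f = "\<lambda>m. u1 m (- int n)" and B = "\<lambda>x. - a' (b x)"])
      show "killed (int N) (n + 2) (\<lambda>m. u1 m (- int n))"
        using conjunct1[OF Suc] by (rule killed_mono) simp
      show "killed (int N) (n + 2) (\<lambda>m. u2 m ?r)"
        using k2 by (rule killed_mono) simp
    qed (simp_all add: a' b)
    then have "killed (int N) (n + 2) (\<lambda>m. u1 m ?r)"
      by (simp only: u1)
    then show ?case using killed_mono[OF k2, of "Suc n + 2"] by simp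
  qed
  show ?thesis using pos[of "nat n"] neg[of "nat (- n)"] by (cases "0 \<le> n") auto
qed

text \<open>With q = p^e the operator (1 - S^N)^q is 1 - S^(N q).\<close>

lemma killed_frobenius:
  fixes \<phi> :: "int \<Rightarrow> 'f::{field,finite}"
  assumes "killed (int N) (CHAR('f) ^ e) \<phi>"
  shows "\<phi> (m + int N * int CHAR('f) ^ e) = \<phi> m"
proof -
  define q where "q = CHAR('f) ^ e"
  define P :: "'f poly" where "P = 1 - monom 1 N"
  \<comment> \<open>The sequence is viewed as an array constant in the first index, on which F[x]
    acts.\<close>
  let ?\<phi> = "\<lambda>_ :: int. \<phi>"
  have act: "act_x.act (1 - monom 1 M) (\<lambda>_ :: int. f) = (\<lambda>_. delta (int M) f)" for M and f :: "int \<Rightarrow> 'f"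
  proof -
    have "act_x.act (1 - monom 1 M + monom 1 M) (\<lambda>_ :: int. f)
        = act_x.act (1 - monom 1 M) (\<lambda>_ :: int. f) + act_x.act (monom 1 M) (\<lambda>_ :: int. f)"
      by (rule act_x.act_add_left)
    then have "f n = act_x.act (1 - monom 1 M) (\<lambda>_ :: int. f) m n + f (n - int M)" for m n
      by (simp add: act_x.act_one act_x.act_monom shift_x_pow scale_array_def fun_eq_iff)
    then show ?thesis by (simp add: delta_def fun_eq_iff eq_diff_eq)
  qed
  have pow: "act_x.act (P ^ j) ?\<phi> = (\<lambda>_. (delta (int N) ^^ j) \<phi>)" for j
    by (induction j) (simp_all add: act_x.act_one act_x.act_mult act P_def)
  have char: "prime CHAR('f poly)" "q = CHAR('f poly) ^ e"
    using prime_CHAR_semidom[where ?'a = 'f] finite_imp_CHAR_pos[where ?'a = 'f] q_def by auto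
  have "(P + monom 1 N) ^ q = P ^ q + monom 1 N ^ q"
    by (rule freshmans_dream'[OF char])
  then have "P ^ q = 1 - monom 1 (N * q)"
    by (simp add: P_def monom_power algebra_simps)
  then have "(\<lambda>_ :: int. delta (int (N * q)) \<phi>) = (\<lambda>_. \<lambda>_. 0)"
    using pow[of q] assms act[of "N * q" \<phi>] by (simp add: killed_def q_def)
  then have "delta (int (N * q)) \<phi> x = 0" for x by metis
  from this[of "m + int N * int CHAR('f) ^ e"] show ?thesis by (simp add: delta_def q_def)
qed

lemma bij_finite_order:
  fixes f :: "'x \<Rightarrow> 'x"
  assumes "finite (UNIV :: 'x set)" "bij f"
  obtains N where "0 < N" "f ^^ N = id"
proof -
  have "finite (UNIV :: ('x \<Rightarrow> 'x) set)"
    using finite_PiE[of "UNIV :: 'x set" "\<lambda>_. UNIV :: 'x set"] assms(1) by (simp add: PiE_UNIV_domain)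
  then have "\<not> inj (\<lambda>n. f ^^ n)"
    by (meson finite_imageD finite_subset infinite_UNIV_nat subset_UNIV)
  then obtain i j where ij: "i < j" "f ^^ i = f ^^ j"
    unfolding inj_def by (metis linorder_neqE_nat)
  have "(f ^^ (j - i)) x = x" for x
  proof -
    have "inj (f ^^ i)" using assms(2) by (simp add: bij_is_inj inj_fn)
    moreover have "(f ^^ i) ((f ^^ (j - i)) x) = (f ^^ i) x"
      using ij by (metis comp_apply funpow_add le_add_diff_inverse less_imp_le)
    ultimately show ?thesis by (simp add: inj_eq)
  qed
  then show ?thesis using that[of "j - i"] ij by (simp add: fun_eq_iff)
qed

lemma funpow_id_mult: "f ^^ N = id \<Longrightarrow> f ^^ (N * M) = id"
  by (simp add: funpow_mult[symmetric])

section \<open>Coordinates\<close>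

definition coord :: "('f::field \<Rightarrow> 'v::ab_group_add \<Rightarrow> 'v) \<Rightarrow> 'v list \<Rightarrow> nat \<Rightarrow> 'v \<Rightarrow> 'f" where
  "coord sc bs i x = module.representation sc (set bs) x (bs ! i)"

locale coordinates = finite_dimensional_vector_space sc "set bs"
  for sc :: "'f::field \<Rightarrow> 'v::ab_group_add \<Rightarrow> 'v" and bs :: "'v list" +
  assumes distinct: "distinct bs"
begin

abbreviation "co \<equiv> coord sc bs"

lemma in_span: "x \<in> span (set bs)"
  by (simp add: span_Basis)

lemma coord_add: "co i (x + y) = co i x + co i y"
  by (simp add: coord_def representation_add[OF independent_Basis in_span in_span])

lemma coord_sum: "co i (\<Sum>j\<in>J. f j) = (\<Sum>j\<in>J. co i (f j))"
  by (simp add: coord_def representation_sum[OF independent_Basis in_span])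

lemma coord_scale: "co i (sc r x) = r * co i x"
  by (simp add: coord_def representation_scale[OF independent_Basis in_span])

lemma coord_zero: "co i 0 = 0"
  by (simp add: coord_def representation_zero)

lemma coord_basis: "i < length bs \<Longrightarrow> j < length bs \<Longrightarrow> co i (bs ! j) = (if i = j then 1 else 0)"
  using distinct by (simp add: coord_def representation_basis[OF independent_Basis] nth_eq_iff_index_eq)

lemma coord_expand: "(\<Sum>j<length bs. sc (co j x) (bs ! j)) = x"
proof -
  have "(\<Sum>j<length bs. sc (co j x) (bs ! j)) = (\<Sum>v\<in>set bs. sc (representation (set bs) x v) v)"
    unfolding coord_def
    by (rule sum.reindex_bij_betw[OF bij_betw_nth[OF distinct]]) simp_all
  then show ?thesis
    using sum_representation_eq[OF independent_Basis in_span finite_Basis order_refl] by simp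
qed

lemma coord_eqI:
  assumes "\<And>i. i < length bs \<Longrightarrow> co i x = co i y"
  shows "x = y"
proof -
  have "(\<Sum>j<length bs. sc (co j x) (bs ! j)) = (\<Sum>j<length bs. sc (co j y) (bs ! j))"
    using assms by (intro sum.cong) simp_all
  then show ?thesis by (simp only: coord_expand)
qed

lemma coord_exists: "\<exists>x. \<forall>i<length bs. co i x = f i"
proof (intro exI allI impI)
  fix i assume i: "i < length bs"
  have "co i (\<Sum>j<length bs. sc (f j) (bs ! j)) = (\<Sum>j<length bs. if i = j then f j else 0)"
    unfolding coord_sum coord_scale using i by (intro sum.cong) (auto simp: coord_basis)
  then show "co i (\<Sum>j<length bs. sc (f j) (bs ! j)) = f i"
    using i by simp
qed

lemma finite_space:
  assumes "finite (UNIV :: 'f set)"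
  shows "finite (UNIV :: 'v set)"
proof -
  have inj: "inj (\<lambda>x. \<lambda>i\<in>{..<length bs}. co i x)"
  proof (intro injI coord_eqI)
    fix x y i assume "(\<lambda>i\<in>{..<length bs}. co i x) = (\<lambda>i\<in>{..<length bs}. co i y)" and i: "i < length bs"
    from fun_cong[OF this(1), of i] i show "co i x = co i y" by simp
  qed
  have fin: "finite ({..<length bs} \<rightarrow>\<^sub>E (UNIV :: 'f set))"
    using assms by (intro finite_PiE) auto
  have "range (\<lambda>x. \<lambda>i\<in>{..<length bs}. co i x) \<subseteq> {..<length bs} \<rightarrow>\<^sub>E UNIV"
    by (intro image_subsetI restrict_PiE_iff[THEN iffD2]) simp
  then show ?thesis by (rule inj_on_finite[OF inj _ fin])
qed

end

lemma coord_linear: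
  fixes sc :: "'f::field \<Rightarrow> 'v::ab_group_add \<Rightarrow> 'v" and sc' :: "'f \<Rightarrow> 'w::ab_group_add \<Rightarrow> 'w"
  assumes "coordinates sc bs" "coordinates sc' cs" and f: "Vector_Spaces.linear sc sc' f" and i: "i < length cs"
  shows "coord sc' cs i (f x) = (\<Sum>j<length bs. matrix_of_map sc' bs cs f $$ (i, j) * coord sc bs j x)"
proof -
  interpret V: coordinates sc bs by fact
  interpret W: coordinates sc' cs by fact
  interpret f: Vector_Spaces.linear sc sc' f by fact
  have "f x = f (\<Sum>j<length bs. sc (coord sc bs j x) (bs ! j))" by (simp only: V.coord_expand)
  also have "\<dots> = (\<Sum>j<length bs. sc' (coord sc bs j x) (f (bs ! j)))"
    by (simp only: f.sum f.scale)
  finally have "coord sc' cs i (f x) = (\<Sum>j<length bs. coord sc bs j x * coord sc' cs i (f (bs ! j)))"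
    by (simp only: W.coord_sum W.coord_scale)
  also have "\<dots> = (\<Sum>j<length bs. matrix_of_map sc' bs cs f $$ (i, j) * coord sc bs j x)"
    using i by (intro sum.cong refl) (simp add: matrix_of_map_def coord_def mult.commute)
  finally show ?thesis .
qed

lemma sum_lessThan_add: "(\<Sum>j<m + n :: nat. f j) = (\<Sum>j<m. f j) + (\<Sum>j<n. f (m + j) :: 'a::comm_monoid_add)"
  by (induction n) (simp_all add: add.assoc)

section \<open>The square complex of the linear data and its colorings\<close>

locale linear_square =
  fixes scale1 :: "'f::{field,finite} \<Rightarrow> 'v1::ab_group_add \<Rightarrow> 'v1"
    and scale2 :: "'f \<Rightarrow> 'v2::ab_group_add \<Rightarrow> 'v2"
    and bs1 :: "'v1 list" and bs2 :: "'v2 list"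
    and a :: "'v1 \<Rightarrow> 'v1" and b :: "'v2 \<Rightarrow> 'v1" and c :: "'v1 \<Rightarrow> 'v2" and d :: "'v2 \<Rightarrow> 'v2"
  assumes V1: "coordinates scale1 bs1" and V2: "coordinates scale2 bs2"
    and lin_a: "Vector_Spaces.linear scale1 scale1 a" and lin_b: "Vector_Spaces.linear scale2 scale1 b"
    and lin_c: "Vector_Spaces.linear scale1 scale2 c" and lin_d: "Vector_Spaces.linear scale2 scale2 d"
    and bij_a: "bij a" and bij_d: "bij d" and bij_abcd: "bij (\<lambda>(v1, v2). (a v1 + b v2, c v1 + d v2))"
begin

sublocale V1: coordinates scale1 bs1 by (rule V1)
sublocale V2: coordinates scale2 bs2 by (rule V2)
sublocale a: Vector_Spaces.linear scale1 scale1 a by (rule lin_a)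
sublocale b: Vector_Spaces.linear scale2 scale1 b by (rule lin_b)
sublocale c: Vector_Spaces.linear scale1 scale2 c by (rule lin_c)
sublocale d: Vector_Spaces.linear scale2 scale2 d by (rule lin_d)

lemma finite_V1: "finite (UNIV :: 'v1 set)" and finite_V2: "finite (UNIV :: 'v2 set)"
  by (rule V1.finite_space V2.finite_space; simp)+

text \<open>Reflection in the diagonal; it reduces statements about columns to statements about
  rows.\<close>

lemma swapped: "linear_square scale2 scale1 bs2 bs1 d c b a"
proof
  have "(\<lambda>(v2, v1). (d v2 + c v1, b v2 + a v1)) = prod.swap \<circ> (\<lambda>(v1, v2). (a v1 + b v2, c v1 + d v2)) \<circ> prod.swap"
    by (auto simp: add.commute)
  moreover have "bij (prod.swap \<circ> (\<lambda>(v1, v2). (a v1 + b v2, c v1 + d v2)) \<circ> prod.swap)"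
    by (intro bij_comp bij_swap bij_abcd)
  ultimately show "bij (\<lambda>(v2, v1). (d v2 + c v1, b v2 + a v1))" by simp
qed (rule bij_a bij_d)+

sublocale square_complex "\<lambda>v w. a v + b w" "\<lambda>v w. c v + d w"
proof
  show "bij (\<lambda>v. a v + b w)" for w
    using bij_comp[OF bij_a bij_plus_right[of "b w"]] by (simp add: comp_def)
  show "bij (\<lambda>w. c v + d w)" for v
    using bij_comp[OF bij_d bij_plus[of "c v"]] by (simp add: comp_def)
qed (rule bij_abcd)

text \<open>The labels \<open>u1 m n\<close> and \<open>u2 m n\<close> are those of the bottom and
  the left edge of the square at (m, n).\<close>

definition is_coloring :: "'v1 \<Rightarrow> 'v2 \<Rightarrow> (int \<Rightarrow> int \<Rightarrow> 'v1) \<Rightarrow> (int \<Rightarrow> int \<Rightarrow> 'v2) \<Rightarrow> bool" where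
  "is_coloring v1 v2 u1 u2 \<longleftrightarrow>
     (\<forall>m n. u1 m (n + 1) = a (u1 m n) + b (u2 m n) \<and> u2 (m + 1) n = c (u1 m n) + d (u2 m n)) \<and>
     (\<forall>m. u1 m 0 = v1) \<and> (\<forall>n. u2 0 n = v2)"

text \<open>If x and y have the same image, then (-a^(-1) b x, x) and (-a^(-1) b y, y) have the same
  image under the block matrix. Surjectivity follows by finiteness.\<close>

lemma schur_bij: "bij (\<lambda>x. d x - c (inv_into UNIV a (b x)))"
proof -
  let ?a' = "inv_into UNIV a" let ?f = "\<lambda>x. d x - c (?a' (b x))"
  have aa': "a (?a' x) = x" for x using bij_a by (simp add: bij_is_surj surj_f_inv_f)
  have "inj ?f"
  proof
    fix x y assume "?f x = ?f y"
    then have "(\<lambda>(v1, v2). (a v1 + b v2, c v1 + d v2)) (- ?a' (b x), x)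
        = (\<lambda>(v1, v2). (a v1 + b v2, c v1 + d v2)) (- ?a' (b y), y)"
      by (simp add: a.neg c.neg aa')
    from injD[OF bij_is_inj[OF bij_abcd] this] show "x = y" by simp
  qed
  then show ?thesis by (simp add: bij_def finite_UNIV_inj_surj finite_V2)
qed

lemma row_order: obtains N where "0 < N" "d ^^ N = id" "(\<lambda>x. d x - c (inv_into UNIV a (b x))) ^^ N = id"
proof -
  obtain N1 where N1: "0 < N1" "d ^^ N1 = id" using bij_finite_order[OF finite_V2 bij_d] by blast
  obtain N2 where N2: "0 < N2" "(\<lambda>x. d x - c (inv_into UNIV a (b x))) ^^ N2 = id"
    using bij_finite_order[OF finite_V2 schur_bij] by blast
  show ?thesis
    using that[of "N1 * N2"] N1 N2 funpow_id_mult[OF N1(2)] funpow_id_mult[OF N2(2)]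
    by (simp add: mult.commute)
qed

lemma row_killed_coloring:
  assumes col: "is_coloring v1 v2 u1 u2"
    and "d ^^ N = id" "(\<lambda>x. d x - c (inv_into UNIV a (b x))) ^^ N = id"
  shows "killed (int N) (nat \<bar>n\<bar> + 2) (\<lambda>m. u1 m n) \<and> killed (int N) (nat \<bar>n\<bar> + 2) (\<lambda>m. u2 m n)"
proof -
  have a'a: "inv_into UNIV a (a x) = x" for x using bij_a by (simp add: bij_is_inj)
  have a': "inv_into UNIV a (x + y) = inv_into UNIV a x + inv_into UNIV a y" for x y
  proof -
    have "a (inv_into UNIV a z) = z" for z using bij_a by (simp add: bij_is_surj surj_f_inv_f)
    then have "a (inv_into UNIV a x + inv_into UNIV a y) = x + y" by (simp add: a.add)
    then show ?thesis using a'a by metis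
  qed
  have "killed (int N) (nat \<bar>n\<bar> + 1) (\<lambda>m. u1 m n) \<and> killed (int N) (nat \<bar>n\<bar> + 2) (\<lambda>m. u2 m n)"
    by (rule row_killed[where a = a and b = b and c = c and d = d and a' = "inv_into UNIV a"])
      (use col in \<open>simp_all add: is_coloring_def a.add b.add c.add d.add a'a a' assms(2,3)\<close>)
  then show ?thesis using killed_mono[of "int N" "nat \<bar>n\<bar> + 1" "\<lambda>m. u1 m n" "nat \<bar>n\<bar> + 2"] by simp
qed

end

section \<open>Colorings in coordinates\<close>

context linear_square
begin

abbreviation "k1 \<equiv> length bs1"
abbreviation "k \<equiv> length bs1 + length bs2"

definition pair_coord :: "nat \<Rightarrow> 'v1 \<times> 'v2 \<Rightarrow> 'f" where
  "pair_coord i x = (if i < k1 then coord scale1 bs1 i (fst x) else coord scale2 bs2 (i - k1) (snd x))"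

abbreviation "A \<equiv> matrix_of_map scale1 bs1 bs1 a"
abbreviation "B \<equiv> matrix_of_map scale1 bs2 bs1 b"
abbreviation "C \<equiv> matrix_of_map scale2 bs1 bs2 c"
abbreviation "D \<equiv> matrix_of_map scale2 bs2 bs2 d"

definition E :: "nat \<Rightarrow> nat \<Rightarrow> 'f" where
  "E i j = (if i < k1 then if j < k1 then A $$ (i, j) else B $$ (i, j - k1)
     else if j < k1 then C $$ (i - k1, j) else D $$ (i - k1, j - k1))"

lemma pair_coord_map:
  assumes "i < k"
  shows "pair_coord i (a v + b w, c v + d w) = (\<Sum>j<k. E i j * pair_coord j (v, w))"
proof (cases "i < k1")
  case True
  then show ?thesis
    using coord_linear[OF V1 V1 lin_a True] coord_linear[OF V2 V1 lin_b True]
    by (simp add: pair_coord_def E_def sum_lessThan_add V1.coord_add)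
next
  case False
  then have i: "i - k1 < length bs2" using assms by simp
  show ?thesis
    using False coord_linear[OF V1 V2 lin_c i] coord_linear[OF V2 V2 lin_d i]
    by (simp add: pair_coord_def E_def sum_lessThan_add V2.coord_add)
qed

lemma fst_eq_0: "(\<And>i. i < k1 \<Longrightarrow> pair_coord i x = 0) \<Longrightarrow> fst x = 0"
  by (rule V1.coord_eqI) (simp add: pair_coord_def V1.coord_zero)

lemma snd_eq_0:
  assumes "\<And>i. k1 \<le> i \<Longrightarrow> i < k \<Longrightarrow> pair_coord i x = 0"
  shows "snd x = 0"
proof (rule V2.coord_eqI)
  fix i assume "i < length bs2"
  then show "coord scale2 bs2 i (snd x) = coord scale2 bs2 i 0"
    using assms[of "k1 + i"] by (simp add: pair_coord_def V2.coord_zero)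
qed

lemma pair_coord_eqI:
  assumes "\<And>i. i < k \<Longrightarrow> pair_coord i x = pair_coord i y"
  shows "x = y"
proof (rule prod_eqI)
  show "fst x = fst y"
  proof (rule V1.coord_eqI)
    fix i assume "i < k1"
    then show "coord scale1 bs1 i (fst x) = coord scale1 bs1 i (fst y)"
      using assms[of i] by (simp add: pair_coord_def)
  qed
  show "snd x = snd y"
  proof (rule V2.coord_eqI)
    fix i assume "i < length bs2"
    then show "coord scale2 bs2 i (snd x) = coord scale2 bs2 i (snd y)"
      using assms[of "k1 + i"] by (simp add: pair_coord_def)
  qed
qed

lemma pair_coord_exists: "\<exists>x. \<forall>i<k. pair_coord i x = f i"
proof -
  obtain v where v: "\<And>i. i < k1 \<Longrightarrow> coord scale1 bs1 i v = f i"
    using V1.coord_exists[of f] by blast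
  obtain w where w: "\<And>i. i < length bs2 \<Longrightarrow> coord scale2 bs2 i w = f (k1 + i)"
    using V2.coord_exists[of "\<lambda>i. f (k1 + i)"] by blast
  have "pair_coord i (v, w) = f i" if "i < k" for i
    using that v[of i] w[of "i - k1"] by (cases "i < k1") (simp_all add: pair_coord_def)
  then show ?thesis by blast
qed

text \<open>A kernel vector consists of the coordinates of a pair x with image y under the block
  matrix. The signs decide whether the first half of x or of y vanishes, and likewise for the second
  half; the four cases are the injectivity of the identity, a, d and the block matrix.\<close>

lemma nonsingular:
  "det (mat k k (\<lambda>(i, j). if (if i < k1 then \<tau> else \<sigma>) then (if i = j then 1 else 0) else - E i j)) \<noteq> 0"
    (is "det ?M \<noteq> 0")
proof
  assume "det ?M = 0"
  then obtain v where v: "v \<in> carrier_vec k" "v \<noteq> 0\<^sub>v k" "?M *\<^sub>v v = 0\<^sub>v k"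
    using det_0_iff_vec_prod_zero_field[of ?M k] by auto
  obtain x where x: "\<And>i. i < k \<Longrightarrow> pair_coord i x = v $ i" using pair_coord_exists[of "\<lambda>i. v $ i"] by blast
  define y where "y = (a (fst x) + b (snd x), c (fst x) + d (snd x))"
  have row: "pair_coord i (if (if i < k1 then \<tau> else \<sigma>) then x else y) = 0" if i: "i < k" for i
  proof -
    have "(?M *\<^sub>v v) $ i = (\<Sum>j<k. ?M $$ (i, j) * v $ j)"
      using i v(1) by (simp add: scalar_prod_def atLeast0LessThan)
    also have "\<dots> = (\<Sum>j<k. (if (if i < k1 then \<tau> else \<sigma>) then (if i = j then 1 else 0) else - E i j) * pair_coord j x)"
      using i by (intro sum.cong) (simp_all add: x)
    also have "\<dots> = (if (if i < k1 then \<tau> else \<sigma>) then pair_coord i x else - pair_coord i y)"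
    proof -
      obtain e where e: "(if i < k1 then \<tau> else \<sigma>) = e" by simp
      have "(\<Sum>j<k. (if i = j then 1 else 0) * pair_coord j x) = pair_coord i x"
        using i by (simp add: if_distrib[of "\<lambda>z. z * _"] cong: if_cong)
      moreover have "(\<Sum>j<k. - E i j * pair_coord j x) = - pair_coord i y"
        using pair_coord_map[OF i, of "fst x" "snd x"] by (simp add: y_def sum_negf)
      ultimately show ?thesis unfolding e by (cases e) simp_all
    qed
    finally show ?thesis using v(3) i by (auto split: if_splits)
  qed
  have first: "fst (if \<tau> then x else y) = 0"
  proof (rule fst_eq_0)
    fix i assume "i < k1"
    then show "pair_coord i (if \<tau> then x else y) = 0" using row[of i] by simp
  qed
  have second: "snd (if \<sigma> then x else y) = 0"
  proof (rule snd_eq_0)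
    fix i assume "k1 \<le> i" "i < k"
    then show "pair_coord i (if \<sigma> then x else y) = 0" using row[of i] by simp
  qed
  have "x = 0"
  proof (cases \<sigma>)
    case True
    then have s: "snd x = 0" using second by simp
    have "fst x = 0"
    proof (cases \<tau>)
      case False
      then have "a (fst x) = a 0" using first s by (simp add: y_def b.zero a.zero)
      then show ?thesis by (rule injD[OF bij_is_inj[OF bij_a]])
    qed (use first in simp)
    then show ?thesis using s by (simp add: prod_eq_iff)
  next
    case False
    then have s: "c (fst x) + d (snd x) = 0" using second by (simp add: y_def)
    show ?thesis
    proof (cases \<tau>)
      case True
      then have f: "fst x = 0" using first by simp
      then have "d (snd x) = d 0" using s by (simp add: c.zero d.zero)
      then have "snd x = 0" by (rule injD[OF bij_is_inj[OF bij_d]])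
      then show ?thesis using f by (simp add: prod_eq_iff)
    next
      case False
      then have "(\<lambda>(v1, v2). (a v1 + b v2, c v1 + d v2)) x = (\<lambda>(v1, v2). (a v1 + b v2, c v1 + d v2)) 0"
        using first s by (simp add: y_def case_prod_unfold a.zero b.zero c.zero d.zero)
      then show ?thesis using bij_is_inj[OF bij_abcd] by (simp only: inj_eq)
    qed
  qed
  then have "pair_coord i x = 0" if "i < k" for i
    by (simp add: pair_coord_def V1.coord_zero V2.coord_zero)
  then have "v = 0\<^sub>v k" using v(1) x by (intro eq_vecI) auto
  with v(2) show False ..
qed

lemma coord_killed_period:
  assumes "killed (int N) (nat \<bar>m\<bar> + 2) u1" "killed (int N) (nat \<bar>m\<bar> + 2) u2"
    and e: "\<bar>m\<bar> + 2 \<le> int CHAR('f) ^ e"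
  shows "pair_coord i (u1 (n + int N * int CHAR('f) ^ e), u2 (n + int N * int CHAR('f) ^ e))
    = pair_coord i (u1 n, u2 n)"
proof -
  have "int (nat \<bar>m\<bar> + 2) \<le> int (CHAR('f) ^ e)" using e by simp
  then have le: "nat \<bar>m\<bar> + 2 \<le> CHAR('f) ^ e" by (simp only: of_nat_le_iff)
  show ?thesis
  proof (cases "i < k1")
    case True
    have "killed (int N) (CHAR('f) ^ e) (\<lambda>x. coord scale1 bs1 i (u1 x))"
      by (rule killed_additive[OF killed_mono[OF assms(1) le]]) (rule V1.coord_add)
    from killed_frobenius[OF this, of n] show ?thesis using True by (simp add: pair_coord_def)
  next
    case False
    have "killed (int N) (CHAR('f) ^ e) (\<lambda>x. coord scale2 bs2 (i - k1) (u2 x))"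
      by (rule killed_additive[OF killed_mono[OF assms(2) le]]) (rule V2.coord_add)
    from killed_frobenius[OF this, of n] show ?thesis using False by (simp add: pair_coord_def)
  qed
qed

text \<open>Row periods come from \<open>row_killed_coloring\<close>, and column periods from the
  same lemma for the swapped data with m and n interchanged. N is a common multiple of the orders of
  the four maps involved.\<close>

lemma coloring_arrays:
  assumes col: "is_coloring v1 v2 u1 u2"
  shows "\<exists>N. linear_arrays k k1 E (\<lambda>i m n. pair_coord i (u1 m n, u2 m n)) N"
proof -
  interpret S: linear_square scale2 scale1 bs2 bs1 d c b a by (rule swapped)
  have colS: "S.is_coloring v2 v1 (\<lambda>m n. u2 n m) (\<lambda>m n. u1 n m)"
    using col by (simp add: is_coloring_def S.is_coloring_def add.commute)
  obtain N1 where N1: "0 < N1" "d ^^ N1 = id" "(\<lambda>x. d x - c (inv_into UNIV a (b x))) ^^ N1 = id"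
    using row_order by blast
  obtain N2 where N2: "0 < N2" "a ^^ N2 = id" "(\<lambda>x. a x - b (inv_into UNIV d (c x))) ^^ N2 = id"
    using S.row_order by blast
  define N where "N = N1 * N2"
  have N: "d ^^ N = id" "(\<lambda>x. d x - c (inv_into UNIV a (b x))) ^^ N = id"
    "a ^^ N = id" "(\<lambda>x. a x - b (inv_into UNIV d (c x))) ^^ N = id"
    unfolding N_def using N1(2,3) N2(2,3)
    by (simp_all only: funpow_id_mult mult.commute[of N1 N2]) (simp_all only: funpow_id_mult mult.commute[of N2 N1])
  have "linear_arrays k k1 E (\<lambda>i m n. pair_coord i (u1 m n, u2 m n)) N"
  proof
    fix i m n assume i: "i < k"
    show "pair_coord i (u1 m (n + 1), u2 m (n + 1)) = (\<Sum>j<k. E i j * pair_coord j (u1 m n, u2 m n))" if "i < k1"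
      using that col pair_coord_map[OF i, of "u1 m n" "u2 m n"] by (simp add: is_coloring_def pair_coord_def)
    show "pair_coord i (u1 (m + 1) n, u2 (m + 1) n) = (\<Sum>j<k. E i j * pair_coord j (u1 m n, u2 m n))" if "\<not> i < k1"
      using that col pair_coord_map[OF i, of "u1 m n" "u2 m n"] by (simp add: is_coloring_def pair_coord_def)
    fix e
    show "pair_coord i (u1 m (n + int N * int CHAR('f) ^ e), u2 m (n + int N * int CHAR('f) ^ e)) =
      pair_coord i (u1 m n, u2 m n)" if "\<bar>m\<bar> + 2 \<le> int CHAR('f) ^ e"
      using S.row_killed_coloring[OF colS N(3,4), of m] that
      by (intro coord_killed_period[where m = m]) auto
    show "pair_coord i (u1 (m + int N * int CHAR('f) ^ e) n, u2 (m + int N * int CHAR('f) ^ e) n) =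
      pair_coord i (u1 m n, u2 m n)" if "\<bar>n\<bar> + 2 \<le> int CHAR('f) ^ e"
      using row_killed_coloring[OF col N(1,2), of n] that
      by (intro coord_killed_period[where m = n and ?u1.0 = "\<lambda>m. u1 m n" and ?u2.0 = "\<lambda>m. u2 m n"]) auto
  next
    show "0 < N" using N1(1) N2(1) by (simp add: N_def)
  qed (rule nonsingular)
  then show ?thesis by blast
qed

text \<open>A kernel element is determined by its coordinate arrays, and each of these lies in the
  finite kernel of that coordinate.\<close>

lemma finite_coloring_kernel:
  assumes col: "is_coloring v1 v2 u1 u2"
  shows "finite (\<Union>e. kernel_level CHAR('f) (\<lambda>(m, n). (u1 m n, u2 m n)) e)"
proof -
  let ?p = "CHAR('f)"
  let ?T = "\<lambda>(m, n). (u1 m n, u2 m n)"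
  obtain N where "linear_arrays k k1 E (\<lambda>i m n. pair_coord i (u1 m n, u2 m n)) N"
    using coloring_arrays[OF col] by blast
  then interpret L: linear_arrays k k1 E "\<lambda>i m n. pair_coord i (u1 m n, u2 m n)" N .
  define F where "F i = (\<Union>e. kernel_level ?p (\<lambda>(m, n). pair_coord i (u1 m n, u2 m n)) e)" for i
  have finF: "finite (F i)" if "i < k" for i
    unfolding F_def using L.finite_kernel[OF that] .
  define co where "co \<kappa> = (\<lambda>i\<in>{..<k}. \<lambda>z. pair_coord i (\<kappa> z))" for \<kappa> :: "int \<times> int \<Rightarrow> 'v1 \<times> 'v2"
  have "inj co"
  proof
    fix \<kappa> \<kappa>' assume "co \<kappa> = co \<kappa>'"
    then have "pair_coord i (\<kappa> z) = pair_coord i (\<kappa>' z)" if "i < k" for i z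
      using that unfolding co_def by (metis (mono_tags, lifting) lessThan_iff restrict_apply')
    then show "\<kappa> = \<kappa>'" by (intro ext pair_coord_eqI)
  qed
  moreover have "co \<kappa> \<in> Pi\<^sub>E {..<k} F" if "\<kappa> \<in> (\<Union>e. kernel_level ?p ?T e)" for \<kappa>
  proof -
    obtain e \<beta> where e: "\<beta> \<in> block_index (?p ^ e)" "\<kappa> = decimate (?p ^ e) \<beta> ?T"
      using \<open>\<kappa> \<in> _\<close> by (auto simp: kernel_level_def)
    have "(\<lambda>z. pair_coord i (\<kappa> z)) = decimate (?p ^ e) \<beta> (\<lambda>(m, n). pair_coord i (u1 m n, u2 m n))" for i
      by (simp add: e(2) decimate_def fun_eq_iff case_prod_unfold)
    then have "(\<lambda>z. pair_coord i (\<kappa> z)) \<in> F i" for i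
      using e(1) unfolding F_def kernel_level_def by blast
    then show ?thesis by (simp add: co_def restrict_PiE_iff)
  qed
  moreover have "finite (Pi\<^sub>E {..<k} F)" using finF by (intro finite_PiE) auto
  ultimately show ?thesis
    by (intro inj_on_finite[of co _ "Pi\<^sub>E {..<k} F"]) (auto intro: inj_on_subset)
qed

end

section \<open>Divisors of products of polynomials in separate variables\<close>

abbreviation lift_y :: "'f::field poly \<Rightarrow> 'f poly poly" where
  "lift_y \<equiv> map_poly (\<lambda>c. [:c:])"

text \<open>A product f(x) g(y): as y is the outer indeterminate of F[x][y], a polynomial in x alone
  is a constant \<open>[:f:]\<close>, and one in y alone has constant coefficients.\<close>

definition separated :: "'f::field poly poly \<Rightarrow> bool" where
  "separated P \<longleftrightarrow> (\<exists>f g. P = [:f:] * lift_y g)"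

lemma lift_y_mult: "lift_y (g * h) = lift_y g * lift_y h"
proof -
  interpret c: comm_ring_hom "\<lambda>c :: 'a. [:c:]" by unfold_locales auto
  interpret map_poly_comm_ring_hom "\<lambda>c :: 'a. [:c:]" ..
  show ?thesis by (rule hom_mult)
qed

lemma lift_y_add: "lift_y (g + h) = lift_y g + lift_y h"
  by (rule poly_eqI) (simp add: coeff_map_poly)

lemma lift_y_one [simp]: "lift_y 1 = 1"
  by (rule poly_eqI) (simp add: coeff_map_poly one_pCons coeff_pCons split: nat.splits)

lemma separated_mult: "separated P \<Longrightarrow> separated Q \<Longrightarrow> separated (P * Q)"
  unfolding separated_def
proof (elim exE)
  fix f g f' g' assume "P = [:f:] * lift_y g" "Q = [:f':] * lift_y g'"
  then have "P * Q = [:f * f':] * lift_y (g * g')"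
    by (simp add: lift_y_mult algebra_simps)
  then show "\<exists>f g. P * Q = [:f:] * lift_y g" by blast
qed

lemma separated_const: "separated [:f:]"
  unfolding separated_def by (intro exI[of _ f] exI[of _ 1]) simp

lemma separated_lift_y: "separated (lift_y g)"
  unfolding separated_def by (intro exI[of _ 1] exI[of _ g]) simp

lemma lift_y_of_degree_0:
  assumes "\<And>j. degree (coeff P j) = 0"
  shows "P = lift_y (map_poly (\<lambda>c. coeff c 0) P)"
proof (rule poly_eqI)
  fix j
  show "coeff P j = coeff (lift_y (map_poly (\<lambda>c. coeff c 0) P)) j"
  proof -
    obtain e where "coeff P j = [:e:]" by (rule degree_eq_zeroE[OF assms[of j]])
    then show ?thesis by (simp add: coeff_map_poly)
  qed
qed

lemma coeff_mult_bound:
  fixes p q :: "'a::idom poly"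
  assumes "degree p \<le> m" "degree q \<le> n"
  shows "coeff (p * q) (m + n) = coeff p m * coeff q n"
proof -
  have "coeff p i * coeff q (m + n - i) = 0" if "i \<noteq> m" "i \<le> m + n" for i
    using that assms by (cases "i < m") (auto simp: coeff_eq_0)
  then have "(\<Sum>i\<le>m + n. coeff p i * coeff q (m + n - i)) = (\<Sum>i\<in>{m}. coeff p i * coeff q (m + n - i))"
    by (intro sum.mono_neutral_right) auto
  then show ?thesis by (simp add: coeff_mult)
qed

text \<open>The degree in \<open>x\<close> is additive.\<close>

lemma inner_degree_0_of_mult:
  fixes P Q :: "'f::field poly poly"
  assumes PQ: "\<And>j. degree (coeff (P * Q) j) = 0" and P: "P \<noteq> 0" and Q: "Q \<noteq> 0"
  shows "degree (coeff P j) = 0"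
proof -
  \<comment> \<open>The highest power n of x, and the highest power j0 of y occurring with it: in
    the product of two polynomials, the coefficient at the sums of these exponents is a single
    non-zero product.\<close>
  have ex: "\<exists>n j0. coeff (coeff R j0) n \<noteq> 0 \<and> (\<forall>j. degree (coeff R j) \<le> n) \<and>
      (\<forall>j>j0. coeff (coeff R j) n = 0)" if R: "R \<noteq> 0" for R :: "'f poly poly"
  proof -
    define n where "n = Max ((\<lambda>j. degree (coeff R j)) ` {..degree R})"
    have le: "degree (coeff R j) \<le> n" for j
    proof (cases "j \<le> degree R")
      case True
      then show ?thesis unfolding n_def by (intro Max_ge) auto
    qed (simp add: coeff_eq_0)
    have "n \<in> (\<lambda>j. degree (coeff R j)) ` {..degree R}" unfolding n_def by (intro Max_in) auto
    then obtain i where i: "degree (coeff R i) = n" by auto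
    define J where "J = {j. coeff (coeff R j) n \<noteq> 0}"
    have "j \<le> degree R" if "j \<in> J" for j
    proof (rule le_degree)
      show "coeff R j \<noteq> 0" using that by (auto simp: J_def)
    qed
    then have "J \<subseteq> {..degree R}" by auto
    then have finJ: "finite J" by (rule finite_subset) simp
    have "J \<noteq> {}"
    proof (cases "n = 0")
      case True
      have "degree (lead_coeff R) = 0" using le[of "degree R"] True by simp
      then have "coeff (lead_coeff R) 0 \<noteq> 0" using R by (metis leading_coeff_0_iff)
      then show ?thesis using True unfolding J_def by blast
    next
      case False
      then have "coeff (coeff R i) n \<noteq> 0" using i by (metis degree_0 leading_coeff_0_iff)
      then show ?thesis unfolding J_def by blast
    qed
    then have "Max J \<in> J" using finJ by (rule Max_in[rotated])
    moreover have "coeff (coeff R j) n = 0" if "j > Max J" for j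
    proof (rule ccontr)
      assume "coeff (coeff R j) n \<noteq> 0"
      then have "j \<le> Max J" using finJ by (intro Max_ge) (auto simp: J_def)
      then show False using that by simp
    qed
    ultimately show ?thesis using le unfolding J_def by blast
  qed
  obtain n j0 where n: "coeff (coeff P j0) n \<noteq> 0" "\<And>j. degree (coeff P j) \<le> n"
    "\<And>j. j > j0 \<Longrightarrow> coeff (coeff P j) n = 0" using ex[OF P] by blast
  obtain m i0 where m: "coeff (coeff Q i0) m \<noteq> 0" "\<And>j. degree (coeff Q j) \<le> m"
    "\<And>j. j > i0 \<Longrightarrow> coeff (coeff Q j) m = 0" using ex[OF Q] by blast
  have "coeff (coeff (P * Q) (j0 + i0)) (n + m)
      = (\<Sum>i\<le>j0 + i0. coeff (coeff P i) n * coeff (coeff Q (j0 + i0 - i)) m)"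
    unfolding coeff_mult[of P Q] coeff_sum coeff_mult_bound[OF n(2) m(2)] ..
  also have "\<dots> = (\<Sum>i\<in>{j0}. coeff (coeff P i) n * coeff (coeff Q (j0 + i0 - i)) m)"
  proof (rule sum.mono_neutral_right)
    show "\<forall>i\<in>{..j0 + i0} - {j0}. coeff (coeff P i) n * coeff (coeff Q (j0 + i0 - i)) m = 0"
    proof
      fix i assume "i \<in> {..j0 + i0} - {j0}"
      then have "i > j0 \<or> j0 + i0 - i > i0" by auto
      then show "coeff (coeff P i) n * coeff (coeff Q (j0 + i0 - i)) m = 0" using n(3) m(3) by auto
    qed
  qed auto
  also have "\<dots> \<noteq> 0" using n(1) m(1) by simp
  finally have "n + m \<le> degree (coeff (P * Q) (j0 + i0))" by (rule le_degree)
  then show ?thesis using PQ[of "j0 + i0"] n(2)[of j] by simp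
qed

text \<open>A divisor of least positive degree is irreducible.\<close>

lemma prime_factor_exists:
  fixes f :: "'f::field poly"
  assumes "degree f \<noteq> 0"
  obtains \<pi> where "prime_elem \<pi>" "\<pi> dvd f" "degree \<pi> \<noteq> 0"
proof -
  define X where "X = {q. q dvd f \<and> degree q \<noteq> 0}"
  have "f \<in> X" using assms by (simp add: X_def)
  then obtain q where q: "q \<in> X" "\<And>r. r \<in> X \<Longrightarrow> degree q \<le> degree r"
    using ex_has_least_nat[of "\<lambda>q. q \<in> X" f degree] by auto
  have q0: "q \<noteq> 0" using q(1) by (auto simp: X_def)
  have "irreducible q"
  proof (rule irreducibleI)
    show "\<not> q dvd 1" using q(1) q0 by (simp add: X_def is_unit_iff_degree)
    fix r s assume rs: "q = r * s"
    then have nz: "r \<noteq> 0" "s \<noteq> 0" using q0 by auto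
    then have deg: "degree q = degree r + degree s" by (simp add: rs degree_mult_eq)
    have "r dvd f" using q(1) rs dvd_mult_left by (auto simp: X_def)
    then have "degree r = 0 \<or> degree s = 0" using q(2)[of r] deg
      by (cases "degree r = 0"; cases "degree s = 0") (auto simp: X_def)
    then show "r dvd 1 \<or> s dvd 1" using nz by (simp add: is_unit_iff_degree)
  qed (rule q0)
  then have "prime_elem q" by (rule field_poly_irreducible_imp_prime)
  then show ?thesis using that q(1) by (auto simp: X_def)
qed

text \<open>A prime factor of f stays prime in F[x][y], so it divides P or Q and can be removed,
  which lowers the degree of f. Once f is constant, the product does not involve x, and neither does
  P because degrees in x add up.\<close>

lemma separated_of_mult:
  fixes P Q :: "'f::field poly poly"
  assumes "P * Q = [:f:] * lift_y g" "f \<noteq> 0" "g \<noteq> 0"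
  shows "separated P"
  using assms(1,2)
proof (induction "degree f" arbitrary: f P Q rule: less_induct)
  case less
  have nz: "[:f:] * lift_y g \<noteq> 0"
  proof -
    have "coeff (lift_y g) (degree g) \<noteq> 0" using assms(3) by (simp add: coeff_map_poly)
    then have "lift_y g \<noteq> 0" by auto
    then show ?thesis using less.prems by simp
  qed
  then have PQ0: "P \<noteq> 0" "Q \<noteq> 0" using less.prems by auto
  show ?case
  proof (cases "degree f = 0")
    case True
    then obtain e where e: "f = [:e:]" by (rule degree_eq_zeroE)
    have "degree (coeff (P * Q) j) = 0" for j
      unfolding less.prems e by (simp add: coeff_map_poly)
    then have "P = lift_y (map_poly (\<lambda>c. coeff c 0) P)"
      by (intro lift_y_of_degree_0 inner_degree_0_of_mult[OF _ PQ0])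
    then show ?thesis using separated_lift_y by metis
  next
    case False
    then obtain \<pi> where \<pi>: "prime_elem \<pi>" "\<pi> dvd f" "degree \<pi> \<noteq> 0" by (rule prime_factor_exists)
    obtain f1 where f1: "f = \<pi> * f1" using \<pi>(2) by (rule dvdE)
    have f10: "f1 \<noteq> 0" "\<pi> \<noteq> 0" using less.prems f1 by auto
    have lt: "degree f1 < degree f" using \<pi>(3) f10 by (simp add: f1 degree_mult_eq)
    have prime: "prime_elem [:\<pi>:]" using \<pi>(1) by (rule lift_prime_elem_poly)
    have PQ: "P * Q = [:\<pi>:] * ([:f1:] * lift_y g)" by (simp add: less.prems f1 mult.commute)
    then have "[:\<pi>:] dvd P * Q" by (simp only: dvd_triv_left)
    then have "[:\<pi>:] dvd P \<or> [:\<pi>:] dvd Q" by (rule prime_elem_dvd_multD[OF prime])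
    then show ?thesis
    proof
      assume "[:\<pi>:] dvd P"
      then obtain P1 where P1: "P = [:\<pi>:] * P1" by (rule dvdE)
      have "[:\<pi>:] * (P1 * Q) = [:\<pi>:] * ([:f1:] * lift_y g)" using PQ by (simp only: P1 mult.assoc)
      then have "P1 * Q = [:f1:] * lift_y g" using f10 by (subst (asm) mult_left_cancel) simp_all
      then have "separated P1" by (rule less.hyps[OF lt _ f10(1)])
      then show ?thesis unfolding P1 by (intro separated_mult separated_const)
    next
      assume "[:\<pi>:] dvd Q"
      then obtain Q1 where Q1: "Q = [:\<pi>:] * Q1" by (rule dvdE)
      have "[:\<pi>:] * (P * Q1) = [:\<pi>:] * ([:f1:] * lift_y g)" using PQ by (simp only: Q1 mult.left_commute)
      then have "P * Q1 = [:f1:] * lift_y g" using f10 by (subst (asm) mult_left_cancel) simp_all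
      then show ?thesis by (rule less.hyps[OF lt _ f10(1)])
    qed
  qed
qed

lemma separated_dvd:
  assumes "P dvd R" "separated R" "R \<noteq> 0"
  shows "separated P"
proof -
  obtain Q where Q: "R = P * Q" using assms(1) by (rule dvdE)
  obtain f g where R: "R = [:f:] * lift_y g" using assms(2) by (auto simp: separated_def)
  then have "f \<noteq> 0" "g \<noteq> 0" using assms(3) by auto
  then show ?thesis using separated_of_mult[of P Q f g] Q R by simp
qed

definition at_y_0 :: "'f::field poly poly \<Rightarrow> 'f poly poly" where
  "at_y_0 P = [:poly P 0:]"

definition at_x_0 :: "'f::field poly poly \<Rightarrow> 'f poly poly" where
  "at_x_0 P = map_poly (\<lambda>c. [:poly c 0:]) P"

interpretation at_y_0: comm_ring_hom at_y_0
  by unfold_locales (auto simp: at_y_0_def one_pCons)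

interpretation at_x_0: comm_ring_hom at_x_0
proof -
  interpret c: comm_ring_hom "\<lambda>c :: 'a poly. [:poly c 0:]" by unfold_locales (auto simp: one_pCons)
  interpret m: map_poly_comm_ring_hom "\<lambda>c :: 'a poly. [:poly c 0:]" ..
  show "comm_ring_hom (at_x_0 :: 'a poly poly \<Rightarrow> _)"
    unfolding at_x_0_def by (rule m.comm_ring_hom_axioms)
qed

text \<open>If P = f(x) g(y), then f(x) g(0) f(0) g(y) = P f(0) g(0), and f(0) g(0) = P(0, 0) =
  1.\<close>

lemma separated_eq_at_0:
  assumes "separated P" "poly (poly P 0) 0 = 1"
  shows "P = at_y_0 P * at_x_0 P"
proof -
  obtain f g where P: "P = [:f:] * lift_y g" using assms(1) by (auto simp: separated_def)
  have lg0: "poly (lift_y g) 0 = [:poly g 0:]" by (simp add: poly_0_coeff_0 coeff_map_poly)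
  have "at_y_0 P = [:f:] * [:[:poly g 0:]:]" by (simp add: P at_y_0_def lg0)
  moreover have "at_x_0 P = [:[:poly f 0:]:] * lift_y g"
    by (rule poly_eqI) (simp add: P at_x_0_def coeff_map_poly)
  moreover have "poly f 0 * poly g 0 = 1" using assms(2) by (simp add: P lg0 mult.commute)
  moreover have "[:f:] * [:[:poly g 0:]:] * ([:[:poly f 0:]:] * lift_y g)
      = [:[:poly f 0 * poly g 0:]:] * ([:f:] * lift_y g)"
    by (simp add: algebra_simps)
  ultimately show ?thesis by (simp only: P[symmetric]) (simp add: one_pCons[symmetric])
qed

lemma lift_y_power: "lift_y (g ^ n) = lift_y g ^ n"
  by (induction n) (simp_all add: lift_y_mult)

lemma lift_y_sum: "lift_y (\<Sum>i\<in>I. g i) = (\<Sum>i\<in>I. lift_y (g i))"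
  by (induction I rule: infinite_finite_induct) (simp_all add: lift_y_add)

lemma separated_prod_list: "(\<And>P. P \<in> set Ps \<Longrightarrow> separated P) \<Longrightarrow> separated (prod_list Ps)"
  using separated_const[of 1] by (induction Ps) (auto intro: separated_mult simp: one_pCons)

text \<open>The boundary term of a fundamental domain of side N for a coordinate of u2: summing
  along y telescopes to 1 - y^N, and the constant labels on the left axis contribute 1 + x + ... +
  x^(N-1). The next definition is its mirror image, for u1.\<close>

definition geometric_x :: "nat \<Rightarrow> 'f::field poly poly" where
  "geometric_x N = (1 - indet_y ^ N) * (\<Sum>n<N. indet_x ^ n)"

definition geometric_y :: "nat \<Rightarrow> 'f::field poly poly" where
  "geometric_y N = (1 - indet_x ^ N) * (\<Sum>m<N. indet_y ^ m)"

lemma indet_x_power: "indet_x ^ n = [:[:0, 1:] ^ n:]"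
  by (simp add: indet_x_def poly_const_pow)

lemma indet_y_power: "indet_y ^ n = lift_y ([:0, 1 :: 'f::field:] ^ n)"
proof -
  have "lift_y [:0, 1 :: 'f:] = indet_y" by (rule poly_eqI) (simp add: indet_y_def coeff_map_poly coeff_pCons one_pCons split: nat.splits)
  then show ?thesis by (simp only: lift_y_power)
qed

lemma sum_const_poly: "(\<Sum>i\<in>I. [:f i:]) = [:\<Sum>i\<in>I. f i:]"
  by (induction I rule: infinite_finite_induct) simp_all

lemma separated_geometric_x: "separated (geometric_x N)"
proof -
  have "1 - indet_y ^ N = (lift_y (1 - [:0, 1:] ^ N) :: 'a poly poly)"
    using lift_y_add[of "1 - [:0, 1:] ^ N" "[:0, 1:] ^ N"] by (simp add: indet_y_power diff_eq_eq)
  moreover have "(\<Sum>n<N. indet_x ^ n) = ([:\<Sum>n<N. [:0, 1:] ^ n:] :: 'a poly poly)"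
    by (simp add: indet_x_power sum_const_poly)
  ultimately show ?thesis
    unfolding geometric_x_def by (simp only: separated_mult separated_lift_y separated_const)
qed

lemma separated_geometric_y: "separated (geometric_y N)"
proof -
  have "1 - indet_x ^ N = ([:1 - [:0, 1:] ^ N:] :: 'a poly poly)"
    by (simp add: indet_x_power one_pCons)
  moreover have "(\<Sum>m<N. indet_y ^ m) = (lift_y (\<Sum>m<N. [:0, 1:] ^ m) :: 'a poly poly)"
    by (simp add: indet_y_power lift_y_sum)
  ultimately show ?thesis
    unfolding geometric_y_def by (simp only: separated_mult separated_lift_y separated_const)
qed

lemma geometric_nonzero:
  assumes "0 < N"
  shows "geometric_x N \<noteq> (0 :: 'f::field poly poly)" "geometric_y N \<noteq> (0 :: 'f poly poly)"
proof -
  have "(\<Sum>n<N. 0 ^ n) = (1 :: 'f)"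
    using assms by (cases N) (simp_all add: sum.lessThan_Suc_shift del: sum.lessThan_Suc)
  then have "poly (poly (geometric_x N) 0) 0 = (1 :: 'f)" "poly (poly (geometric_y N) 0) 0 = (1 :: 'f)"
    using assms by (simp_all add: geometric_x_def geometric_y_def indet_x_def indet_y_def poly_sum)
  then show "geometric_x N \<noteq> (0 :: 'f poly poly)" "geometric_y N \<noteq> (0 :: 'f poly poly)"
    by fastforce+
qed

section \<open>The determinant and generating functions of doubly periodic colorings\<close>

context linear_square
begin

abbreviation K2 :: "'f \<Rightarrow> 'f poly poly" where "K2 e \<equiv> [:[:e:]:]"

text \<open>The recurrences give the matrix with off-diagonal blocks -bx and -cy, whereas the
  determinant condition has bx and cy. The two are conjugate by the diagonal matrix of these signs,
  so they have the same determinant.\<close>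

definition side_sign :: "nat \<Rightarrow> 'f poly poly" where
  "side_sign i = (if i < k1 then 1 else - 1)"

definition side_indet :: "nat \<Rightarrow> 'f poly poly" where
  "side_indet i = (if i < k1 then indet_x else indet_y)"

definition char_mat :: "'f poly poly mat" where
  "char_mat = mat k k (\<lambda>(i, j). (if i = j then 1 else 0) - side_sign i * side_sign j * side_indet i * K2 (E i j))"

abbreviation "Ax \<equiv> 1\<^sub>m (dim_row A) - indet_x \<cdot>\<^sub>m const_mat A"
abbreviation "Dy \<equiv> 1\<^sub>m (dim_row D) - indet_y \<cdot>\<^sub>m const_mat D"

lemma dims [simp]: "dim_row A = k1" "dim_col A = k1" "dim_row B = k1" "dim_col B = length bs2"
  "dim_row C = length bs2" "dim_col C = k1" "dim_row D = length bs2" "dim_col D = length bs2"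
  by (simp_all add: matrix_of_map_def)

lemma char_mat_block:
  "char_mat = four_block_mat Ax (indet_x \<cdot>\<^sub>m const_mat B) (indet_y \<cdot>\<^sub>m const_mat C) Dy"
  by (rule eq_matI)
    (auto simp: char_mat_def const_mat_def side_sign_def side_indet_def E_def)

lemma det_condition_iff: "det_condition A B C D \<longleftrightarrow> det char_mat \<noteq> det Ax * det Dy"
  by (simp add: det_condition_def char_mat_block Let_def)

lemma at_y_0_char_mat: "at_y_0 (det char_mat) = det Ax"
proof -
  have "map_mat at_y_0 char_mat
    = four_block_mat Ax (indet_x \<cdot>\<^sub>m const_mat B) (0\<^sub>m (length bs2) k1) (1\<^sub>m (length bs2))"
    unfolding char_mat_block
    by (rule eq_matI) (auto simp: const_mat_def at_y_0_def indet_x_def indet_y_def one_pCons)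
  then have "at_y_0 (det char_mat) = det Ax * det (1\<^sub>m (length bs2))"
    unfolding at_y_0.hom_det[symmetric]
    by (simp only:) (rule det_four_block_mat_lower_left_zero, auto simp: const_mat_def)
  then show ?thesis by simp
qed

lemma at_x_0_char_mat: "at_x_0 (det char_mat) = det Dy"
proof -
  have x0: "at_x_0 indet_x = 0" and y0: "at_x_0 indet_y = indet_y" and c0: "at_x_0 (K2 e) = K2 e" for e
    by (rule poly_eqI; simp add: at_x_0_def indet_x_def indet_y_def coeff_map_poly coeff_pCons one_pCons split: nat.splits)+
  have smult: "at_x_0 (smult c P) = smult [:poly c 0:] (at_x_0 P)" for c and P :: "'f poly poly"
    by (rule poly_eqI) (simp add: at_x_0_def coeff_map_poly)
  have "map_mat at_x_0 char_mat
    = four_block_mat (1\<^sub>m k1) (0\<^sub>m k1 (length bs2)) (indet_y \<cdot>\<^sub>m const_mat C) Dy"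
    unfolding char_mat_block
    by (rule eq_matI)
      (auto simp: const_mat_def at_x_0.hom_minus at_x_0.hom_mult at_x_0.hom_one x0 y0 c0 smult)
  then have "at_x_0 (det char_mat) = det (1\<^sub>m k1) * det Dy"
    unfolding at_x_0.hom_det[symmetric]
    by (simp only:) (rule det_four_block_mat_upper_right_zero, auto simp: const_mat_def)
  then show ?thesis by simp
qed

lemma det_char_mat_0: "poly (poly (det char_mat) 0) 0 = 1"
proof -
  interpret ev: comm_ring_hom "\<lambda>P :: 'f poly poly. poly (poly P 0) 0"
    by unfold_locales auto
  have "map_mat (\<lambda>P. poly (poly P 0) 0) char_mat = 1\<^sub>m k"
    by (rule eq_matI) (auto simp: char_mat_def side_indet_def indet_x_def indet_y_def)
  then show ?thesis unfolding ev.hom_det[symmetric] by simp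
qed

definition doubly_periodic :: "int \<Rightarrow> (int \<Rightarrow> int \<Rightarrow> 'v1) \<Rightarrow> (int \<Rightarrow> int \<Rightarrow> 'v2) \<Rightarrow> bool" where
  "doubly_periodic N u1 u2 \<longleftrightarrow>
     (\<forall>m n. u1 (m + N) n = u1 m n \<and> u2 (m + N) n = u2 m n \<and> u1 m (n + N) = u1 m n \<and> u2 m (n + N) = u2 m n)"

lemma doubly_periodic_mult:
  assumes "doubly_periodic N u1 u2"
  shows "doubly_periodic (N * int t) u1 u2"
proof (induction t)
  case (Suc t)
  have "m + N * int (Suc t) = (m + N * int t) + N" for m by (simp add: algebra_simps)
  then show ?case using Suc assms unfolding doubly_periodic_def by metis
qed (simp add: doubly_periodic_def)

text \<open>The recurrence turns the sum over j into a shift of coordinate i by one step in the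
  direction of \<open>side_indet i\<close>, so the difference telescopes over the fundamental
  domain. Its two ends agree by periodicity and are the constant label on an axis.\<close>

lemma generating_function:
  assumes col: "is_coloring v1 v2 u1 u2" and per: "doubly_periodic (int N) u1 u2" and i: "i < k"
  defines "w \<equiv> \<lambda>i m n. pair_coord i (u1 (int m) (int n), u2 (int m) (int n))"
  defines "q \<equiv> \<lambda>i. \<Sum>m<N. \<Sum>n<N. K2 (w i m n) * indet_x ^ n * indet_y ^ m"
  shows "q i - side_indet i * (\<Sum>j<k. K2 (E i j) * q j)
    = K2 (pair_coord i (v1, v2)) * (if i < k1 then geometric_y N else geometric_x N)"
proof -
  have K_sum: "K2 (\<Sum>j\<in>J. e j) = (\<Sum>j\<in>J. K2 (e j))" for e and J :: "nat set"
    by (simp add: sum_const_poly)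
  have "(\<Sum>j<k. K2 (E i j) * q j) = (\<Sum>m<N. \<Sum>j<k. \<Sum>n<N. K2 (E i j) * (K2 (w j m n) * indet_x ^ n * indet_y ^ m))"
    unfolding q_def sum_distrib_left by (rule sum.swap)
  also have "\<dots> = (\<Sum>m<N. \<Sum>n<N. \<Sum>j<k. K2 (E i j) * (K2 (w j m n) * indet_x ^ n * indet_y ^ m))"
    by (intro sum.cong refl sum.swap)
  also have "\<dots> = (\<Sum>m<N. \<Sum>n<N. K2 (\<Sum>j<k. E i j * w j m n) * indet_x ^ n * indet_y ^ m)"
    unfolding K_sum sum_distrib_right by (intro sum.cong refl) simp
  finally have Eq: "(\<Sum>j<k. K2 (E i j) * q j)
      = (\<Sum>m<N. \<Sum>n<N. K2 (\<Sum>j<k. E i j * w j m n) * indet_x ^ n * indet_y ^ m)" .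
  have step: "(\<Sum>j<k. E i j * w j m n) = (if i < k1 then w i m (Suc n) else w i (Suc m) n)" for m n
  proof -
    let ?u1 = "u1 (int m) (int n)" let ?u2 = "u2 (int m) (int n)"
    have "pair_coord i (a ?u1 + b ?u2, c ?u1 + d ?u2) = (\<Sum>j<k. E i j * w j m n)"
      unfolding w_def by (rule pair_coord_map[OF i])
    moreover have "pair_coord i (a ?u1 + b ?u2, c ?u1 + d ?u2) = (if i < k1 then w i m (Suc n) else w i (Suc m) n)"
      using col by (simp add: w_def is_coloring_def pair_coord_def add.commute[of 1])
    ultimately show ?thesis by simp
  qed
  show ?thesis
  proof (cases "i < k1")
    case True
    define g where "g m n = K2 (w i m n) * indet_x ^ n * indet_y ^ m" for m n
    have "q i - side_indet i * (\<Sum>j<k. K2 (E i j) * q j) = (\<Sum>m<N. \<Sum>n<N. g m n - g m (Suc n))"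
      unfolding Eq step unfolding q_def g_def using True
      by (simp add: side_indet_def sum_subtractf sum_distrib_left mult.left_commute mult.assoc
          del: mult_pCons_left mult_pCons_right)
    also have "\<dots> = (\<Sum>m<N. g m 0 - g m N)"
      by (simp only: sum_lessThan_telescope')
    also have "\<dots> = (\<Sum>m<N. K2 (pair_coord i (v1, v2)) * (1 - indet_x ^ N) * indet_y ^ m)"
    proof (intro sum.cong refl)
      fix m
      have "u1 (int m) (int N) = u1 (int m) 0"
        using per unfolding doubly_periodic_def by (metis add_0)
      then have "w i m N = pair_coord i (v1, v2)" "w i m 0 = pair_coord i (v1, v2)"
        using col True by (simp_all add: w_def is_coloring_def pair_coord_def)
      then show "g m 0 - g m N = K2 (pair_coord i (v1, v2)) * (1 - indet_x ^ N) * indet_y ^ m"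
        unfolding g_def by (simp only:) (simp only: power_0 mult_1_right right_diff_distrib left_diff_distrib)
    qed
    finally show ?thesis
      using True by (simp only: if_True geometric_y_def sum_distrib_left mult.assoc)
  next
    case False
    define g where "g n m = K2 (w i m n) * indet_x ^ n * indet_y ^ m" for m n
    have "q i - side_indet i * (\<Sum>j<k. K2 (E i j) * q j) = (\<Sum>m<N. \<Sum>n<N. g n m - g n (Suc m))"
      unfolding Eq step unfolding q_def g_def using False
      by (simp add: side_indet_def sum_subtractf sum_distrib_left mult.left_commute mult.assoc
          del: mult_pCons_left mult_pCons_right)
    also have "\<dots> = (\<Sum>n<N. \<Sum>m<N. g n m - g n (Suc m))" by (rule sum.swap)
    also have "\<dots> = (\<Sum>n<N. g n 0 - g n N)"
      by (simp only: sum_lessThan_telescope')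
    also have "\<dots> = (\<Sum>n<N. K2 (pair_coord i (v1, v2)) * (1 - indet_y ^ N) * indet_x ^ n)"
    proof (intro sum.cong refl)
      fix n
      have "u2 (int N) (int n) = u2 0 (int n)"
        using per unfolding doubly_periodic_def by (metis add_0)
      then have "w i N n = pair_coord i (v1, v2)" "w i 0 n = pair_coord i (v1, v2)"
        using col False by (simp_all add: w_def is_coloring_def pair_coord_def)
      then show "g n 0 - g n N = K2 (pair_coord i (v1, v2)) * (1 - indet_y ^ N) * indet_x ^ n"
        unfolding g_def
        by (simp only:) (simp only: power_0 mult_1_right right_diff_distrib left_diff_distrib mult.assoc mult.commute[of "indet_x ^ n"])
    qed
    finally show ?thesis
      using False by (simp only: if_False geometric_x_def sum_distrib_left mult.assoc)
  qed
qed

text \<open>If every coloring were doubly periodic, those of the basis vectors would have a common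
  period N, and their generating functions would form a matrix whose product with
  \<open>char_mat\<close> is diagonal with separated non-zero entries. Then the determinant divides
  a separated polynomial, so it is separated and equals the product of its restrictions to the
  axes.\<close>

theorem exists_aperiodic:
  assumes "det_condition A B C D"
  obtains v1 v2 u1 u2 where "is_coloring v1 v2 u1 u2" "\<And>N. 0 < N \<Longrightarrow> \<not> doubly_periodic N u1 u2"
proof (rule ccontr)
  assume "\<not> thesis"
  then have all: "\<And>v1 v2 u1 u2. is_coloring v1 v2 u1 u2 \<Longrightarrow> \<exists>N>0. doubly_periodic N u1 u2"
    using that by blast
  have "\<exists>v1 v2 u1 u2 N. (\<forall>i<k. pair_coord i (v1, v2) = (if i = l then 1 else 0)) \<and>
      is_coloring v1 v2 u1 u2 \<and> (0 :: nat) < N \<and> doubly_periodic (int N) u1 u2" for l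
  proof -
    obtain x where x: "\<forall>i<k. pair_coord i x = (if i = l then 1 else 0)"
      using pair_coord_exists[of "\<lambda>i. if i = l then 1 else 0"] by blast
    obtain u1 :: "int \<Rightarrow> int \<Rightarrow> 'v1" and u2 :: "int \<Rightarrow> int \<Rightarrow> 'v2" where u: "\<And>m n. u1 m (n + 1) = a (u1 m n) + b (u2 m n)"
      "\<And>m n. u2 (m + 1) n = c (u1 m n) + d (u2 m n)"
      "\<And>m. u1 m 0 = fst x" "\<And>n. u2 0 n = snd x"
      using plane_exists[of "fst x" "snd x"] by blast
    then have col: "is_coloring (fst x) (snd x) u1 u2" by (simp add: is_coloring_def)
    then obtain N where "0 < N" "doubly_periodic N u1 u2" using all by blast
    then have "0 < nat N" "doubly_periodic (int (nat N)) u1 u2" by simp_all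
    then show ?thesis using x col by (metis prod.collapse)
  qed
  then obtain V1 V2 U1 U2 P where
    V: "\<And>l i. i < k \<Longrightarrow> pair_coord i (V1 l, V2 l) = (if i = l then 1 else 0)"
    and U: "\<And>l. is_coloring (V1 l) (V2 l) (U1 l) (U2 l)" and P0: "\<And>l. (0 :: nat) < P l"
    and P: "\<And>l. doubly_periodic (int (P l)) (U1 l) (U2 l)"
    by metis
  define N where "N = (\<Prod>l<k. P l)"
  have N0: "0 < N" unfolding N_def using P0 by (intro prod_pos) auto
  have per: "doubly_periodic (int N) (U1 l) (U2 l)" if "l < k" for l
  proof -
    have "N = P l * (\<Prod>l\<in>{..<k} - {l}. P l)"
      unfolding N_def using that by (intro prod.remove) auto
    then show ?thesis using doubly_periodic_mult[OF P[of l]] by (metis of_nat_mult)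
  qed
  define q where "q l i = (\<Sum>m<N. \<Sum>n<N. K2 (pair_coord i (U1 l (int m) (int n), U2 l (int m) (int n)))
    * indet_x ^ n * indet_y ^ m)" for l i
  \<comment> \<open>Column l belongs to the coloring of the l-th basis vector; the sign of row j
    matches the conjugation in \<open>char_mat\<close>.\<close>
  define Q where "Q = mat k k (\<lambda>(j, l). side_sign j * q l j)"
  define r where "r i = side_sign i * (if i < k1 then geometric_y N else geometric_x N)" for i
  have sign2: "side_sign j * side_sign j = 1" for j by (simp add: side_sign_def)
  have "char_mat * Q = mat k k (\<lambda>(i, l). if i = l then r i else 0)"
  proof (rule eq_matI)
    fix i l assume "i < dim_row (mat k k (\<lambda>(i, l). if i = l then r i else 0))"
      "l < dim_col (mat k k (\<lambda>(i, l). if i = l then r i else 0))"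
    then have i: "i < k" and l: "l < k" by simp_all
    have "(char_mat * Q) $$ (i, l) = (\<Sum>j<k. char_mat $$ (i, j) * Q $$ (j, l))"
      using i l by (simp add: char_mat_def Q_def scalar_prod_def atLeast0LessThan)
    also have "\<dots> = (\<Sum>j<k. (if i = j then side_sign j * q l j else 0)
        - side_sign i * (side_indet i * (K2 (E i j) * q l j)))"
    proof (intro sum.cong refl)
      fix j assume "j \<in> {..<k}"
      then have e: "char_mat $$ (i, j) = (if i = j then 1 else 0) - side_sign i * side_sign j * side_indet i * K2 (E i j)"
        and e': "Q $$ (j, l) = side_sign j * q l j" using i l by (simp_all add: char_mat_def Q_def)
      have "side_sign i * side_sign j * side_indet i * K2 (E i j) * (side_sign j * q l j)
          = (side_sign j * side_sign j) * (side_sign i * (side_indet i * (K2 (E i j) * q l j)))"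
        by (simp only: ac_simps)
      then show "char_mat $$ (i, j) * Q $$ (j, l) = (if i = j then side_sign j * q l j else 0)
        - side_sign i * (side_indet i * (K2 (E i j) * q l j))"
        unfolding e e' by (simp add: left_diff_distrib sign2 del: mult_pCons_left mult_pCons_right)
    qed
    also have "\<dots> = side_sign i * (q l i - side_indet i * (\<Sum>j<k. K2 (E i j) * q l j))"
      using i by (simp add: sum_subtractf sum_distrib_left right_diff_distrib del: mult_pCons_left mult_pCons_right)
    also have "\<dots> = side_sign i * (K2 (pair_coord i (V1 l, V2 l)) * (if i < k1 then geometric_y N else geometric_x N))"
      unfolding q_def using generating_function[OF U per[OF l] i] by simp
    also have "\<dots> = mat k k (\<lambda>(i, l). if i = l then r i else 0) $$ (i, l)"
      using i l by (simp add: V r_def one_pCons[symmetric])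
    finally show "(char_mat * Q) $$ (i, l) = mat k k (\<lambda>(i, l). if i = l then r i else 0) $$ (i, l)" .
  qed (simp_all add: char_mat_def Q_def)
  then have "det char_mat * det Q = det (mat k k (\<lambda>(i, l). if i = l then r i else 0))"
    by (subst det_mult[symmetric, of _ k]) (simp_all add: char_mat_def Q_def)
  also have "\<dots> = prod_list (diag_mat (mat k k (\<lambda>(i, l). if i = l then r i else 0)))"
    by (rule det_lower_triangular[of k]) auto
  finally have dvd: "det char_mat dvd prod_list (diag_mat (mat k k (\<lambda>(i, l). if i = l then r i else 0)))"
    by (metis dvd_triv_left)
  have diag: "set (diag_mat (mat k k (\<lambda>(i, l). if i = l then r i else 0))) \<subseteq> range r"
    by (auto simp: diag_mat_def)
  have sep: "separated (r i)" for i
  proof -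
    have "side_sign i = [:if i < k1 then 1 else - 1:]" by (simp add: side_sign_def one_pCons)
    then have "separated (side_sign i)" by (simp only: separated_const)
    then show ?thesis unfolding r_def
      by (rule separated_mult) (simp add: separated_geometric_x separated_geometric_y)
  qed
  have "r i \<noteq> 0" for i using geometric_nonzero[OF N0, where ?'f = 'f] by (simp add: r_def side_sign_def)
  then have "separated (det char_mat)"
    using dvd diag sep
    by (intro separated_dvd[OF dvd] separated_prod_list) (auto simp: prod_list_zero_iff)
  then have "det char_mat = det Ax * det Dy"
    using separated_eq_at_0[OF _ det_char_mat_0] by (simp add: at_y_0_char_mat at_x_0_char_mat)
  then show False using assms by (simp add: det_condition_iff)
qed

end

section \<open>The trees\<close>

text \<open>The line through the base vertex consists of the powers of v. A reduced word leaves it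
  after its longest initial run of letters v and inverses of v: the exponent sum of the run is the
  position, and the number of remaining letters is the distance.\<close>

definition word_pos :: "'v \<Rightarrow> 'v sword \<Rightarrow> int" where
  "word_pos v u = sum_list (map (\<lambda>l. if snd l then 1 else - 1) (takeWhile (\<lambda>l. fst l = v) u))"

definition word_off :: "'v \<Rightarrow> 'v sword \<Rightarrow> int" where
  "word_off v u = int (length (dropWhile (\<lambda>l. fst l = v) u))"

text \<open>A further letter either prolongs the initial run, which moves the position by one at
  offset 0, or adds one to the offset and keeps the position.\<close>

lemma word_pos_off_append:
  "\<bar>(word_pos v (u @ [l]) + word_off v (u @ [l])) - (word_pos v u + word_off v u)\<bar> \<le> 1 \<and>
   \<bar>(word_pos v (u @ [l]) - word_off v (u @ [l])) - (word_pos v u - word_off v u)\<bar> \<le> 1"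
proof (cases "\<forall>l'\<in>set u. fst l' = v")
  case True
  then have tw: "takeWhile (\<lambda>l. fst l = v) u = u" and dw: "dropWhile (\<lambda>l. fst l = v) u = []"
    by (simp_all add: takeWhile_eq_all_conv)
  show ?thesis using True by (simp add: word_pos_def word_off_def tw dw)
next
  case False
  then obtain l' where "l' \<in> set u" "fst l' \<noteq> v" by blast
  then show ?thesis by (simp add: word_pos_def word_off_def takeWhile_append1 dropWhile_append1)
qed

context square_presentation
begin

abbreviation "T \<equiv> coset_graph G H (range gi)"

lemma H_sub: "H \<subseteq> carrier G"
  using H_closed by blast

lemma verts_T: "verts T = (\<lambda>g. g <#\<^bsub>G\<^esub> H) ` carrier G"
  by (auto simp: coset_graph_def)

lemma edges_T: "edges T = {{g <#\<^bsub>G\<^esub> H, (g \<otimes>\<^bsub>G\<^esub> gi v) <#\<^bsub>G\<^esub> H} | g v. g \<in> carrier G}"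
  by (auto simp: coset_graph_def)

lemma coset_in_verts [simp]: "g \<in> carrier G \<Longrightarrow> g <#\<^bsub>G\<^esub> H \<in> verts T"
  by (simp add: verts_T)

lemma coset_mult_H: "g \<in> carrier G \<Longrightarrow> h \<in> H \<Longrightarrow> (g \<otimes>\<^bsub>G\<^esub> h) <#\<^bsub>G\<^esub> H = g <#\<^bsub>G\<^esub> H"
  using G.lcos_m_assoc[OF H_sub, of g h] G.coset_join3[OF _ subgroup_H, of h] H_closed by simp

lemma in_coset: "g \<in> carrier G \<Longrightarrow> g \<in> g <#\<^bsub>G\<^esub> H"
  using subgroup.one_closed[OF subgroup_H] by (force simp: l_coset_def)

lemma coset_eqE:
  assumes "g <#\<^bsub>G\<^esub> H = g' <#\<^bsub>G\<^esub> H" "g \<in> carrier G"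
  obtains h where "h \<in> H" "g = g' \<otimes>\<^bsub>G\<^esub> h"
proof -
  have "g \<in> g' <#\<^bsub>G\<^esub> H" using in_coset[OF assms(2)] assms(1) by simp
  then show ?thesis using that by (auto simp: l_coset_def)
qed

lemma coset_word_elt: "g \<in> carrier G \<Longrightarrow> word_elt (gact g []) <#\<^bsub>G\<^esub> H = g <#\<^bsub>G\<^esub> H"
  by (metis decompose coset_mult_H word_elt_closed)

text \<open>\<open>H\<close> fixes the empty word, and the normal form recovers the coset; so
  vertices of the graph are faithfully described by reduced words.\<close>

lemma coset_eq_iff:
  assumes "g \<in> carrier G" "g' \<in> carrier G"
  shows "g <#\<^bsub>G\<^esub> H = g' <#\<^bsub>G\<^esub> H \<longleftrightarrow> gact g [] = gact g' []"
proof
  assume "g <#\<^bsub>G\<^esub> H = g' <#\<^bsub>G\<^esub> H"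
  then obtain h where "h \<in> H" "g = g' \<otimes>\<^bsub>G\<^esub> h" using assms(1) by (rule coset_eqE)
  then show "gact g [] = gact g' []" using assms gact_mult_H by simp
next
  assume "gact g [] = gact g' []"
  then show "g <#\<^bsub>G\<^esub> H = g' <#\<^bsub>G\<^esub> H" using coset_word_elt assms by metis
qed

definition vertex_elt :: "'g word set set \<Rightarrow> 'g word set" where
  "vertex_elt X = (SOME g. g \<in> carrier G \<and> X = g <#\<^bsub>G\<^esub> H)"

definition vertex_word :: "'g word set set \<Rightarrow> 'v sword" where
  "vertex_word X = gact (vertex_elt X) []"

definition vertex_height :: "'g word set set \<Rightarrow> int" where
  "vertex_height X = height (vertex_elt X)"

lemma vertex_elt: "g \<in> carrier G \<Longrightarrow> vertex_elt (g <#\<^bsub>G\<^esub> H) \<in> carrier G \<and>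
    g <#\<^bsub>G\<^esub> H = vertex_elt (g <#\<^bsub>G\<^esub> H) <#\<^bsub>G\<^esub> H"
  unfolding vertex_elt_def by (rule someI) simp

lemma vertex_word_coset: "g \<in> carrier G \<Longrightarrow> vertex_word (g <#\<^bsub>G\<^esub> H) = gact g []"
  using vertex_elt[of g] coset_eq_iff[of g "vertex_elt (g <#\<^bsub>G\<^esub> H)"] by (simp add: vertex_word_def)

lemma vertex_height_coset:
  assumes "g \<in> carrier G"
  shows "vertex_height (g <#\<^bsub>G\<^esub> H) = height g"
proof -
  obtain h where "h \<in> H" "g = vertex_elt (g <#\<^bsub>G\<^esub> H) \<otimes>\<^bsub>G\<^esub> h"
    using vertex_elt[OF assms] assms coset_eqE by metis
  then show ?thesis
    using vertex_elt[OF assms] by (metis H_closed add.right_neutral height_H height_mult vertex_height_def)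
qed

lemma edge_cases:
  assumes "e \<in> edges T"
  obtains g v where "g \<in> carrier G" "e = {g <#\<^bsub>G\<^esub> H, (g \<otimes>\<^bsub>G\<^esub> gi v) <#\<^bsub>G\<^esub> H}"
  using assms unfolding edges_T by blast

lemma edgeI: "g \<in> carrier G \<Longrightarrow> {g <#\<^bsub>G\<^esub> H, (g \<otimes>\<^bsub>G\<^esub> gi v) <#\<^bsub>G\<^esub> H} \<in> edges T"
  unfolding edges_T by blast

lemma height_step: "g \<in> carrier G \<Longrightarrow> height (g \<otimes>\<^bsub>G\<^esub> gi v) = height g + 1"
  by (simp add: height_mult)

lemma connected_word:
  "g \<in> carrier G \<Longrightarrow> (g <#\<^bsub>G\<^esub> H, (g \<otimes>\<^bsub>G\<^esub> word_elt u) <#\<^bsub>G\<^esub> H) \<in> {(x, y). {x, y} \<in> edges T}\<^sup>*"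
proof (induction u arbitrary: g)
  case Nil
  then show ?case by (simp add: word_elt_Nil)
next
  case (Cons l u)
  obtain v e where l: "l = (v, e)" by fastforce
  define s where "s = pres_class R [(i v, e)]"
  have s: "s \<in> carrier G" by (simp add: s_def)
  have "{g <#\<^bsub>G\<^esub> H, (g \<otimes>\<^bsub>G\<^esub> s) <#\<^bsub>G\<^esub> H} \<in> edges T"
  proof (cases e)
    case True
    then show ?thesis using edgeI[OF Cons.prems] by (simp add: s_def class_gi)
  next
    case False
    then have "s = inv\<^bsub>G\<^esub> gi v" by (simp add: s_def class_gi)
    then show ?thesis
      using edgeI[of "g \<otimes>\<^bsub>G\<^esub> s" v] Cons.prems by (simp add: G.m_assoc insert_commute)
  qed
  then have "(g <#\<^bsub>G\<^esub> H, (g \<otimes>\<^bsub>G\<^esub> s) <#\<^bsub>G\<^esub> H) \<in> {(x, y). {x, y} \<in> edges T}" by simp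
  moreover have "((g \<otimes>\<^bsub>G\<^esub> s) <#\<^bsub>G\<^esub> H, (g \<otimes>\<^bsub>G\<^esub> word_elt (l # u)) <#\<^bsub>G\<^esub> H) \<in> {(x, y). {x, y} \<in> edges T}\<^sup>*"
    using Cons.IH[of "g \<otimes>\<^bsub>G\<^esub> s"] Cons.prems s by (simp add: l word_elt_Cons s_def[symmetric] G.m_assoc)
  ultimately show ?case by (rule converse_rtrancl_into_rtrancl)
qed

text \<open>The ends of an edge differ in height, so there are no loops. The normal form spells a
  path from the base vertex.\<close>

lemma is_metric_graph: "metric_graph T"
proof
  fix e assume "e \<in> edges T"
  then obtain g v where g: "g \<in> carrier G" and e: "e = {g <#\<^bsub>G\<^esub> H, (g \<otimes>\<^bsub>G\<^esub> gi v) <#\<^bsub>G\<^esub> H}"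
    by (rule edge_cases)
  have "vertex_height (g <#\<^bsub>G\<^esub> H) \<noteq> vertex_height ((g \<otimes>\<^bsub>G\<^esub> gi v) <#\<^bsub>G\<^esub> H)"
    using g by (simp add: vertex_height_coset height_step)
  then have "g <#\<^bsub>G\<^esub> H \<noteq> (g \<otimes>\<^bsub>G\<^esub> gi v) <#\<^bsub>G\<^esub> H" by metis
  then show "\<exists>x y. e = {x, y} \<and> x \<noteq> y \<and> x \<in> verts T \<and> y \<in> verts T"
    using e g by (metis G.m_closed coset_in_verts gi_closed)
next
  fix x y assume xy: "x \<in> verts T" "y \<in> verts T"
  have one: "(\<one>\<^bsub>G\<^esub> <#\<^bsub>G\<^esub> H, z) \<in> {(x, y). {x, y} \<in> edges T}\<^sup>*" if z: "z \<in> verts T" for z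
  proof -
    obtain g where g: "g \<in> carrier G" "z = g <#\<^bsub>G\<^esub> H" using z by (auto simp: verts_T)
    show ?thesis
      using connected_word[of "\<one>\<^bsub>G\<^esub>" "gact g []"] g coset_word_elt[OF g(1)] by simp
  qed
  have "sym {(x, y). {x, y} \<in> edges T}" by (auto simp: sym_def insert_commute)
  then have "(x, \<one>\<^bsub>G\<^esub> <#\<^bsub>G\<^esub> H) \<in> {(x, y). {x, y} \<in> edges T}\<^sup>*"
    using one[OF xy(1)] sym_rtrancl symD by metis
  then show "(x, y) \<in> {(x, y). {x, y} \<in> edges T}\<^sup>*" using one[OF xy(2)] by (rule rtrancl_trans)
qed

sublocale T: metric_graph T by (rule is_metric_graph)

lemma translation_coset:
  "g \<in> carrier G \<Longrightarrow> x \<in> carrier G \<Longrightarrow> left_translation G T g (x <#\<^bsub>G\<^esub> H) = (g \<otimes>\<^bsub>G\<^esub> x) <#\<^bsub>G\<^esub> H"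
  by (simp add: left_translation_def G.lcos_m_assoc[OF H_sub])

lemma translation_edge:
  assumes "g \<in> carrier G" "{x, y} \<in> edges T"
  shows "{left_translation G T g x, left_translation G T g y} \<in> edges T"
proof -
  obtain k v where k: "k \<in> carrier G" "{x, y} = {k <#\<^bsub>G\<^esub> H, (k \<otimes>\<^bsub>G\<^esub> gi v) <#\<^bsub>G\<^esub> H}"
    using assms(2) by (rule edge_cases)
  have "left_translation G T g ` {x, y} = {(g \<otimes>\<^bsub>G\<^esub> k) <#\<^bsub>G\<^esub> H, (g \<otimes>\<^bsub>G\<^esub> k \<otimes>\<^bsub>G\<^esub> gi v) <#\<^bsub>G\<^esub> H}"
    unfolding k(2) using assms(1) k(1) by (simp add: translation_coset G.m_assoc)
  then show ?thesis using edgeI[of "g \<otimes>\<^bsub>G\<^esub> k" v] assms(1) k(1) by simp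
qed

lemma translation_inverse:
  assumes "g \<in> carrier G" "x \<in> verts T"
  shows "left_translation G T (inv\<^bsub>G\<^esub> g) (left_translation G T g x) = x"
proof -
  obtain k where "k \<in> carrier G" "x = k <#\<^bsub>G\<^esub> H" using assms(2) by (auto simp: verts_T)
  then show ?thesis using assms(1) by (simp add: translation_coset G.m_assoc[symmetric])
qed

lemma translation_verts:
  assumes "g \<in> carrier G" "x \<in> verts T"
  shows "left_translation G T g x \<in> verts T"
proof -
  obtain k where "k \<in> carrier G" "x = k <#\<^bsub>G\<^esub> H" using assms(2) by (auto simp: verts_T)
  then show ?thesis using assms(1) by (simp add: translation_coset)
qed

lemma is_automorphism:
  assumes g: "g \<in> carrier G"
  shows "graph_automorphism T (left_translation G T g)"
proof
  show "bij_betw (left_translation G T g) (verts T) (verts T)"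
    using translation_inverse[of "inv\<^bsub>G\<^esub> g"] g
    by (intro bij_betwI[where g = "left_translation G T (inv\<^bsub>G\<^esub> g)"])
      (simp_all add: translation_verts translation_inverse)
  fix x y assume xy: "x \<in> verts T" "y \<in> verts T"
  show "{left_translation G T g x, left_translation G T g y} \<in> edges T \<longleftrightarrow> {x, y} \<in> edges T"
    using translation_edge[OF g] translation_edge[of "inv\<^bsub>G\<^esub> g" "left_translation G T g x" "left_translation G T g y"]
      xy g by (auto simp: translation_inverse)
qed

lemma vertex_height_edge:
  assumes "{x, y} \<in> edges T"
  shows "\<bar>real_of_int (vertex_height x) - real_of_int (vertex_height y)\<bar> \<le> 1"
proof -
  obtain g v where g: "g \<in> carrier G" and e: "{x, y} = {g <#\<^bsub>G\<^esub> H, (g \<otimes>\<^bsub>G\<^esub> gi v) <#\<^bsub>G\<^esub> H}"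
    using assms by (rule edge_cases)
  have "vertex_height ((g \<otimes>\<^bsub>G\<^esub> gi v) <#\<^bsub>G\<^esub> H) = vertex_height (g <#\<^bsub>G\<^esub> H) + 1"
    using g by (simp add: vertex_height_coset height_step)
  then show ?thesis using e by (auto simp: doubleton_eq_iff)
qed

lemma vertex_height_translation:
  assumes "g \<in> carrier G" "x \<in> verts T"
  shows "vertex_height (left_translation G T g x) = vertex_height x + height g"
proof -
  obtain k where "k \<in> carrier G" "x = k <#\<^bsub>G\<^esub> H" using assms(2) by (auto simp: verts_T)
  then show ?thesis using assms(1) by (simp add: translation_coset vertex_height_coset height_mult)
qed

lemma gi_pow_word: "gi v [^]\<^bsub>G\<^esub> (n :: int) = word_elt (replicate (nat \<bar>n\<bar>) (v, 0 \<le> n))"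
proof -
  have pos: "word_elt (replicate n (v, True)) = gi v [^]\<^bsub>G\<^esub> n" for n :: nat
  proof (induction n)
    case (Suc n)
    then show ?case using G.nat_pow_Suc2[OF gi_closed, of v n] by (simp add: word_elt_Cons class_gi)
  qed (simp add: word_elt_Nil)
  have neg: "word_elt (replicate n (v, False)) = inv\<^bsub>G\<^esub> (gi v) [^]\<^bsub>G\<^esub> n" for n :: nat
  proof (induction n)
    case (Suc n)
    then show ?case
      using G.nat_pow_Suc2[of "inv\<^bsub>G\<^esub> gi v" n] by (simp add: word_elt_Cons class_gi)
  qed (simp add: word_elt_Nil)
  show ?thesis
  proof (cases "0 \<le> n")
    case True
    then show ?thesis using int_pow_int[of G "gi v" "nat n"] by (simp add: pos)
  next
    case False
    then have "gi v [^]\<^bsub>G\<^esub> n = inv\<^bsub>G\<^esub> (gi v [^]\<^bsub>G\<^esub> nat (- n))"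
      using G.int_pow_neg_int[of "gi v" "nat (- n)"] by simp
    also have "\<dots> = word_elt (replicate (nat (- n)) (v, False))"
      by (simp only: neg G.nat_pow_inv[OF gi_closed])
    finally show ?thesis using False by simp
  qed
qed

lemma reduced_replicate: "reduced (replicate n (v, e))"
proof (induction n)
  case (Suc n)
  then show ?case by (cases n) simp_all
qed simp

lemma vertex_word_pow:
  "vertex_word ((gi v [^]\<^bsub>G\<^esub> (n :: int)) <#\<^bsub>G\<^esub> H) = replicate (nat \<bar>n\<bar>) (v, 0 \<le> n)"
  by (simp add: vertex_word_coset gi_pow_word gact_word_elt_Nil reduced_replicate)

lemma word_elt_pow: "(\<And>l. l \<in> set u \<Longrightarrow> fst l = v) \<Longrightarrow> word_elt u = gi v [^]\<^bsub>G\<^esub> word_pos v u"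
proof (induction u)
  case Nil
  then show ?case by (simp add: word_elt_Nil word_pos_def)
next
  case (Cons l u)
  obtain e where l: "l = (v, e)" using Cons.prems[of l] by (cases l) auto
  have "word_pos v (l # u) = (if e then 1 else - 1) + word_pos v u" by (simp add: l word_pos_def)
  moreover have "pres_class R [(i v, e)] = gi v [^]\<^bsub>G\<^esub> (if e then 1 else - 1 :: int)"
    by (auto simp: class_gi G.int_pow_1 G.int_pow_neg)
  ultimately show ?case
    using Cons by (simp only: l word_elt_Cons G.int_pow_mult[OF gi_closed]) simp
qed

text \<open>The vertices on the axis are the words that are powers of v, which is what offset 0
  means. The Lipschitz conditions hold because neighbours differ by one final letter.\<close>

lemma is_axis:
  "graph_axis T (\<lambda>n. (gi v [^]\<^bsub>G\<^esub> n) <#\<^bsub>G\<^esub> H) (\<lambda>x. word_pos v (vertex_word x)) (\<lambda>x. word_off v (vertex_word x))"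
proof
  fix k :: int
  have cl: "gi v [^]\<^bsub>G\<^esub> k \<in> carrier G" for k :: int by simp
  show "(gi v [^]\<^bsub>G\<^esub> k) <#\<^bsub>G\<^esub> H \<in> verts T" by simp
  show "{(gi v [^]\<^bsub>G\<^esub> k) <#\<^bsub>G\<^esub> H, (gi v [^]\<^bsub>G\<^esub> (k + 1)) <#\<^bsub>G\<^esub> H} \<in> edges T"
    using edgeI[OF cl, of k v] G.int_pow_mult[OF gi_closed, of v k 1] by (simp add: G.int_pow_1)
  have "takeWhile (\<lambda>l. fst l = v) (replicate n (v, e)) = replicate n (v, e)"
    "dropWhile (\<lambda>l. fst l = v) (replicate n (v, e)) = []" for n e
    by (simp_all add: takeWhile_eq_all_conv)
  then show "word_pos v (vertex_word ((gi v [^]\<^bsub>G\<^esub> k) <#\<^bsub>G\<^esub> H)) = k"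
    "word_off v (vertex_word ((gi v [^]\<^bsub>G\<^esub> k) <#\<^bsub>G\<^esub> H)) = 0"
    unfolding vertex_word_pow word_pos_def word_off_def by (auto simp: sum_list_replicate)
next
  fix y assume y: "y \<in> verts T" "word_off v (vertex_word y) = 0"
  then obtain g where g: "g \<in> carrier G" "y = g <#\<^bsub>G\<^esub> H" by (auto simp: verts_T)
  have "word_elt (gact g []) = gi v [^]\<^bsub>G\<^esub> word_pos v (gact g [])"
    using y(2) g by (intro word_elt_pow) (auto simp: word_off_def vertex_word_coset dropWhile_eq_Nil_conv)
  then show "y = (gi v [^]\<^bsub>G\<^esub> word_pos v (vertex_word y)) <#\<^bsub>G\<^esub> H"
    using g coset_word_elt[OF g(1)] by (simp add: vertex_word_coset)
next
  fix y z assume "{y, z} \<in> edges T"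
  then obtain g s where g: "g \<in> carrier G" and e: "{y, z} = {g <#\<^bsub>G\<^esub> H, (g \<otimes>\<^bsub>G\<^esub> gi s) <#\<^bsub>G\<^esub> H}"
    by (rule edge_cases)
  let ?F = "\<lambda>u u'. \<bar>(word_pos v u + word_off v u) - (word_pos v u' + word_off v u')\<bar> \<le> 1 \<and>
      \<bar>(word_pos v u - word_off v u) - (word_pos v u' - word_off v u')\<bar> \<le> 1"
  have sym: "?F u u' \<Longrightarrow> ?F u' u" for u u' by (auto simp: abs_minus_commute)
  have "?F (gact (g \<otimes>\<^bsub>G\<^esub> gi s) []) (gact g [])"
    using edge_words[OF g, of s] word_pos_off_append sym by metis
  then have "?F (vertex_word ((g \<otimes>\<^bsub>G\<^esub> gi s) <#\<^bsub>G\<^esub> H)) (vertex_word (g <#\<^bsub>G\<^esub> H))"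
    using g by (simp add: vertex_word_coset)
  then show "?F (vertex_word y) (vertex_word z)"
    using e sym unfolding doubleton_eq_iff by metis
qed (simp add: word_off_def)

lemma gi_inject: "gi v = gi v' \<longleftrightarrow> v = v'"
proof -
  have "gact (gi v) [] = [(v, True)]" for v
    by (simp add: class_gi(1)[symmetric] gact_class lmul_def)
  then show ?thesis by (metis list.inject prod.inject)
qed

end

section \<open>Translations of the realized tree and their heights\<close>

context square_presentation
begin

abbreviation tr :: "'g word set \<Rightarrow> ('g word set set \<Rightarrow> real) \<Rightarrow> 'g word set set \<Rightarrow> real" where
  "tr g \<equiv> realization_map (left_translation G T g)"

abbreviation height_ext :: "('g word set set \<Rightarrow> real) \<Rightarrow> real" where
  "height_ext \<equiv> affine_ext (\<lambda>x. real_of_int (vertex_height x))"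

abbreviation line :: "'v \<Rightarrow> int \<Rightarrow> 'g word set set" where
  "line v \<equiv> \<lambda>n. (gi v [^]\<^bsub>G\<^esub> n) <#\<^bsub>G\<^esub> H"

lemma height_ext_lipschitz:
  "\<xi> \<in> realization T \<Longrightarrow> \<eta> \<in> realization T \<Longrightarrow> \<bar>height_ext \<xi> - height_ext \<eta>\<bar> \<le> realization_dist T \<xi> \<eta>"
  by (rule T.affine_ext_lipschitz) (simp_all add: vertex_height_edge)

lemma tr_realization: "g \<in> carrier G \<Longrightarrow> \<xi> \<in> realization T \<Longrightarrow> tr g \<xi> \<in> realization T"
  using graph_automorphism.map_realization[OF is_automorphism] by blast

lemma height_ext_tr:
  assumes "g \<in> carrier G" "\<xi> \<in> realization T"
  shows "height_ext (tr g \<xi>) = height_ext \<xi> + height g"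
  using graph_automorphism.affine_ext_map[OF is_automorphism[OF assms(1)] assms(2),
      of "\<lambda>x. real_of_int (vertex_height x)" "real_of_int (height g)"] assms(1)
  by (simp add: vertex_height_translation)

text \<open>The height extends to a 1-Lipschitz function on the realization, and g raises it by the
  height of g.\<close>

lemma displacement:
  assumes "g \<in> carrier G" "\<xi> \<in> realization T"
  shows "\<bar>real_of_int (height g)\<bar> \<le> realization_dist T \<xi> (tr g \<xi>)"
  using height_ext_lipschitz[OF assms(2) tr_realization[OF assms]] by (simp add: height_ext_tr[OF assms])

lemma tr_vertex:
  assumes "g \<in> carrier G" "x \<in> carrier G"
  shows "tr g (vertex_point (x <#\<^bsub>G\<^esub> H)) = vertex_point ((g \<otimes>\<^bsub>G\<^esub> x) <#\<^bsub>G\<^esub> H)"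
  using graph_automorphism.map_vertex[OF is_automorphism[OF assms(1)], of "x <#\<^bsub>G\<^esub> H"] assms
  by (simp add: translation_coset)

lemma height_ext_vertex: "g \<in> carrier G \<Longrightarrow> height_ext (vertex_point (g <#\<^bsub>G\<^esub> H)) = height g"
  by (simp add: affine_ext_def vertex_point_def vertex_height_coset)

lemma tr_axis: "tr (gi v) (graph_axis.point (line v) t) = graph_axis.point (line v) (t + 1)"
proof -
  interpret ax: graph_axis T "line v" "\<lambda>x. word_pos v (vertex_word x)" "\<lambda>x. word_off v (vertex_word x)"
    by (rule is_axis)
  interpret au: graph_automorphism T "left_translation G T (gi v)" by (rule is_automorphism) simp
  have step: "left_translation G T (gi v) (line v k) = line v (k + 1)" for k
    using G.int_pow_mult[OF gi_closed, of v 1 k] by (simp add: translation_coset G.int_pow_1 add.commute)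
  have iff: "left_translation G T (gi v) x = line v (k + 1) \<longleftrightarrow> x = line v k" if "x \<in> verts T" for x k
    using inj_onD[OF au.inj_f, of x "line v k"] that step[of k] by auto
  show ?thesis
  proof (rule au.map_eqI[OF ax.point_realization])
    fix x assume x: "x \<in> verts T"
    have "\<lfloor>t + 1\<rfloor> = \<lfloor>t\<rfloor> + 1" "frac (t + 1) = frac t" by (simp_all add: frac_def)
    then show "ax.point (t + 1) (left_translation G T (gi v) x) = ax.point t x"
      unfolding ax.point_def using iff[OF x, of "\<lfloor>t\<rfloor>"] iff[OF x, of "\<lfloor>t\<rfloor> + 1"] by simp
  next
    fix y assume "y \<notin> verts T"
    then show "ax.point (t + 1) y = 0" using ax.x_verts unfolding ax.point_def by auto
  qed
qed

lemma height_ext_axis: "height_ext (graph_axis.point (line v) t) = t"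
proof -
  interpret ax: graph_axis T "line v" "\<lambda>x. word_pos v (vertex_word x)" "\<lambda>x. word_off v (vertex_word x)"
    by (rule is_axis)
  show ?thesis by (rule ax.affine_ext_point) (simp add: vertex_height_coset height_int_pow)
qed

lemma vertex_point_inject: "vertex_point x = vertex_point y \<longleftrightarrow> x = y"
proof
  assume "vertex_point x = vertex_point y"
  from fun_cong[OF this, of x] show "x = y" by (simp add: vertex_point_def split: if_splits)
qed simp

end

text \<open>The index travels with the product, since the relation in \<open>int_chain\<close> does
  not see it.\<close>

lemma (in group) partial_products:
  fixes s :: "int \<Rightarrow> 'a"
  assumes "\<And>n. s n \<in> carrier G" "g0 \<in> carrier G"
  shows "\<exists>p. p 0 = g0 \<and> (\<forall>n. p n \<in> carrier G \<and> p (n + 1) = p n \<otimes> s n)"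
proof -
  have "\<exists>z :: int \<Rightarrow> int \<times> 'a. z 0 = (0, g0) \<and> (\<forall>k. snd (z k) \<in> carrier G \<and>
      fst (z (k + 1)) = fst (z k) + 1 \<and> snd (z (k + 1)) = snd (z k) \<otimes> s (fst (z k)))"
  proof (rule int_chain)
    fix x :: "int \<times> 'a" assume "snd x \<in> carrier G"
    then show "\<exists>y. snd y \<in> carrier G \<and> fst y = fst x + 1 \<and> snd y = snd x \<otimes> s (fst x)"
      using assms by (intro exI[of _ "(fst x + 1, snd x \<otimes> s (fst x))"]) simp
  next
    fix y :: "int \<times> 'a" assume "snd y \<in> carrier G"
    then show "\<exists>x. snd x \<in> carrier G \<and> fst y = fst x + 1 \<and> snd y = snd x \<otimes> s (fst x)"
      using assms by (intro exI[of _ "(fst y - 1, snd y \<otimes> inv s (fst y - 1))"]) (simp add: m_assoc)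
  qed (use assms in simp)
  then obtain z :: "int \<Rightarrow> int \<times> 'a" where z: "z 0 = (0, g0)" "\<And>k. snd (z k) \<in> carrier G"
    "\<And>k. fst (z (k + 1)) = fst (z k) + 1" "\<And>k. snd (z (k + 1)) = snd (z k) \<otimes> s (fst (z k))"
    by blast
  have "fst (z k) = k" for k
  proof (induction k rule: int_induct[where k = 0])
    case (step2 i)
    then show ?case using z(3)[of "i - 1"] by simp
  qed (use z in simp_all)
  then show ?thesis using z by (intro exI[of _ "\<lambda>n. snd (z n)"]) simp
qed

section \<open>The two trees of the linear data and the grid of a coloring\<close>

context linear_square
begin

sublocale one: square_presentation "\<lambda>v w. a v + b w" "\<lambda>v w. c v + d w" "bmw_relations a b c d" Inl Inr
proof
  show "(\<exists>v. x = Inl v) \<or> (\<exists>w. x = Inr w)" for x :: "'v1 + 'v2" by (cases x) auto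
  show "pres_eq (bmw_relations a b c d) [(Inl v, True), (Inr (c v + d w), True)] [(Inr w, True), (Inl (a v + b w), True)]"
    for v w by (rule pres_rel) (auto simp: bmw_relations_def)
  show "\<exists>v w. {l, r} = {[(Inl v, True), (Inr (c v + d w), True)], [(Inr w, True), (Inl (a v + b w), True)]}"
    if "(l, r) \<in> bmw_relations a b c d" for l r
    using that by (auto simp: bmw_relations_def)
qed auto

sublocale two: square_presentation "\<lambda>w v. c v + d w" "\<lambda>w v. a v + b w" "bmw_relations a b c d" Inr Inl
proof (intro square_presentation.intro square_presentation_axioms.intro)
  show "square_complex (\<lambda>w v. c v + d w) (\<lambda>w v. a v + b w)" by (rule swap)
  show "(\<exists>v. x = Inr v) \<or> (\<exists>w. x = Inl w)" for x :: "'v1 + 'v2" by (cases x) auto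
  show "pres_eq (bmw_relations a b c d) [(Inr w, True), (Inl (a v + b w), True)] [(Inl v, True), (Inr (c v + d w), True)]"
    for v w by (rule pres_sym[OF one.square])
  show "\<exists>w v. {l, r} = {[(Inr w, True), (Inl (a v + b w), True)], [(Inl v, True), (Inr (c v + d w), True)]}"
    if R: "(l, r) \<in> bmw_relations a b c d" for l r
  proof -
    obtain v w where vw: "{l, r} = {[(Inl v, True), (Inr (c v + d w), True)], [(Inr w, True), (Inl (a v + b w), True)]}"
      using one.R_imp_square[OF R] by blast
    show ?thesis unfolding vw by (intro exI) (rule insert_commute)
  qed
qed auto

abbreviation "\<Gamma> \<equiv> presented_group (bmw_relations a b c d)"

lemma two_gi: "two.gi = one.gj" and two_gj: "two.gj = one.gi"
  by (simp_all add: fun_eq_iff one.gi_def one.gj_def two.gi_def two.gj_def)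

lemma two_H: "two.H = one.K" and two_K: "two.K = one.H"
  by (simp_all add: one.H_def one.K_def two.H_def two.K_def two_gi two_gj)

lemma identify:
  "bmw_group a b c d = \<Gamma>" "gen1 a b c d = one.gi" "gen2 a b c d = two.gi"
  "base1 a b c d = one.H" "base2 a b c d = two.H" "tree1 a b c d = one.T" "tree2 a b c d = two.T"
proof -
  show *: "bmw_group a b c d = \<Gamma>" "gen1 a b c d = one.gi" "gen2 a b c d = two.gi"
    by (simp_all add: bmw_group_def fun_eq_iff gen1_def gen2_def one.gi_def two.gi_def)
  show "base1 a b c d = one.H" "base2 a b c d = two.H"
    by (simp_all add: base1_def base2_def * one.H_def two.H_def two_gi two_gj)
  then show "tree1 a b c d = one.T" "tree2 a b c d = two.T"
    by (simp_all add: tree1_def tree2_def *)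
qed

text \<open>Two elements with the same projections differ by an element of \<open>one.H\<close> and
  \<open>two.H\<close>, and these intersect trivially.\<close>

lemma vertex_eqI:
  assumes g: "g \<in> carrier \<Gamma>" "g' \<in> carrier \<Gamma>"
    and "g <#\<^bsub>\<Gamma>\<^esub> one.H = g' <#\<^bsub>\<Gamma>\<^esub> one.H" "g <#\<^bsub>\<Gamma>\<^esub> two.H = g' <#\<^bsub>\<Gamma>\<^esub> two.H"
  shows "g = g'"
proof -
  obtain h where h: "h \<in> one.H" "g = g' \<otimes>\<^bsub>\<Gamma>\<^esub> h" using assms(3) g(1) by (rule one.coset_eqE)
  obtain k where k: "k \<in> two.H" "g = g' \<otimes>\<^bsub>\<Gamma>\<^esub> k" using assms(4) g(1) by (rule two.coset_eqE)
  have "g' \<otimes>\<^bsub>\<Gamma>\<^esub> h = g' \<otimes>\<^bsub>\<Gamma>\<^esub> k" using h(2) k(2) by simp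
  then have "h = k" using g(2) one.H_closed[OF h(1)] two.H_closed[OF k(1)] by simp
  then have "h = \<one>\<^bsub>\<Gamma>\<^esub>" using h(1) k(1) one.K_Int_H two_H by blast
  then show ?thesis using h(2) g by simp
qed

definition is_grid :: "'v1 \<Rightarrow> 'v2 \<Rightarrow> (int \<Rightarrow> int \<Rightarrow> 'v1) \<Rightarrow> (int \<Rightarrow> int \<Rightarrow> 'v2) \<Rightarrow>
    (int \<Rightarrow> int \<Rightarrow> ('v1 + 'v2) word set) \<Rightarrow> bool" where
  "is_grid v1 v2 u1 u2 p \<longleftrightarrow> (\<forall>m n. p m n \<in> carrier \<Gamma> \<and>
     p (m + 1) n = p m n \<otimes>\<^bsub>\<Gamma>\<^esub> one.gi (u1 m n) \<and> p m (n + 1) = p m n \<otimes>\<^bsub>\<Gamma>\<^esub> two.gi (u2 m n)) \<and>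
     (\<forall>m. p m 0 = one.gi v1 [^]\<^bsub>\<Gamma>\<^esub> m) \<and> (\<forall>n. p 0 n = two.gi v2 [^]\<^bsub>\<Gamma>\<^esub> n)"

text \<open>Columns are partial products starting on the bottom axis. That horizontal neighbours
  differ by the right generators is clear in row 0 and spreads through the square relations,
  downwards by cancelling a vertical edge.\<close>

lemma grid_exists:
  assumes col: "is_coloring v1 v2 u1 u2"
  shows "\<exists>p. is_grid v1 v2 u1 u2 p"
proof -
  have up: "u1 m (n + 1) = a (u1 m n) + b (u2 m n)" and right: "u2 (m + 1) n = c (u1 m n) + d (u2 m n)"
    and u10: "u1 m 0 = v1" and u20: "u2 0 n = v2" for m n using col by (auto simp: is_coloring_def)
  have "\<exists>q. q 0 = one.gi v1 [^]\<^bsub>\<Gamma>\<^esub> m \<and> (\<forall>n. q n \<in> carrier \<Gamma> \<and> q (n + 1) = q n \<otimes>\<^bsub>\<Gamma>\<^esub> two.gi (u2 m n))" for m :: int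
    by (rule one.G.partial_products) simp_all
  then obtain p where p0: "\<And>m :: int. p m 0 = one.gi v1 [^]\<^bsub>\<Gamma>\<^esub> m"
    and pc [simp]: "\<And>m n. p m n \<in> carrier \<Gamma>" and pup: "\<And>m n. p m (n + 1) = p m n \<otimes>\<^bsub>\<Gamma>\<^esub> two.gi (u2 m n)"
    by metis
  have sq: "one.gi (u1 m n) \<otimes>\<^bsub>\<Gamma>\<^esub> two.gi (u2 (m + 1) n) = two.gi (u2 m n) \<otimes>\<^bsub>\<Gamma>\<^esub> one.gi (u1 m (n + 1))" for m n
    unfolding up right two_gi by (rule one.square_relation)
  have pright: "p (m + 1) n = p m n \<otimes>\<^bsub>\<Gamma>\<^esub> one.gi (u1 m n)" for m n
  proof (induction n rule: int_induct[where k = 0])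
    case base
    show ?case using one.G.int_pow_mult[OF one.gi_closed, of v1 m 1] by (simp add: p0 u10 one.G.int_pow_1)
  next
    case (step1 n)
    have "p (m + 1) (n + 1) = p m n \<otimes>\<^bsub>\<Gamma>\<^esub> (one.gi (u1 m n) \<otimes>\<^bsub>\<Gamma>\<^esub> two.gi (u2 (m + 1) n))"
      by (simp add: pup step1 one.G.m_assoc)
    also have "\<dots> = p m (n + 1) \<otimes>\<^bsub>\<Gamma>\<^esub> one.gi (u1 m (n + 1))"
      unfolding sq by (simp add: pup one.G.m_assoc)
    finally show ?case .
  next
    case (step2 n)
    define n' where "n' = n - 1"
    have n: "n = n' + 1" by (simp add: n'_def)
    have "p (m + 1) n' \<otimes>\<^bsub>\<Gamma>\<^esub> two.gi (u2 (m + 1) n') = p m n' \<otimes>\<^bsub>\<Gamma>\<^esub> (two.gi (u2 m n') \<otimes>\<^bsub>\<Gamma>\<^esub> one.gi (u1 m (n' + 1)))"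
      using step2(2) unfolding n pup by (simp add: one.G.m_assoc)
    also have "\<dots> = (p m n' \<otimes>\<^bsub>\<Gamma>\<^esub> one.gi (u1 m n')) \<otimes>\<^bsub>\<Gamma>\<^esub> two.gi (u2 (m + 1) n')"
      unfolding sq[symmetric] by (simp add: one.G.m_assoc)
    finally have "p (m + 1) n' = p m n' \<otimes>\<^bsub>\<Gamma>\<^esub> one.gi (u1 m n')"
      by (simp add: one.G.right_cancel)
    then show ?case by (simp add: n'_def)
  qed
  have "p 0 n = two.gi v2 [^]\<^bsub>\<Gamma>\<^esub> n" for n
  proof (induction n rule: int_induct[where k = 0])
    case base
    show ?case by (simp add: p0)
  next
    case (step1 n)
    then show ?case
      using one.G.int_pow_mult[OF two.gi_closed, of v2 n 1] by (simp add: pup u20 one.G.int_pow_1)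
  next
    case (step2 n)
    have "p 0 (n - 1) \<otimes>\<^bsub>\<Gamma>\<^esub> two.gi v2 = two.gi v2 [^]\<^bsub>\<Gamma>\<^esub> (n - 1) \<otimes>\<^bsub>\<Gamma>\<^esub> two.gi v2"
      using step2(2) pup[of 0 "n - 1"] one.G.int_pow_mult[OF two.gi_closed, of v2 "n - 1" 1]
      by (simp add: u20 one.G.int_pow_1)
    then show ?case by (simp add: one.G.right_cancel)
  qed
  then have "is_grid v1 v2 u1 u2 p" by (simp add: is_grid_def p0 pup pright)
  then show ?thesis by blast
qed

end

text \<open>Periods close to far apart points of one axis have bounded second coordinates. By the
  pigeonhole principle two of these agree, and the difference is a period along that axis.\<close>

lemma near_lattice_period:
  fixes Per :: "int \<Rightarrow> int \<Rightarrow> bool" and B :: int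
  assumes diff: "\<And>i j i' j'. Per i j \<Longrightarrow> Per i' j' \<Longrightarrow> Per (i' - i) (j' - j)"
    and near: "\<And>s t. \<exists>i j. Per i j \<and> \<bar>s - i\<bar> \<le> B \<and> \<bar>t - j\<bar> \<le> B"
  shows "\<exists>N>0. Per N 0"
proof -
  have B: "0 \<le> B" using near[of 0 0] by linarith
  \<comment> \<open>With spacing 2B + 1, first coordinates that are B-close to distinct points of
    the axis stay in order.\<close>
  define C where "C = 2 * B + 1"
  have "\<exists>i j. Per i j \<and> \<bar>int k * C - i\<bar> \<le> B \<and> \<bar>0 - j\<bar> \<le> B" for k :: nat
    by (rule near)
  then obtain I J where IJ: "\<And>k :: nat. Per (I k) (J k) \<and> \<bar>int k * C - I k\<bar> \<le> B \<and> \<bar>0 - J k\<bar> \<le> B"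
    by metis
  have "range J \<subseteq> {- B..B}"
  proof
    fix y assume "y \<in> range J"
    then obtain k where "y = J k" by blast
    then show "y \<in> {- B..B}" using IJ[of k] by simp linarith
  qed
  then have "finite (range J)" by (rule finite_subset) simp
  then have "\<not> inj J" using finite_imageD infinite_UNIV_nat by blast
  then obtain k k' where k: "k < k'" "J k = J k'"
    unfolding inj_def by (metis linorder_neqE_nat)
  have "(int k + 1) * C \<le> int k' * C"
    using k(1) B by (intro mult_right_mono) (auto simp: C_def)
  then have "int k * C + C \<le> int k' * C" by (simp only: distrib_right mult_1)
  then have "0 < I k' - I k"
    using IJ[of k] IJ[of k'] C_def by linarith
  moreover have "Per (I k' - I k) 0"
    using diff[of "I k" "J k" "I k'" "J k'"] IJ[of k] IJ[of k'] k(2) by simp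
  ultimately show ?thesis by blast
qed

section \<open>The flat of a coloring\<close>

locale bmw_plane = linear_square scale1 scale2 bs1 bs2 a b c d
  for scale1 :: "'f::{field,finite} \<Rightarrow> 'v1::ab_group_add \<Rightarrow> 'v1"
    and scale2 :: "'f \<Rightarrow> 'v2::ab_group_add \<Rightarrow> 'v2"
    and bs1 :: "'v1 list" and bs2 :: "'v2 list"
    and a :: "'v1 \<Rightarrow> 'v1" and b :: "'v2 \<Rightarrow> 'v1" and c :: "'v1 \<Rightarrow> 'v2" and d :: "'v2 \<Rightarrow> 'v2" +
  fixes v1 :: 'v1 and v2 :: 'v2 and u1 :: "int \<Rightarrow> int \<Rightarrow> 'v1" and u2 :: "int \<Rightarrow> int \<Rightarrow> 'v2"
    and p :: "int \<Rightarrow> int \<Rightarrow> ('v1 + 'v2) word set"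
  assumes grid: "is_grid v1 v2 u1 u2 p"
    and aperiodic: "\<And>N. 0 < N \<Longrightarrow> \<not> doubly_periodic N u1 u2"
begin

lemma p_closed [simp]: "p m n \<in> carrier \<Gamma>"
  and p_right: "p (m + 1) n = p m n \<otimes>\<^bsub>\<Gamma>\<^esub> one.gi (u1 m n)"
  and p_up: "p m (n + 1) = p m n \<otimes>\<^bsub>\<Gamma>\<^esub> two.gi (u2 m n)"
  and p_bottom: "p m 0 = one.gi v1 [^]\<^bsub>\<Gamma>\<^esub> m"
  and p_left: "p 0 n = two.gi v2 [^]\<^bsub>\<Gamma>\<^esub> n"
  using grid by (auto simp: is_grid_def)

text \<open>Vertical steps multiply on the right by elements of \<open>one.H\<close>, so they do not
  change the projection to the first tree.\<close>

lemma coset1: "p m n <#\<^bsub>\<Gamma>\<^esub> one.H = one.line v1 m"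
proof (induction n rule: int_induct[where k = 0])
  case base
  show ?case by (simp add: p_bottom)
next
  case (step1 n)
  have "two.gi (u2 m n) \<in> one.H" unfolding two_gi by (rule one.gj_in_H)
  then show ?case using step1(2) by (simp add: p_up one.coset_mult_H)
next
  case (step2 n)
  have "two.gi (u2 m (n - 1)) \<in> one.H" unfolding two_gi by (rule one.gj_in_H)
  then have "p m (n - 1 + 1) <#\<^bsub>\<Gamma>\<^esub> one.H = p m (n - 1) <#\<^bsub>\<Gamma>\<^esub> one.H"
    unfolding p_up by (rule one.coset_mult_H[OF p_closed])
  then show ?case using step2(2) by simp
qed

lemma coset2: "p m n <#\<^bsub>\<Gamma>\<^esub> two.H = two.line v2 n"
proof (induction m rule: int_induct[where k = 0])
  case base
  show ?case by (simp add: p_left)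
next
  case (step1 m)
  have "one.gi (u1 m n) \<in> two.H" unfolding two_gj[symmetric] by (rule two.gj_in_H)
  then show ?case using step1(2) by (simp add: p_right two.coset_mult_H)
next
  case (step2 m)
  have "one.gi (u1 (m - 1) n) \<in> two.H" unfolding two_gj[symmetric] by (rule two.gj_in_H)
  then have "p (m - 1 + 1) n <#\<^bsub>\<Gamma>\<^esub> two.H = p (m - 1) n <#\<^bsub>\<Gamma>\<^esub> two.H"
    unfolding p_right by (rule two.coset_mult_H[OF p_closed])
  then show ?case using step2(2) by simp
qed

sublocale ax1: graph_axis one.T "one.line v1" "\<lambda>x. word_pos v1 (one.vertex_word x)" "\<lambda>x. word_off v1 (one.vertex_word x)"
  by (rule one.is_axis)

sublocale ax2: graph_axis two.T "two.line v2" "\<lambda>x. word_pos v2 (two.vertex_word x)" "\<lambda>x. word_off v2 (two.vertex_word x)"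
  by (rule two.is_axis)

sublocale flat: two_lines "realization one.T" "realization_dist one.T" "realization two.T" "realization_dist two.T"
    ax1.point ax2.point
proof (intro two_lines.intro two_lines_axioms.intro Metric_space12.intro)
  show "Metric_space (realization one.T) (realization_dist one.T)" by (rule one.T.metric_space)
  show "Metric_space (realization two.T) (realization_dist two.T)" by (rule two.T.metric_space)
qed (simp_all add: ax1.point_dist ax2.point_dist ax1.between_points ax2.between_points)

abbreviation "act \<equiv> bmw_action a b c d"
abbreviation "vertex \<equiv> bmw_vertex a b c d"

lemma act_eq: "act g = map_prod (one.tr g) (two.tr g)"
  by (simp add: bmw_action_def bmw_rep_def identify)

lemma vertex_eq: "vertex g = (vertex_point (g <#\<^bsub>\<Gamma>\<^esub> one.H), vertex_point (g <#\<^bsub>\<Gamma>\<^esub> two.H))"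
  by (simp add: bmw_vertex_def identify)

lemma vertex_grid: "vertex (p m n) = (ax1.point (of_int m), ax2.point (of_int n))"
  unfolding vertex_eq coset1 coset2 ax1.point_int ax2.point_int ..

lemma act_vertex: "g \<in> carrier \<Gamma> \<Longrightarrow> x \<in> carrier \<Gamma> \<Longrightarrow> act g (vertex x) = vertex (g \<otimes>\<^bsub>\<Gamma>\<^esub> x)"
  by (simp add: act_eq vertex_eq one.tr_vertex two.tr_vertex)

lemma act_isometry:
  assumes g: "g \<in> carrier \<Gamma>"
  shows "isometry_of flat.X flat.d (act g)"
proof -
  have 1: "isometry_of (realization one.T) (realization_dist one.T) (one.tr g)"
    by (rule graph_automorphism.map_isometry[OF one.is_automorphism[OF g]])
  have 2: "isometry_of (realization two.T) (realization_dist two.T) (two.tr g)"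
    by (rule graph_automorphism.map_isometry[OF two.is_automorphism[OF g]])
  have "bij_betw (map_prod (one.tr g) (two.tr g)) flat.X flat.X"
    using 1 2 unfolding isometry_of_def by (intro bij_betw_map_prod) auto
  moreover have "flat.d (act g x) (act g y) = flat.d x y" if "x \<in> flat.X" "y \<in> flat.X" for x y
    using 1 2 that unfolding isometry_of_def act_eq by (auto simp: prod_dist_def)
  ultimately show ?thesis unfolding isometry_of_def act_eq by blast
qed

lemma d_ge1: "realization_dist one.T (fst x) (fst y) \<le> flat.d x y"
  and d_ge2: "realization_dist two.T (snd x) (snd y) \<le> flat.d x y"
  by (simp_all add: prod_dist_def case_prod_unfold real_le_rsqrt)

lemma act_fixes1: "h \<in> one.H \<Longrightarrow> one.tr h (ax1.point 0) = ax1.point 0"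
proof -
  assume h: "h \<in> one.H"
  have hc: "h \<in> carrier \<Gamma>" using h by (rule one.H_closed)
  have pt: "ax1.point 0 = vertex_point (\<one>\<^bsub>\<Gamma>\<^esub> <#\<^bsub>\<Gamma>\<^esub> one.H)"
    using ax1.point_int[of 0] by simp
  have "(h \<otimes>\<^bsub>\<Gamma>\<^esub> \<one>\<^bsub>\<Gamma>\<^esub>) <#\<^bsub>\<Gamma>\<^esub> one.H = \<one>\<^bsub>\<Gamma>\<^esub> <#\<^bsub>\<Gamma>\<^esub> one.H"
    using one.coset_mult_H[OF one.G.one_closed h] hc by simp
  then show ?thesis unfolding pt one.tr_vertex[OF hc one.G.one_closed] by simp
qed

lemma act_fixes2: "h \<in> two.H \<Longrightarrow> two.tr h (ax2.point 0) = ax2.point 0"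
proof -
  assume h: "h \<in> two.H"
  have hc: "h \<in> carrier \<Gamma>" using h by (rule two.H_closed)
  have pt: "ax2.point 0 = vertex_point (\<one>\<^bsub>\<Gamma>\<^esub> <#\<^bsub>\<Gamma>\<^esub> two.H)"
    using ax2.point_int[of 0] by simp
  have "(h \<otimes>\<^bsub>\<Gamma>\<^esub> \<one>\<^bsub>\<Gamma>\<^esub>) <#\<^bsub>\<Gamma>\<^esub> two.H = \<one>\<^bsub>\<Gamma>\<^esub> <#\<^bsub>\<Gamma>\<^esub> two.H"
    using two.coset_mult_H[OF one.G.one_closed h] hc by simp
  then show ?thesis unfolding pt two.tr_vertex[OF hc one.G.one_closed] by simp
qed

lemma act_line1: "act (one.gi v1) (ax1.point t, ax2.point 0) = (ax1.point (t + 1), ax2.point 0)"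
proof -
  have "one.gi v1 \<in> two.H" unfolding two_gj[symmetric] by (rule two.gj_in_H)
  then show ?thesis by (simp add: act_eq one.tr_axis act_fixes2)
qed

lemma act_line2: "act (two.gi v2) (ax1.point 0, ax2.point t) = (ax1.point 0, ax2.point (t + 1))"
proof -
  have "two.gi v2 \<in> one.H" unfolding two_gi by (rule one.gj_in_H)
  then show ?thesis by (simp add: act_eq two.tr_axis act_fixes1)
qed

text \<open>The origin is moved by 1, and \<open>displacement\<close> shows that no point is moved
  by less, as the generator has height 1.\<close>

lemma hyperbolic1: "hyperbolic_isometry flat.X flat.d (act (one.gi v1))"
  unfolding hyperbolic_isometry_def
proof (intro conjI bexI[of _ "(ax1.point 0, ax2.point 0)"] ballI)
  let ?o = "(ax1.point 0, ax2.point 0)"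
  have o: "flat.d ?o (act (one.gi v1) ?o) = 1"
    unfolding act_line1 flat.d_flat by (simp add: dist_prod_def dist_real_def)
  then show "0 < flat.d ?o (act (one.gi v1) ?o)" by simp
  fix y assume "y \<in> flat.X"
  then have "1 \<le> realization_dist one.T (fst y) (one.tr (one.gi v1) (fst y))"
    using one.displacement[of "one.gi v1" "fst y"] by auto
  also have "\<dots> \<le> flat.d y (act (one.gi v1) y)"
    using d_ge1[of y "act (one.gi v1) y"] by (simp add: act_eq)
  finally show "flat.d ?o (act (one.gi v1) ?o) \<le> flat.d y (act (one.gi v1) y)" using o by simp
qed (simp_all add: act_isometry)

lemma hyperbolic2: "hyperbolic_isometry flat.X flat.d (act (two.gi v2))"
  unfolding hyperbolic_isometry_def
proof (intro conjI bexI[of _ "(ax1.point 0, ax2.point 0)"] ballI)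
  let ?o = "(ax1.point 0, ax2.point 0)"
  have o: "flat.d ?o (act (two.gi v2) ?o) = 1"
    unfolding act_line2 flat.d_flat by (simp add: dist_prod_def dist_real_def)
  then show "0 < flat.d ?o (act (two.gi v2) ?o)" by simp
  fix y assume "y \<in> flat.X"
  then have "1 \<le> realization_dist two.T (snd y) (two.tr (two.gi v2) (snd y))"
    using two.displacement[of "two.gi v2" "snd y"] by auto
  also have "\<dots> \<le> flat.d y (act (two.gi v2) y)"
    using d_ge2[of y "act (two.gi v2) y"] by (simp add: act_eq)
  finally show "flat.d ?o (act (two.gi v2) ?o) \<le> flat.d y (act (two.gi v2) y)" using o by simp
qed (simp_all add: act_isometry)

lemma axis1: "translation_axis flat.X flat.d (act (one.gi v1)) flat.L1"
  unfolding translation_axis_def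
proof (intro exI conjI allI)
  show "geodesic_line flat.X flat.d (\<lambda>t. (ax1.point t, ax2.point 0))" by (rule flat.line1)
  show "flat.L1 = range (\<lambda>t. (ax1.point t, ax2.point 0))" by auto
  show "act (one.gi v1) (ax1.point t, ax2.point 0) = (ax1.point (t + 1), ax2.point 0)" for t
    by (rule act_line1)
qed simp

lemma axis2: "translation_axis flat.X flat.d (act (two.gi v2)) flat.L2"
  unfolding translation_axis_def
proof (intro exI conjI allI)
  show "geodesic_line flat.X flat.d (\<lambda>t. (ax1.point 0, ax2.point t))" by (rule flat.line2)
  show "flat.L2 = range (\<lambda>t. (ax1.point 0, ax2.point t))" by auto
  show "act (two.gi v2) (ax1.point 0, ax2.point t) = (ax1.point 0, ax2.point (t + 1))" for t
    by (rule act_line2)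
qed simp

section \<open>Periods of the coloring and cocompactness\<close>

definition period :: "int \<Rightarrow> int \<Rightarrow> bool" where
  "period i j \<longleftrightarrow> (\<forall>m n. u1 (m + i) (n + j) = u1 m n \<and> u2 (m + i) (n + j) = u2 m n)"

lemma period_diff:
  assumes "period i j" "period i' j'"
  shows "period (i' - i) (j' - j)"
  unfolding period_def
proof (intro allI)
  fix m n
  have "m + (i' - i) + i = m + i'" "n + (j' - j) + j = n + j'" by simp_all
  then show "u1 (m + (i' - i)) (n + (j' - j)) = u1 m n \<and> u2 (m + (i' - i)) (n + (j' - j)) = u2 m n"
    using assms unfolding period_def by metis
qed

lemma no_periods:
  assumes "period N 0" "period 0 N'" "0 < N" "0 < N'"
  shows False
proof -
  have 1: "period (N * int t) 0" for t
  proof (induction t)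
    case (Suc t)
    have "m + N * int (Suc t) = (m + N * int t) + N" for m by (simp add: algebra_simps)
    then show ?case using Suc assms(1) unfolding period_def by (metis add.right_neutral)
  qed (simp add: period_def)
  have 2: "period 0 (N' * int t)" for t
  proof (induction t)
    case (Suc t)
    have "m + N' * int (Suc t) = (m + N' * int t) + N'" for m by (simp add: algebra_simps)
    then show ?case using Suc assms(2) unfolding period_def by (metis add.right_neutral)
  qed (simp add: period_def)
  have "doubly_periodic (N * N') u1 u2"
    using 1[of "nat N'"] 2[of "nat N"] assms(3,4)
    by (simp add: doubly_periodic_def period_def mult.commute[of N' N])
  then show False using aperiodic[of "N * N'"] assms(3,4) by simp
qed

text \<open>A vertex is determined by its projections, so g maps the grid to its translate by (i,
  j). Edge labels are invariant under left multiplication, hence the coloring is translated as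
  well.\<close>

lemma periodI:
  assumes g: "g \<in> carrier \<Gamma>"
    and 1: "\<And>m n. (g \<otimes>\<^bsub>\<Gamma>\<^esub> p m n) <#\<^bsub>\<Gamma>\<^esub> one.H = one.line v1 (m + i)"
    and 2: "\<And>m n. (g \<otimes>\<^bsub>\<Gamma>\<^esub> p m n) <#\<^bsub>\<Gamma>\<^esub> two.H = two.line v2 (n + j)"
  shows "period i j"
proof -
  have eq: "p (m + i) (n + j) = g \<otimes>\<^bsub>\<Gamma>\<^esub> p m n" for m n
    by (rule vertex_eqI) (simp_all add: g 1 2 coset1 coset2)
  show ?thesis unfolding period_def
  proof (intro allI conjI)
    fix m n
    have "g \<otimes>\<^bsub>\<Gamma>\<^esub> p m n \<otimes>\<^bsub>\<Gamma>\<^esub> one.gi (u1 (m + i) (n + j)) = p (m + 1 + i) (n + j)"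
    proof -
      have s: "m + 1 + i = m + i + 1" by simp
      show ?thesis unfolding eq[symmetric] s p_right ..
    qed
    also have "\<dots> = g \<otimes>\<^bsub>\<Gamma>\<^esub> p m n \<otimes>\<^bsub>\<Gamma>\<^esub> one.gi (u1 m n)"
      unfolding eq p_right using g by (simp add: one.G.m_assoc)
    finally have "one.gi (u1 (m + i) (n + j)) = one.gi (u1 m n)"
      using g by simp
    then show "u1 (m + i) (n + j) = u1 m n" by (simp only: one.gi_inject)
    have "g \<otimes>\<^bsub>\<Gamma>\<^esub> p m n \<otimes>\<^bsub>\<Gamma>\<^esub> two.gi (u2 (m + i) (n + j)) = p (m + i) (n + 1 + j)"
    proof -
      have s: "n + 1 + j = n + j + 1" by simp
      show ?thesis unfolding eq[symmetric] s p_up ..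
    qed
    also have "\<dots> = g \<otimes>\<^bsub>\<Gamma>\<^esub> p m n \<otimes>\<^bsub>\<Gamma>\<^esub> two.gi (u2 m n)"
      unfolding eq p_up using g by (simp add: one.G.m_assoc)
    finally have "two.gi (u2 (m + i) (n + j)) = two.gi (u2 m n)"
      using g by simp
    then show "u2 (m + i) (n + j) = u2 m n" by (simp only: two.gi_inject)
  qed
qed

text \<open>An element preserving the flat preserves its grid of vertices and respects the labels and
  orientations of the edges, so it translates the coloring by its two heights.\<close>

lemma stabilizer_period:
  assumes g: "g \<in> carrier \<Gamma>" and P: "act g ` flat.P = flat.P"
  shows "period (one.height g) (two.height g)"
proof (rule periodI[OF g])
  fix m n
  have "vertex (p m n) \<in> flat.P" by (simp add: vertex_grid)
  then have "act g (vertex (p m n)) \<in> act g ` flat.P" by (rule imageI)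
  then have "vertex (g \<otimes>\<^bsub>\<Gamma>\<^esub> p m n) \<in> flat.P" using act_vertex[OF g p_closed] P by simp
  then obtain s t where s: "vertex_point ((g \<otimes>\<^bsub>\<Gamma>\<^esub> p m n) <#\<^bsub>\<Gamma>\<^esub> one.H) = ax1.point s"
    and t: "vertex_point ((g \<otimes>\<^bsub>\<Gamma>\<^esub> p m n) <#\<^bsub>\<Gamma>\<^esub> two.H) = ax2.point t"
    unfolding vertex_eq by blast
  have gp: "g \<otimes>\<^bsub>\<Gamma>\<^esub> p m n \<in> carrier \<Gamma>" using g by simp
  have h1: "one.height (p m n) = m"
    using arg_cong[OF coset1[of m n], of one.vertex_height]
    by (simp add: one.vertex_height_coset one.height_int_pow)
  have h2: "two.height (p m n) = n"
    using arg_cong[OF coset2[of m n], of two.vertex_height]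
    by (simp add: two.vertex_height_coset two.height_int_pow)
  \<comment> \<open>Along the axis the height is the parameter, so s is the height of the translated
    vertex.\<close>
  have "s = of_int (m + one.height g)"
    using arg_cong[OF s, of one.height_ext] one.height_ext_vertex[OF gp] one.height_mult[OF g p_closed, of m n]
    by (simp add: one.height_ext_axis h1)
  then have "vertex_point ((g \<otimes>\<^bsub>\<Gamma>\<^esub> p m n) <#\<^bsub>\<Gamma>\<^esub> one.H) = vertex_point (one.line v1 (m + one.height g))"
    unfolding s by (simp only: ax1.point_int)
  then show "(g \<otimes>\<^bsub>\<Gamma>\<^esub> p m n) <#\<^bsub>\<Gamma>\<^esub> one.H = one.line v1 (m + one.height g)"
    by (simp only: one.vertex_point_inject)
  have "t = of_int (n + two.height g)"
    using arg_cong[OF t, of two.height_ext] two.height_ext_vertex[OF gp] two.height_mult[OF g p_closed, of m n]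
    by (simp add: two.height_ext_axis h2)
  then have "vertex_point ((g \<otimes>\<^bsub>\<Gamma>\<^esub> p m n) <#\<^bsub>\<Gamma>\<^esub> two.H) = vertex_point (two.line v2 (n + two.height g))"
    unfolding t by (simp only: ax2.point_int)
  then show "(g \<otimes>\<^bsub>\<Gamma>\<^esub> p m n) <#\<^bsub>\<Gamma>\<^esub> two.H = two.line v2 (n + two.height g)"
    by (simp only: two.vertex_point_inject)
qed

text \<open>Heights are bounded on a compact set. Every vertex of the flat would be the image of a
  point of that set under some element of the stabilizer, whose two heights are a period; so there
  would be periods within bounded distance of all lattice points, and
  \<open>near_lattice_period\<close> would yield one along each axis.\<close>

lemma not_cocompact: "\<not> acts_cocompactly flat.X flat.d act {g \<in> carrier \<Gamma>. act g ` flat.P = flat.P} flat.P"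
proof
  define S where "S = {g \<in> carrier \<Gamma>. act g ` flat.P = flat.P}"
  assume "acts_cocompactly flat.X flat.d act {g \<in> carrier \<Gamma>. act g ` flat.P = flat.P} flat.P"
  then obtain K where K: "K \<subseteq> flat.P" "compactin (Metric_space.mtopology flat.X flat.d) K"
    and cover: "(\<Union>g\<in>S. act g ` K) = flat.P"
    unfolding acts_cocompactly_def S_def by blast
  have "flat.Prod_metric.mbounded K" using K(2) by (rule flat.Prod_metric.compactin_imp_mbounded)
  then obtain x0 r where "K \<subseteq> flat.Prod_metric.mcball x0 r" unfolding flat.Prod_metric.mbounded_def by blast
  then have near0: "x0 \<in> flat.X \<and> z \<in> flat.X \<and> flat.d x0 z \<le> r" if "z \<in> K" for z
    using that by (auto simp: flat.Prod_metric.in_mcball)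
  define B where "B = r + \<bar>one.height_ext (fst x0)\<bar> + \<bar>two.height_ext (snd x0)\<bar>"
  have bound: "\<bar>one.height_ext (fst z)\<bar> \<le> B \<and> \<bar>two.height_ext (snd z)\<bar> \<le> B" if z: "z \<in> K" for z
  proof -
    have "\<bar>one.height_ext (fst x0) - one.height_ext (fst z)\<bar> \<le> r"
      using near0[OF z] one.height_ext_lipschitz[of "fst x0" "fst z"] d_ge1[of x0 z] by fastforce
    moreover have "\<bar>two.height_ext (snd x0) - two.height_ext (snd z)\<bar> \<le> r"
      using near0[OF z] two.height_ext_lipschitz[of "snd x0" "snd z"] d_ge2[of x0 z] by fastforce
    ultimately show ?thesis unfolding B_def by linarith
  qed
  have near: "\<exists>i j. period i j \<and> \<bar>s - i\<bar> \<le> \<lceil>B\<rceil> \<and> \<bar>t - j\<bar> \<le> \<lceil>B\<rceil>" for s t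
  proof -
    have "(ax1.point (of_int s), ax2.point (of_int t)) \<in> (\<Union>g\<in>S. act g ` K)" unfolding cover by simp
    then obtain g z where gz: "g \<in> S" "z \<in> K" "(ax1.point (of_int s), ax2.point (of_int t)) = act g z"
      by blast
    have g: "g \<in> carrier \<Gamma>" "act g ` flat.P = flat.P" using gz(1) by (auto simp: S_def)
    have zX: "fst z \<in> realization one.T" "snd z \<in> realization two.T" using near0[OF gz(2)] by auto
    have "ax1.point (of_int s) = one.tr g (fst z)" "ax2.point (of_int t) = two.tr g (snd z)"
      using gz(3) by (simp_all add: act_eq map_prod_def case_prod_unfold)
    then have "real_of_int s = one.height_ext (fst z) + one.height g"
      "real_of_int t = two.height_ext (snd z) + two.height g"
      using one.height_ext_tr[OF g(1) zX(1)] two.height_ext_tr[OF g(1) zX(2)]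
        one.height_ext_axis[of v1 "of_int s"] two.height_ext_axis[of v2 "of_int t"] by simp_all
    then have "\<bar>real_of_int (s - one.height g)\<bar> \<le> B" "\<bar>real_of_int (t - two.height g)\<bar> \<le> B"
      using bound[OF gz(2)] by simp_all
    then have "real_of_int \<bar>s - one.height g\<bar> \<le> of_int \<lceil>B\<rceil>" "real_of_int \<bar>t - two.height g\<bar> \<le> of_int \<lceil>B\<rceil>"
      using le_of_int_ceiling[of B] by (simp_all only: of_int_abs)
    then have "\<bar>s - one.height g\<bar> \<le> \<lceil>B\<rceil>" "\<bar>t - two.height g\<bar> \<le> \<lceil>B\<rceil>"
      by (simp_all only: of_int_le_iff)
    then show ?thesis using stabilizer_period[OF g] by blast
  qed
  obtain N where N: "0 < N" "period N 0"
    using near_lattice_period[of period, OF period_diff near] by blast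
  have "\<exists>N>0. period 0 N"
  proof (rule near_lattice_period[of "\<lambda>i j. period j i"])
    show "period (j' - j) (i' - i)" if "period j i" "period j' i'" for i j i' j'
      using that by (rule period_diff)
    show "\<exists>i j. period j i \<and> \<bar>s - i\<bar> \<le> \<lceil>B\<rceil> \<and> \<bar>t - j\<bar> \<le> \<lceil>B\<rceil>" for s t
      using near[of t s] by blast
  qed
  then obtain N' where N': "0 < N'" "period 0 N'" by blast
  show False using no_periods[OF N(2) N'(2) N(1) N'(1)] .
qed

lemma is_anti_torus: "anti_torus \<Gamma> flat.X flat.d act (one.gi v1) (two.gi v2) flat.L1 flat.L2 flat.P"
  unfolding anti_torus_def
  using hyperbolic1 hyperbolic2 axis1 axis2 flat.not_parallel flat.flat flat.hull not_cocompact
  by (simp only: one.gi_closed two.gi_closed simp_thms)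

lemma origin_on_axes: "vertex \<one>\<^bsub>\<Gamma>\<^esub> \<in> flat.L1" "vertex \<one>\<^bsub>\<Gamma>\<^esub> \<in> flat.L2"
  using vertex_grid[of 0 0] p_bottom[of 0] by simp_all

lemma is_natural_coloring:
  "natural_coloring a b c d flat.P v1 v2 (\<lambda>(m, n). (u1 m n, u2 m n))"
  unfolding natural_coloring_def Let_def identify
proof (intro exI[of _ p] allI conjI)
  fix m n
  show "p m n \<in> carrier \<Gamma>" by simp
  show "vertex (p m n) \<in> flat.P" by (simp add: vertex_grid)
  show "fst (vertex (p m n)) = fst (vertex (one.gi v1 [^]\<^bsub>\<Gamma>\<^esub> m))"
    by (simp add: vertex_eq coset1)
  show "snd (vertex (p m n)) = snd (vertex (two.gi v2 [^]\<^bsub>\<Gamma>\<^esub> n))"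
    by (simp add: vertex_eq coset2)
  show "inv\<^bsub>\<Gamma>\<^esub> p m n \<otimes>\<^bsub>\<Gamma>\<^esub> p (m + 1) n = one.gi (fst (case (m, n) of (m, n) \<Rightarrow> (u1 m n, u2 m n)))"
    by (simp add: p_right one.G.m_assoc[symmetric])
  show "inv\<^bsub>\<Gamma>\<^esub> p m n \<otimes>\<^bsub>\<Gamma>\<^esub> p m (n + 1) = two.gi (snd (case (m, n) of (m, n) \<Rightarrow> (u1 m n, u2 m n)))"
    by (simp add: p_up one.G.m_assoc[symmetric])
qed

section \<open>Irreducibility\<close>

lemma power_in_finite_index:
  assumes H': "subgroup H' \<Gamma>" and fin: "finite (rcosets\<^bsub>\<Gamma>\<^esub> H')" and x: "x \<in> carrier \<Gamma>"
  obtains N :: nat where "0 < N" "x [^]\<^bsub>\<Gamma>\<^esub> N \<in> H'"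
proof -
  have "range (\<lambda>n :: nat. H' #>\<^bsub>\<Gamma>\<^esub> (x [^]\<^bsub>\<Gamma>\<^esub> n)) \<subseteq> rcosets\<^bsub>\<Gamma>\<^esub> H'"
    using x by (auto simp: RCOSETS_def)
  then have "finite (range (\<lambda>n :: nat. H' #>\<^bsub>\<Gamma>\<^esub> (x [^]\<^bsub>\<Gamma>\<^esub> n)))" using fin by (rule finite_subset)
  then have "\<not> inj (\<lambda>n :: nat. H' #>\<^bsub>\<Gamma>\<^esub> (x [^]\<^bsub>\<Gamma>\<^esub> n))" using finite_imageD infinite_UNIV_nat by blast
  then obtain i j :: nat where ij: "i < j" "H' #>\<^bsub>\<Gamma>\<^esub> (x [^]\<^bsub>\<Gamma>\<^esub> i) = H' #>\<^bsub>\<Gamma>\<^esub> (x [^]\<^bsub>\<Gamma>\<^esub> j)"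
    unfolding inj_def by (metis linorder_neqE_nat)
  have "x [^]\<^bsub>\<Gamma>\<^esub> j \<in> H' #>\<^bsub>\<Gamma>\<^esub> (x [^]\<^bsub>\<Gamma>\<^esub> j)"
    using x by (intro one.G.rcos_self H') simp
  then obtain h where h: "h \<in> H'" "x [^]\<^bsub>\<Gamma>\<^esub> j = h \<otimes>\<^bsub>\<Gamma>\<^esub> x [^]\<^bsub>\<Gamma>\<^esub> i"
    unfolding ij(2)[symmetric] by (auto simp: r_coset_def)
  have "x [^]\<^bsub>\<Gamma>\<^esub> (j - i) \<otimes>\<^bsub>\<Gamma>\<^esub> x [^]\<^bsub>\<Gamma>\<^esub> i = h \<otimes>\<^bsub>\<Gamma>\<^esub> x [^]\<^bsub>\<Gamma>\<^esub> i"
    using x ij(1) by (simp add: one.G.nat_pow_mult h(2)[symmetric])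
  then have "x [^]\<^bsub>\<Gamma>\<^esub> (j - i) = h"
    using x subgroup.mem_carrier[OF H' h(1)] by (subst (asm) one.G.right_cancel) simp_all
  then show ?thesis using that[of "j - i"] h(1) ij(1) by simp
qed

lemma translation_one:
  assumes "g \<in> carrier \<Gamma>"
  shows "left_translation \<Gamma> one.T g (\<one>\<^bsub>\<Gamma>\<^esub> <#\<^bsub>\<Gamma>\<^esub> one.H) = g <#\<^bsub>\<Gamma>\<^esub> one.H"
    "left_translation \<Gamma> two.T g (\<one>\<^bsub>\<Gamma>\<^esub> <#\<^bsub>\<Gamma>\<^esub> two.H) = g <#\<^bsub>\<Gamma>\<^esub> two.H"
  using one.translation_coset[OF assms one.G.one_closed] two.translation_coset[OF assms one.G.one_closed] assms
  by simp_all

lemma one_graph_aut: "\<one>\<^bsub>graph_aut T\<^esub> = (\<lambda>x\<in>verts T. x)"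
  by (simp add: graph_aut_def BijGroup_def)

text \<open>In a product \<open>\<Lambda>\<^sub>1 \<times> \<Lambda>\<^sub>2\<close> of finite index, a power of \<open>v1\<close> would act trivially on the second
  tree, since it shares its image of the base vertex with an element acting trivially there.\<close>

lemma irreducible: "bmw_irreducible a b c d"
  unfolding bmw_irreducible_def identify
proof
  assume "\<exists>H \<Lambda>\<^sub>1 \<Lambda>\<^sub>2. subgroup H \<Gamma> \<and> finite (rcosets\<^bsub>\<Gamma>\<^esub> H) \<and> subgroup \<Lambda>\<^sub>1 (graph_aut one.T) \<and>
    subgroup \<Lambda>\<^sub>2 (graph_aut two.T) \<and> bmw_rep a b c d ` H = \<Lambda>\<^sub>1 \<times> \<Lambda>\<^sub>2"
  then obtain H' \<Lambda>\<^sub>1 \<Lambda>\<^sub>2 where H': "subgroup H' \<Gamma>" "finite (rcosets\<^bsub>\<Gamma>\<^esub> H')"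
    and L: "subgroup \<Lambda>\<^sub>1 (graph_aut one.T)" "subgroup \<Lambda>\<^sub>2 (graph_aut two.T)"
    and rep: "bmw_rep a b c d ` H' = \<Lambda>\<^sub>1 \<times> \<Lambda>\<^sub>2" by blast
  have rep_eq: "bmw_rep a b c d g = (left_translation \<Gamma> one.T g, left_translation \<Gamma> two.T g)" for g
    by (simp add: bmw_rep_def identify)
  have id: "(\<lambda>x\<in>verts one.T. x) \<in> \<Lambda>\<^sub>1" "(\<lambda>x\<in>verts two.T. x) \<in> \<Lambda>\<^sub>2"
    using subgroup.one_closed[OF L(1)] subgroup.one_closed[OF L(2)] by (simp_all only: one_graph_aut)
  have base: "\<one>\<^bsub>\<Gamma>\<^esub> <#\<^bsub>\<Gamma>\<^esub> one.H \<in> verts one.T" "\<one>\<^bsub>\<Gamma>\<^esub> <#\<^bsub>\<Gamma>\<^esub> two.H \<in> verts two.T" by simp_all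
  obtain N :: nat where N: "0 < N" "one.gi v1 [^]\<^bsub>\<Gamma>\<^esub> N \<in> H'"
    using power_in_finite_index[OF H' one.gi_closed] by blast
  obtain N' :: nat where N': "0 < N'" "two.gi v2 [^]\<^bsub>\<Gamma>\<^esub> N' \<in> H'"
    using power_in_finite_index[OF H' two.gi_closed] by blast
  let ?x = "one.gi v1 [^]\<^bsub>\<Gamma>\<^esub> N" let ?y = "two.gi v2 [^]\<^bsub>\<Gamma>\<^esub> N'"
  have "one.gi v1 [^]\<^bsub>\<Gamma>\<^esub> n \<in> two.H" for n :: nat
    using subgroup.one_closed[OF two.subgroup_H] subgroup.m_closed[OF two.subgroup_H] two.gj_in_H[of v1]
    by (induction n) (simp_all add: two_gj)
  then have xK: "?x \<in> two.H" .
  have "two.gi v2 [^]\<^bsub>\<Gamma>\<^esub> n \<in> one.H" for n :: nat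
    using subgroup.one_closed[OF one.subgroup_H] subgroup.m_closed[OF one.subgroup_H] one.gj_in_H[of v2]
    by (induction n) (simp_all add: two_gi)
  then have yH: "?y \<in> one.H" .
  have "(left_translation \<Gamma> one.T ?x, left_translation \<Gamma> two.T ?x) \<in> \<Lambda>\<^sub>1 \<times> \<Lambda>\<^sub>2"
    unfolding rep_eq[symmetric] rep[symmetric] using N(2) by (rule imageI)
  \<comment> \<open>A product contains, with this pair, the pair whose second component is replaced
    by the identity.\<close>
  then have "(left_translation \<Gamma> one.T ?x, \<lambda>x\<in>verts two.T. x) \<in> bmw_rep a b c d ` H'"
    unfolding rep using id by blast
  then obtain h where h: "h \<in> H'" "left_translation \<Gamma> one.T h = left_translation \<Gamma> one.T ?x"
    "left_translation \<Gamma> two.T h = (\<lambda>x\<in>verts two.T. x)" unfolding rep_eq by auto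
  have hc: "h \<in> carrier \<Gamma>" using H'(1) h(1) by (rule subgroup.mem_carrier)
  have xc: "?x \<in> carrier \<Gamma>" and yc: "?y \<in> carrier \<Gamma>" by simp_all
  have "h = ?x"
  proof (rule vertex_eqI[OF hc xc])
    show "h <#\<^bsub>\<Gamma>\<^esub> one.H = ?x <#\<^bsub>\<Gamma>\<^esub> one.H"
      using translation_one(1)[OF hc] translation_one(1)[OF xc] h(2) by simp
    have "?x <#\<^bsub>\<Gamma>\<^esub> two.H = \<one>\<^bsub>\<Gamma>\<^esub> <#\<^bsub>\<Gamma>\<^esub> two.H"
      using two.coset_mult_H[OF one.G.one_closed xK] by simp
    then show "h <#\<^bsub>\<Gamma>\<^esub> two.H = ?x <#\<^bsub>\<Gamma>\<^esub> two.H"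
      using translation_one(2)[OF hc] base(2) h(3) by simp
  qed
  then have triv: "left_translation \<Gamma> two.T ?x = (\<lambda>x\<in>verts two.T. x)" using h(3) by simp
  \<comment> \<open>This power shifts the first axis by N and is trivial on the second tree, so it
    translates the whole grid horizontally.\<close>
  have p1: "period (int N) 0"
  proof (rule periodI[OF xc])
    fix m n
    have "(?x \<otimes>\<^bsub>\<Gamma>\<^esub> p m n) <#\<^bsub>\<Gamma>\<^esub> one.H = left_translation \<Gamma> one.T ?x (one.line v1 m)"
      using one.translation_coset[OF xc p_closed, of m n] by (simp only: coset1)
    also have "\<dots> = (?x \<otimes>\<^bsub>\<Gamma>\<^esub> one.gi v1 [^]\<^bsub>\<Gamma>\<^esub> m) <#\<^bsub>\<Gamma>\<^esub> one.H"
      by (rule one.translation_coset[OF xc]) simp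
    also have "?x \<otimes>\<^bsub>\<Gamma>\<^esub> one.gi v1 [^]\<^bsub>\<Gamma>\<^esub> m = one.gi v1 [^]\<^bsub>\<Gamma>\<^esub> (m + int N)"
      by (simp add: one.G.int_pow_mult[symmetric] int_pow_int[symmetric] add.commute)
    finally show "(?x \<otimes>\<^bsub>\<Gamma>\<^esub> p m n) <#\<^bsub>\<Gamma>\<^esub> one.H = one.line v1 (m + int N)" .
    have "(?x \<otimes>\<^bsub>\<Gamma>\<^esub> p m n) <#\<^bsub>\<Gamma>\<^esub> two.H = left_translation \<Gamma> two.T ?x (two.line v2 n)"
      using two.translation_coset[OF xc p_closed, of m n] by (simp only: coset2)
    then show "(?x \<otimes>\<^bsub>\<Gamma>\<^esub> p m n) <#\<^bsub>\<Gamma>\<^esub> two.H = two.line v2 (n + 0)"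
      unfolding triv by simp
  qed
  have "(left_translation \<Gamma> one.T ?y, left_translation \<Gamma> two.T ?y) \<in> \<Lambda>\<^sub>1 \<times> \<Lambda>\<^sub>2"
    unfolding rep_eq[symmetric] rep[symmetric] using N'(2) by (rule imageI)
  then have "(\<lambda>x\<in>verts one.T. x, left_translation \<Gamma> two.T ?y) \<in> bmw_rep a b c d ` H'"
    unfolding rep using id by blast
  then obtain k where k: "k \<in> H'" "left_translation \<Gamma> one.T k = (\<lambda>x\<in>verts one.T. x)"
    "left_translation \<Gamma> two.T k = left_translation \<Gamma> two.T ?y" unfolding rep_eq by auto
  have kc: "k \<in> carrier \<Gamma>" using H'(1) k(1) by (rule subgroup.mem_carrier)
  have "k = ?y"
  proof (rule vertex_eqI[OF kc yc])
    show "k <#\<^bsub>\<Gamma>\<^esub> two.H = ?y <#\<^bsub>\<Gamma>\<^esub> two.H"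
      using translation_one(2)[OF kc] translation_one(2)[OF yc] k(3) by simp
    have "?y <#\<^bsub>\<Gamma>\<^esub> one.H = \<one>\<^bsub>\<Gamma>\<^esub> <#\<^bsub>\<Gamma>\<^esub> one.H"
      using one.coset_mult_H[OF one.G.one_closed yH] by simp
    then show "k <#\<^bsub>\<Gamma>\<^esub> one.H = ?y <#\<^bsub>\<Gamma>\<^esub> one.H"
      using translation_one(1)[OF kc] base(1) k(2) by simp
  qed
  then have triv': "left_translation \<Gamma> one.T ?y = (\<lambda>x\<in>verts one.T. x)" using k(2) by simp
  have p2: "period 0 (int N')"
  proof (rule periodI[OF yc])
    fix m n
    have "(?y \<otimes>\<^bsub>\<Gamma>\<^esub> p m n) <#\<^bsub>\<Gamma>\<^esub> two.H = left_translation \<Gamma> two.T ?y (two.line v2 n)"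
      using two.translation_coset[OF yc p_closed, of m n] by (simp only: coset2)
    also have "\<dots> = (?y \<otimes>\<^bsub>\<Gamma>\<^esub> two.gi v2 [^]\<^bsub>\<Gamma>\<^esub> n) <#\<^bsub>\<Gamma>\<^esub> two.H"
      by (rule two.translation_coset[OF yc]) simp
    also have "?y \<otimes>\<^bsub>\<Gamma>\<^esub> two.gi v2 [^]\<^bsub>\<Gamma>\<^esub> n = two.gi v2 [^]\<^bsub>\<Gamma>\<^esub> (n + int N')"
      by (simp add: one.G.int_pow_mult[symmetric] int_pow_int[symmetric] add.commute)
    finally show "(?y \<otimes>\<^bsub>\<Gamma>\<^esub> p m n) <#\<^bsub>\<Gamma>\<^esub> two.H = two.line v2 (n + int N')" .
    have "(?y \<otimes>\<^bsub>\<Gamma>\<^esub> p m n) <#\<^bsub>\<Gamma>\<^esub> one.H = left_translation \<Gamma> one.T ?y (one.line v1 m)"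
      using one.translation_coset[OF yc p_closed, of m n] by (simp only: coset1)
    then show "(?y \<otimes>\<^bsub>\<Gamma>\<^esub> p m n) <#\<^bsub>\<Gamma>\<^esub> one.H = one.line v1 (m + 0)"
      unfolding triv' by simp
  qed
  show False using no_periods[OF p1 p2] N(1) N'(1) by simp
qed

end

theorem theorem1p5:
  fixes scale1 :: "'f::{field,finite} \<Rightarrow> 'v1::ab_group_add \<Rightarrow> 'v1"
    and scale2 :: "'f \<Rightarrow> 'v2::ab_group_add \<Rightarrow> 'v2"
    and bs1 :: "'v1 list" and bs2 :: "'v2 list"
    and a :: "'v1 \<Rightarrow> 'v1" and b :: "'v2 \<Rightarrow> 'v1" and c :: "'v1 \<Rightarrow> 'v2" and d :: "'v2 \<Rightarrow> 'v2"
    and p :: nat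
  assumes "CHAR('f) = p"
    and "finite_dimensional_vector_space scale1 (set bs1)" and "distinct bs1"
    and "finite_dimensional_vector_space scale2 (set bs2)" and "distinct bs2"
    and "Vector_Spaces.linear scale1 scale1 a" and "Vector_Spaces.linear scale2 scale1 b"
    and "Vector_Spaces.linear scale1 scale2 c" and "Vector_Spaces.linear scale2 scale2 d"
    and "bij a" and "bij d" and "bij (\<lambda>(v1, v2). (a v1 + b v2, c v1 + d v2))"
    and "det_condition (matrix_of_map scale1 bs1 bs1 a) (matrix_of_map scale1 bs2 bs1 b)
           (matrix_of_map scale2 bs1 bs2 c) (matrix_of_map scale2 bs2 bs2 d)"
  shows "bmw_irreducible a b c d \<and>
    (\<exists>v1 v2 l1 l2 P \<T>.
       anti_torus (bmw_group a b c d) (bmw_space a b c d) (bmw_dist a b c d) (bmw_action a b c d)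
         (gen1 a b c d v1) (gen2 a b c d v2) l1 l2 P \<and>
       bmw_vertex a b c d \<one>\<^bsub>bmw_group a b c d\<^esub> \<in> l1 \<and>
       bmw_vertex a b c d \<one>\<^bsub>bmw_group a b c d\<^esub> \<in> l2 \<and>
       natural_coloring a b c d P v1 v2 \<T> \<and>
       substitution_generated UNIV p \<T> \<and>
       (\<exists>s t. 1 \<le> t \<and>
          substitution_invariant (block_colors (p ^ s) UNIV) (p ^ t) (block_tiling (p ^ s) \<T>)))"
proof -
  interpret linear_square scale1 scale2 bs1 bs2 a b c d
    by (intro linear_square.intro coordinates.intro coordinates_axioms.intro) (rule assms)+
  obtain v1 v2 u1 u2 where col: "is_coloring v1 v2 u1 u2" and aper: "\<And>N. 0 < N \<Longrightarrow> \<not> doubly_periodic N u1 u2"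
    using exists_aperiodic[OF assms(13)] by blast
  obtain q where "is_grid v1 v2 u1 u2 q" using grid_exists[OF col] by blast
  then interpret bmw_plane scale1 scale2 bs1 bs2 a b c d v1 v2 u1 u2 q
    using aper by unfold_locales
  let ?T = "\<lambda>(m, n). (u1 m n, u2 m n)"
  have p: "2 \<le> p"
    using prime_CHAR_semidom[where ?'a = 'f] finite_imp_CHAR_pos[where ?'a = 'f] prime_ge_2_nat assms(1) by auto
  have "finite (UNIV :: ('v1 \<times> 'v2) set)"
    using finite_cartesian_product[OF finite_V1 finite_V2] by simp
  then have til: "tiling UNIV ?T" by (simp add: tiling_def)
  have fin: "finite (\<Union>e. kernel_level p ?T e)" using finite_coloring_kernel[OF col] assms(1) by simp
  obtain s t where "1 \<le> t" "substitution_invariant (block_colors (p ^ s) UNIV) (p ^ t) (block_tiling (p ^ s) ?T)"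
    using block_tiling_invariant_of_finite_kernel[OF fin til p] by blast
  then have st: "\<exists>s t. 1 \<le> t \<and> substitution_invariant (block_colors (p ^ s) UNIV) (p ^ t) (block_tiling (p ^ s) ?T)"
    by blast
  have space: "bmw_space a b c d = flat.X" "bmw_dist a b c d = flat.d"
    by (simp_all add: bmw_space_def bmw_dist_def identify)
  have torus: "anti_torus (bmw_group a b c d) (bmw_space a b c d) (bmw_dist a b c d) (bmw_action a b c d)
      (gen1 a b c d v1) (gen2 a b c d v2) flat.L1 flat.L2 flat.P"
    unfolding space identify by (rule is_anti_torus)
  have origin: "bmw_vertex a b c d \<one>\<^bsub>bmw_group a b c d\<^esub> \<in> flat.L1"
    "bmw_vertex a b c d \<one>\<^bsub>bmw_group a b c d\<^esub> \<in> flat.L2"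
    unfolding identify by (rule origin_on_axes)+
  show ?thesis
    by (intro conjI irreducible exI[of _ v1] exI[of _ v2] exI[of _ flat.L1] exI[of _ flat.L2] exI[of _ flat.P]
        exI[of _ ?T] torus origin is_natural_coloring substitution_generated_of_finite_kernel[OF fin til p] st)
qed

end
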